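(* The isomorphism $\phi:\mathcal{A}^+\to\mathcal{U}(R)$ (defined in the context) provides $\mathcal{A}^+$ with a coalgebra structure, which is given by: counit: $\varepsilon(e(u))=0$, $\varepsilon(f(u))=0$, $\varepsilon(h(u))=1$; coproduct: $$\Delta(e(u))=e(u)\otimes1+\Big(h(u)\otimes e(u)+[h(u),f_0]\otimes\big(e(u)^2-\{e(u),e_0\}\big)\Big)\big(1\otimes1+X_{12}(u)\big),$$ $$X_{12}(u)=\sum_{k>0}(-1)^k\Big(f(u-1)\otimes e(u)+\big(f(u-1)^2+\{f(u-1),f_0\}\big)\otimes\big(e(u)^2-\{e(u),e_0\}\big)\Big)^k,$$ $$\Delta(f(u))=1\otimes f(u)+\Big(f(u)\otimes h(u)+\big(f(u)^2+\{f(u),f_0\}\big)\otimes[h(u),e_0]\Big)\big(1\otimes1+Y_{12}(u)\big),$$ $$Y_{12}(u)=\sum_{k>0}(-1)^k\Big(f(u)\otimes e(u+1)+\big(f(u)^2+\{f(u),f_0\}\big)\otimes\big(e(u+1)^2-\{e(u+1),e_0\}\big)\Big)^k,$$ $$\Delta(h(u))=1\otimes1+\{\Delta(e(u)),\,f_0\otimes1+1\otimes f_0\}.$$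
   Context: All algebras are associative unital $\mathbb{Z}_2$-graded algebras over $\mathbb{C}$; $[a]$ is the parity of $a$, $[a,b]=ab-ba$, $\{a,b\}=ab+ba$, and tensor products are graded: $(a\otimes\alpha)(b\otimes\beta)=(-1)^{[b][\alpha]}ab\otimes\alpha\beta$. Put $\kappa=3/2$. Series such as $f(u-1)$, $e(u+1)$ are re-expanded in powers of $u^{-1}$. The superalgebra $\mathcal{A}^+$ is generated by the unit, odd elements $e_k,f_k$ and even elements $h_k$ ($k\ge0$). With $e(u)=\sum_{k\ge0}e_ku^{-k-1}$, $f(u)=\sum_{k\ge0}f_ku^{-k-1}$, $h(u)=1+\sum_{k\ge0}h_ku^{-k-1}$, its defining relations are $$[h(u),h(v)]=0,\qquad \{e(u),f(v)\}=\frac{h(v)-h(u)}{u-v},$$ $$[h(u),e(v)]=-\frac{(u-v+\kappa-1)[h(u),e(u)-e(v)]}{(u-v)(u-v+\kappa)}+\frac{h(u)(e(v)+e(u)-e_0)-(e(u)-e_0)h(u)}{u-v+\kappa},$$ $$[h(u),f(v)]=\frac{(u-v-\kappa+1)[h(u),f(u)-f(v)]}{(u-v)(u-v-\kappa)}-\frac{h(u)(f(v)+f(u)+f_0)-(f(u)+f_0)h(u)}{u-v-\kappa},$$ $$\{e(u),e(v)\}=\frac{[e(u),e(v)]}{2(u-v)}-\frac{\{e_0,e(u)-e(v)\}}{u-v}-\frac{(e(u)-e(v))^2}{2(u-v)^2},$$ $$\{f(u),f(v)\}=-\frac{[f(u),f(v)]}{2(u-v)}-\frac{\{f_0,f(u)-f(v)\}}{u-v}-\frac{(f(u)-f(v))^2}{2(u-v)^2},$$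 $$e(u)^3=e(u)\{e(u),e_0\}+[e_0^2,e(u)],\qquad f(u)^3=-f(u)\{f(u),f_0\}+[f_0^2,f(u)].$$ The Hopf superalgebra $\mathcal{U}(R)$ (the RTT presentation of the super Yangian $Y(osp(1|2))$): indices $1,2,3$ have grades $[1]=[3]=0$, $[2]=1$; $E_{ij}$ is the elementary $3\times3$ matrix, of parity $[i]+[j]$; $\mathbb{I}$ is the $3\times3$ identity. For $A=\sum A^{ij}E_{ij}$ set $A^t=\sum_{i,j,k,l}(-1)^{[i][l]+[i]}J^{ij}A^{kj}J^{lk}E_{il}$ with $J=E_{31}+E_{22}-E_{13}$. Let $P=\sum_{i,j}(-1)^{[j]}E_{ij}\otimes E_{ji}$, let $P^{t_1}$ be obtained by applying $t$ in the first factor, and let $R_{12}(u)=\mathbb{I}\otimes\mathbb{I}+\frac{P}{u}-\frac{P^{t_1}}{u+\kappa}$ (up to a scalar factor, irrelevant in the relations below). $\mathcal{U}(R)$ is generated by the unit and the elements $L^{ij}_{(n)}$ ($1\le i,j\le3$, $n\ge1$) of parity $[i]+[j]$. With $L(u)=\mathbb{I}+\sum_{i,j}\sum_{n\ge1}L^{ij}_{(n)}u^{-n}E_{ij}=\sum_{i,j}L^{ij}(u)E_{ij}$, the relations are $R_{12}(u-v)L_1(u)L_2(v)=L_2(v)L_1(u)R_{12}(u-v)$ and $L^t(u-\kappa)L(u)=\mathbb{I}$. Here $L_1(u)=\sum L^{ij}(u)E_{ij}\otimes\mathbb{I}$, $L_2(v)=\sum L^{ij}(v)\,\mathbb{I}\otimes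 E_{ij}$; the algebra entries $L^{ij}$ are multiplied in the written order and commute (without sign) with the matrices $E_{kl}$, while products in $\mathrm{End}(\mathbb{C}^3)\otimes\mathrm{End}(\mathbb{C}^3)$ use the graded tensor product. The coalgebra structure of $\mathcal{U}(R)$ is $\Delta(L^{ij}(u))=\sum_kL^{ik}(u)\otimes L^{kj}(u)$, $\varepsilon(L^{ij}(u))=\delta_{ij}$. The map $\phi$ is the algebra isomorphism $\mathcal{A}^+\to\mathcal{U}(R)$ given by $e(-u)\mapsto L^{33}(u)^{-1}L^{23}(u)$, $f(-u)\mapsto L^{32}(u)L^{33}(u)^{-1}$, $h(-u)\mapsto L^{22}(u)L^{33}(u)^{-1}+L^{32}(u)L^{33}(u)^{-1}L^{23}(u)L^{33}(u)^{-1}$. The structure on $\mathcal{A}^+$ provided by $\phi$ is the one determined by $\Delta_{\mathcal{U}(R)}\circ\phi=(\phi\otimes\phi)\circ\Delta_{\mathcal{A}^+}$ and $\varepsilon_{\mathcal{A}^+}=\varepsilon_{\mathcal{U}(R)}\circ\phi$. *)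

theory Defs
  imports
    "HOL-Analysis.Analysis"
    "HOL-Computational_Algebra.Formal_Laurent_Series"
    "HOL-Library.Poly_Mapping"
    "HOL-Library.Numeral_Type"
begin

section \<open>Complex superalgebras\<close>

class complex_space = ab_group_add +
  fixes scaleC :: "complex \<Rightarrow> 'a \<Rightarrow> 'a" (infixr \<open>*\<^sub>C\<close> 75)
  assumes scaleC_add_right: "c *\<^sub>C (x + y) = c *\<^sub>C x + c *\<^sub>C y"
    and scaleC_add_left: "(c + d) *\<^sub>C x = c *\<^sub>C x + d *\<^sub>C x"
    and scaleC_scaleC: "c *\<^sub>C d *\<^sub>C x = (c * d) *\<^sub>C x"
    and scaleC_one: "1 *\<^sub>C x = x"
begin

lemma scaleC_zero_left [simp]: "0 *\<^sub>C x = 0"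
  using scaleC_add_left[of 0 0 x] by simp

lemma scaleC_zero_right [simp]: "c *\<^sub>C 0 = 0"
  using scaleC_add_right[of c 0 0] by simp

lemma scaleC_minus_left: "(- c) *\<^sub>C x = - (c *\<^sub>C x)"
  using scaleC_add_left[of "- c" c x] by (simp add: eq_neg_iff_add_eq_0)

lemma scaleC_minus_right: "c *\<^sub>C (- x) = - (c *\<^sub>C x)"
  using scaleC_add_right[of c "- x" x] by (simp add: eq_neg_iff_add_eq_0)

lemma scaleC_diff_right: "c *\<^sub>C (x - y) = c *\<^sub>C x - c *\<^sub>C y"
  using scaleC_add_right[of c x "- y"] by (simp add: scaleC_minus_right)

lemma scaleC_sum: "c *\<^sub>C sum f A = (\<Sum>i\<in>A. c *\<^sub>C f i)"
  by (induction A rule: infinite_finite_induct) (simp_all add: scaleC_add_right)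

end

class complex_algebra = ring_1 + complex_space +
  assumes mult_scaleC_left: "(c *\<^sub>C x) * y = c *\<^sub>C (x * y)"
    and mult_scaleC_right: "x * (c *\<^sub>C y) = c *\<^sub>C (x * y)"

text \<open>\<open>homog False\<close> is the even part and \<open>homog True\<close> the odd part; parities add as \<open>p \<noteq> q\<close>.\<close>

class superalgebra = complex_algebra +
  fixes homog :: "bool \<Rightarrow> 'a set"
  assumes homog_zero: "0 \<in> homog p"
    and homog_add: "x \<in> homog p \<Longrightarrow> y \<in> homog p \<Longrightarrow> x + y \<in> homog p"
    and homog_scaleC: "x \<in> homog p \<Longrightarrow> c *\<^sub>C x \<in> homog p"
    and homog_one: "1 \<in> homog False"
    and homog_mult: "x \<in> homog p \<Longrightarrow> y \<in> homog q \<Longrightarrow> x * y \<in> homog (p \<noteq> q)"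
    and homog_decomp: "\<exists>x0\<in>homog False. \<exists>x1\<in>homog True. x = x0 + x1"
    and homog_indep: "x \<in> homog False \<Longrightarrow> x \<in> homog True \<Longrightarrow> x = 0"
begin

lemma homog_uminus: "x \<in> homog p \<Longrightarrow> - x \<in> homog p"
  using homog_scaleC[of x p "-1"] by (simp add: scaleC_minus_left scaleC_one)

lemma homog_diff: "x \<in> homog p \<Longrightarrow> y \<in> homog p \<Longrightarrow> x - y \<in> homog p"
  using homog_add[OF _ homog_uminus, of x p y] by simp

definition hpart :: "bool \<Rightarrow> 'a \<Rightarrow> 'a" where
  "hpart p x = (THE y. y \<in> homog p \<and> x - y \<in> homog (\<not> p))"

lemma hpart_eqI:
  assumes "y \<in> homog p" "x - y \<in> homog (\<not> p)"
  shows "hpart p x = y"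
  unfolding hpart_def
proof (rule the_equality)
  fix z assume z: "z \<in> homog p \<and> x - z \<in> homog (\<not> p)"
  have "y - z \<in> homog p" using assms z homog_diff by blast
  moreover have "y - z = (x - z) - (x - y)" by (simp add: algebra_simps)
  hence "y - z \<in> homog (\<not> p)" using assms z homog_diff by metis
  ultimately have "y - z = 0" using homog_indep by (cases p) auto
  thus "z = y" by simp
qed (use assms in auto)

lemma hpart_props: "hpart p x \<in> homog p \<and> x - hpart p x \<in> homog (\<not> p)"
proof -
  obtain x0 x1 where x: "x0 \<in> homog False" "x1 \<in> homog True" "x = x0 + x1"
    using homog_decomp by blast
  have "\<exists>y. y \<in> homog p \<and> x - y \<in> homog (\<not> p)"
    by (cases p) (use x in \<open>auto intro: exI[of _ x0] exI[of _ x1]\<close>)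
  thus ?thesis using hpart_eqI by metis
qed

lemma hpart_homog: "hpart p x \<in> homog p"
  and diff_hpart_homog: "x - hpart p x \<in> homog (\<not> p)"
  using hpart_props by auto

lemma hpart_sum: "hpart False x + hpart True x = x"
proof -
  have "hpart True x = x - hpart False x"
    by (rule hpart_eqI) (use hpart_props[of False x] in \<open>auto simp: algebra_simps\<close>)
  thus ?thesis by (simp add: algebra_simps)
qed

lemma hpart_same: "x \<in> homog p \<Longrightarrow> hpart p x = x"
  by (rule hpart_eqI) (auto simp: homog_zero)

lemma hpart_other: "x \<in> homog (\<not> p) \<Longrightarrow> hpart p x = 0"
  by (rule hpart_eqI) (auto simp: homog_zero)

lemma hpart_add: "hpart p (x + y) = hpart p x + hpart p y"
proof (rule hpart_eqI)
  show "hpart p x + hpart p y \<in> homog p" by (simp add: homog_add hpart_homog)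
  have "x + y - (hpart p x + hpart p y) = (x - hpart p x) + (y - hpart p y)"
    by (simp add: algebra_simps)
  thus "x + y - (hpart p x + hpart p y) \<in> homog (\<not> p)"
    using homog_add diff_hpart_homog by metis
qed

lemma hpart_scaleC: "hpart p (c *\<^sub>C x) = c *\<^sub>C hpart p x"
proof (rule hpart_eqI)
  show "c *\<^sub>C hpart p x \<in> homog p" by (simp add: homog_scaleC hpart_homog)
  show "c *\<^sub>C x - c *\<^sub>C hpart p x \<in> homog (\<not> p)"
    using homog_scaleC[OF diff_hpart_homog, of c x p] by (simp add: scaleC_diff_right)
qed

end

instantiation complex :: superalgebra
begin

definition scaleC_complex :: "complex \<Rightarrow> complex \<Rightarrow> complex" where
  "scaleC_complex c x = c * x"

definition homog_complex :: "bool \<Rightarrow> complex set" where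
  "homog_complex p = (if p then {0} else UNIV)"

instance
  by standard (auto simp: scaleC_complex_def homog_complex_def algebra_simps split: if_splits)

end

definition complex_linear :: "('a::complex_space \<Rightarrow> 'b::complex_space) \<Rightarrow> bool" where
  "complex_linear f \<longleftrightarrow> (\<forall>x y. f (x + y) = f x + f y) \<and> (\<forall>c x. f (c *\<^sub>C x) = c *\<^sub>C f x)"

definition superalgebra_hom :: "('a::superalgebra \<Rightarrow> 'b::superalgebra) \<Rightarrow> bool" where
  "superalgebra_hom f \<longleftrightarrow> complex_linear f \<and> f 1 = 1 \<and> (\<forall>x y. f (x * y) = f x * f y) \<and>
     (\<forall>p. f ` homog p \<subseteq> homog p)"

definition superalgebra_iso :: "('a::superalgebra \<Rightarrow> 'b::superalgebra) \<Rightarrow> bool" where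
  "superalgebra_iso f \<longleftrightarrow> superalgebra_hom f \<and> bij f"


section \<open>The graded tensor product\<close>

instantiation poly_mapping :: (type, complex_space) complex_space
begin

definition scaleC_poly_mapping :: "complex \<Rightarrow> ('a \<Rightarrow>\<^sub>0 'b) \<Rightarrow> 'a \<Rightarrow>\<^sub>0 'b" where
  "scaleC_poly_mapping c = Poly_Mapping.map (scaleC c)"

lemma lookup_scaleC [simp]: "Poly_Mapping.lookup (c *\<^sub>C f) k = c *\<^sub>C Poly_Mapping.lookup f k"
  unfolding scaleC_poly_mapping_def by (simp add: Poly_Mapping.map.rep_eq when_def)

instance
  by standard
     (auto intro!: poly_mapping_eqI simp: lookup_add scaleC_add_right scaleC_add_left
        scaleC_scaleC scaleC_one)

end

text \<open>The tensor product of vector spaces is the free vector space on pairs modulo the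
  bilinearity relations.\<close>

inductive_set bilinear_relations ::
    "(('a::complex_space \<times> 'b::complex_space) \<Rightarrow>\<^sub>0 complex) set" where
  zero: "0 \<in> bilinear_relations"
| add: "x \<in> bilinear_relations \<Longrightarrow> y \<in> bilinear_relations \<Longrightarrow> x + y \<in> bilinear_relations"
| add_left: "Poly_Mapping.single (a + a', b) c - Poly_Mapping.single (a, b) c
     - Poly_Mapping.single (a', b) c \<in> bilinear_relations"
| add_right: "Poly_Mapping.single (a, b + b') c - Poly_Mapping.single (a, b) c
     - Poly_Mapping.single (a, b') c \<in> bilinear_relations"
| scale_left: "Poly_Mapping.single (d *\<^sub>C a, b) c - Poly_Mapping.single (a, b) (d * c)
     \<in> bilinear_relations"
| scale_right: "Poly_Mapping.single (a, d *\<^sub>C b) c - Poly_Mapping.single (a, b) (d * c)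
     \<in> bilinear_relations"

lemma scaleC_single: "d *\<^sub>C Poly_Mapping.single k (c::'b::complex_space) = Poly_Mapping.single k (d *\<^sub>C c)"
  by (rule poly_mapping_eqI) (simp add: lookup_single when_def)

lemma bilinear_relations_scaleC:
  "x \<in> bilinear_relations \<Longrightarrow> d *\<^sub>C x \<in> bilinear_relations"
proof (induction rule: bilinear_relations.induct)
  case (scale_left d' a b c)
  show ?case
    using bilinear_relations.scale_left[of d' a b "d * c"]
    by (simp add: scaleC_diff_right scaleC_single scaleC_complex_def mult.left_commute)
next
  case (scale_right a d' b c)
  show ?case
    using bilinear_relations.scale_right[of a d' b "d * c"]
    by (simp add: scaleC_diff_right scaleC_single scaleC_complex_def mult.left_commute)
qed (simp_all add: bilinear_relations.intros scaleC_add_right scaleC_diff_right scaleC_single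
      scaleC_complex_def)

lemma bilinear_relations_uminus:
  "x \<in> bilinear_relations \<Longrightarrow> - x \<in> bilinear_relations"
  using bilinear_relations_scaleC[of x "-1"] by (simp add: scaleC_minus_left scaleC_one)

definition tensor_cong ::
    "(('a::complex_space \<times> 'b::complex_space) \<Rightarrow>\<^sub>0 complex) \<Rightarrow> ('a \<times> 'b \<Rightarrow>\<^sub>0 complex) \<Rightarrow> bool" where
  "tensor_cong x y \<longleftrightarrow> x - y \<in> bilinear_relations"

lemma tensor_cong_equivp:
  "equivp (tensor_cong :: (('a::complex_space \<times> 'b::complex_space) \<Rightarrow>\<^sub>0 complex) \<Rightarrow> _)"
    (is "equivp ?R")
proof (rule equivpI)
  show "reflp ?R"
    by (auto simp: reflp_def tensor_cong_def bilinear_relations.zero)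
  show "symp ?R"
    unfolding symp_def tensor_cong_def using bilinear_relations_uminus minus_diff_eq by metis
  have "x - z \<in> bilinear_relations"
    if "x - y \<in> bilinear_relations" "y - z \<in> bilinear_relations"
    for x y z :: "('a \<times> 'b) \<Rightarrow>\<^sub>0 complex"
    using bilinear_relations.add[OF that] by simp
  thus "transp ?R"
    unfolding transp_def tensor_cong_def by blast
qed

quotient_type (overloaded) ('a, 'b) tensor =
  "('a::complex_space \<times> 'b::complex_space) \<Rightarrow>\<^sub>0 complex" / tensor_cong
  by (rule tensor_cong_equivp)

instantiation tensor :: (complex_space, complex_space) complex_space
begin

lift_definition zero_tensor :: "('a, 'b) tensor" is 0 .

lift_definition plus_tensor :: "('a, 'b) tensor \<Rightarrow> ('a, 'b) tensor \<Rightarrow> ('a, 'b) tensor" is "(+)"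
  unfolding tensor_cong_def by (subst add_diff_add) (rule bilinear_relations.add)

lift_definition uminus_tensor :: "('a, 'b) tensor \<Rightarrow> ('a, 'b) tensor" is uminus
  unfolding tensor_cong_def by (subst minus_diff_minus) (rule bilinear_relations_uminus)

definition minus_tensor :: "('a, 'b) tensor \<Rightarrow> ('a, 'b) tensor \<Rightarrow> ('a, 'b) tensor" where
  "minus_tensor x y = x + - y"

lift_definition scaleC_tensor :: "complex \<Rightarrow> ('a, 'b) tensor \<Rightarrow> ('a, 'b) tensor" is scaleC
  unfolding tensor_cong_def by (subst scaleC_diff_right[symmetric]) (rule bilinear_relations_scaleC)

instance
proof
  fix a b c :: "('a, 'b) tensor" and d e :: complex
  have refl: "tensor_cong x x" for x :: "('a \<times> 'b) \<Rightarrow>\<^sub>0 complex"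
    by (simp add: tensor_cong_def bilinear_relations.zero)
  show "a + b + c = a + (b + c)" by transfer (simp add: add.assoc refl)
  show "a + b = b + a" by transfer (simp add: add.commute refl)
  show "0 + a = a" by transfer (simp add: refl)
  show "- a + a = 0" by transfer (simp add: refl)
  show "a - b = a + - b" by (simp add: minus_tensor_def)
  show "d *\<^sub>C (a + b) = d *\<^sub>C a + d *\<^sub>C b" by transfer (simp add: scaleC_add_right refl)
  show "(d + e) *\<^sub>C a = d *\<^sub>C a + e *\<^sub>C a" by transfer (simp add: scaleC_add_left refl)
  show "d *\<^sub>C e *\<^sub>C a = (d * e) *\<^sub>C a" by transfer (simp add: scaleC_scaleC refl)
  show "1 *\<^sub>C a = a" by transfer (simp add: scaleC_one refl)
qed

end

lift_definition tensor_pure :: "'a::complex_space \<Rightarrow> 'b::complex_space \<Rightarrow> ('a, 'b) tensor"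
    (infixr \<open>\<otimes>\<close> 76)
  is "\<lambda>a b. Poly_Mapping.single (a, b) 1" .

lemma tensor_eqI: "x - y \<in> bilinear_relations \<Longrightarrow> abs_tensor x = abs_tensor y"
  by (simp add: tensor.abs_eq_iff tensor_cong_def)

lemma abs_tensor_plus: "abs_tensor (x + y) = abs_tensor x + abs_tensor y"
  by (simp add: plus_tensor.abs_eq)

lemma abs_tensor_single: "abs_tensor (Poly_Mapping.single (a, b) c) = c *\<^sub>C (a \<otimes> b)"
  by (simp add: tensor_pure.abs_eq scaleC_tensor.abs_eq scaleC_single scaleC_complex_def)

lemma tensor_add_left: "(a + a') \<otimes> b = a \<otimes> b + a' \<otimes> b"
  using bilinear_relations.add_left[of a a' b 1]
  by (simp add: tensor_pure.abs_eq flip: abs_tensor_plus) (rule tensor_eqI, simp add: diff_diff_eq)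

lemma tensor_add_right: "a \<otimes> (b + b') = a \<otimes> b + a \<otimes> b'"
  using bilinear_relations.add_right[of a b b' 1]
  by (simp add: tensor_pure.abs_eq flip: abs_tensor_plus) (rule tensor_eqI, simp add: diff_diff_eq)

lemma tensor_scaleC_left: "(c *\<^sub>C a) \<otimes> b = c *\<^sub>C (a \<otimes> b)"
  using bilinear_relations.scale_left[of c a b 1]
  by (simp flip: abs_tensor_single) (simp add: tensor_pure.abs_eq tensor_eqI)

lemma tensor_scaleC_right: "a \<otimes> (c *\<^sub>C b) = c *\<^sub>C (a \<otimes> b)"
  using bilinear_relations.scale_right[of a c b 1]
  by (simp flip: abs_tensor_single) (simp add: tensor_pure.abs_eq tensor_eqI)

lemma tensor_zero_left [simp]: "0 \<otimes> b = 0"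
  using tensor_add_left[of 0 0 b] by simp

lemma tensor_zero_right [simp]: "a \<otimes> 0 = 0"
  using tensor_add_right[of a 0 0] by simp

lemma poly_mapping_single_induct [case_names zero single add]:
  assumes "P 0" "\<And>k c. P (Poly_Mapping.single k c)" "\<And>x y. P x \<Longrightarrow> P y \<Longrightarrow> P (x + y)"
  shows "P (x :: 'k \<Rightarrow>\<^sub>0 'c::comm_monoid_add)"
proof (induction x rule: Poly_Mapping.update_induct)
  case (update f a b)
  have "Poly_Mapping.update a b f = f + Poly_Mapping.single a b"
    using update(1) by (intro poly_mapping_eqI)
      (auto simp: lookup_update lookup_add lookup_single when_def in_keys_iff)
  thus ?case using assms update by simp
qed (fact assms)

lemma tensor_induct [case_names pure add]:
  assumes "\<And>a b. P (a \<otimes> b)" "\<And>x y. P x \<Longrightarrow> P y \<Longrightarrow> P (x + y)"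
  shows "P t"
proof -
  have "P (abs_tensor x)" for x
  proof (induction x rule: poly_mapping_single_induct)
    case zero
    show ?case using assms(1)[of 0 0] by (simp add: zero_tensor.abs_eq[symmetric])
  next
    case (single k c)
    show ?case using assms(1)[of "c *\<^sub>C fst k" "snd k"]
      by (cases k) (simp add: abs_tensor_single tensor_scaleC_left)
  next
    case (add x y)
    thus ?case by (simp add: abs_tensor_plus assms(2))
  qed
  thus ?thesis by (metis Quotient3_abs_rep Quotient3_tensor)
qed

definition bilinear_map ::
    "('a::complex_space \<Rightarrow> 'b::complex_space \<Rightarrow> 'c::complex_space) \<Rightarrow> bool" where
  "bilinear_map f \<longleftrightarrow> (\<forall>a. complex_linear (f a)) \<and> (\<forall>b. complex_linear (\<lambda>a. f a b))"

text \<open>The linear map \<open>a \<otimes> b \<mapsto> f a b\<close>, for bilinear \<open>f\<close>.\<close>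

definition tensor_lift ::
    "('a::complex_space \<Rightarrow> 'b::complex_space \<Rightarrow> 'c::complex_space) \<Rightarrow> ('a, 'b) tensor \<Rightarrow> 'c" where
  "tensor_lift f t = (\<Sum>k\<in>Poly_Mapping.keys (rep_tensor t).
     Poly_Mapping.lookup (rep_tensor t) k *\<^sub>C f (fst k) (snd k))"

context
  fixes f :: "'a::complex_space \<Rightarrow> 'b::complex_space \<Rightarrow> 'c::complex_space"
begin

private definition raw :: "('a \<times> 'b \<Rightarrow>\<^sub>0 complex) \<Rightarrow> 'c" where
  "raw x = (\<Sum>k\<in>Poly_Mapping.keys x. Poly_Mapping.lookup x k *\<^sub>C f (fst k) (snd k))"

private lemma raw_add: "raw (x + y) = raw x + raw y"
  unfolding raw_def by (rule setsum_keys_plus_distrib) (auto simp: scaleC_add_left)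

private lemma raw_single: "raw (Poly_Mapping.single (a, b) c) = c *\<^sub>C f a b"
  by (simp add: raw_def)

private lemma raw_zero: "raw 0 = 0"
  by (simp add: raw_def)

private lemma raw_diff: "raw (x - y) = raw x - raw y"
  using raw_add[of "x - y" y] by simp

private lemma raw_relations:
  assumes "bilinear_map f" "x \<in> bilinear_relations"
  shows "raw x = 0"
  using assms(2)
  by (induction rule: bilinear_relations.induct)
     (use assms(1) in \<open>auto simp: raw_zero raw_add raw_diff raw_single bilinear_map_def
        complex_linear_def scaleC_add_right scaleC_scaleC mult.commute\<close>)

private lemma tensor_lift_abs:
  assumes "bilinear_map f"
  shows "tensor_lift f (abs_tensor x) = raw x"
proof -
  have "tensor_cong x (rep_tensor (abs_tensor x))"
    by (metis Quotient3_tensor Quotient3_def tensor_cong_equivp equivp_reflp tensor.abs_eq_iff)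
  hence "raw (x - rep_tensor (abs_tensor x)) = 0"
    using raw_relations[OF assms] by (auto simp: tensor_cong_def)
  hence "raw x = raw (rep_tensor (abs_tensor x))" by (simp add: raw_diff)
  thus ?thesis by (simp add: tensor_lift_def raw_def)
qed

lemma tensor_lift_pure:
  assumes "bilinear_map f"
  shows "tensor_lift f (a \<otimes> b) = f a b"
  by (simp add: tensor_pure.abs_eq tensor_lift_abs[OF assms] raw_single scaleC_one)

lemma tensor_lift_add:
  assumes "bilinear_map f"
  shows "tensor_lift f (s + t) = tensor_lift f s + tensor_lift f t"
proof -
  have "tensor_lift f (abs_tensor x + abs_tensor y)
      = tensor_lift f (abs_tensor x) + tensor_lift f (abs_tensor y)" for x y
    by (simp add: tensor_lift_abs[OF assms] raw_add flip: abs_tensor_plus)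
  thus ?thesis by (metis Quotient3_abs_rep Quotient3_tensor)
qed

end

lemma tensor_lift_scaleC:
  assumes "bilinear_map f"
  shows "tensor_lift f (c *\<^sub>C t) = c *\<^sub>C tensor_lift f t"
proof (induction t rule: tensor_induct)
  case (pure a b)
  have "complex_linear (\<lambda>a. f a b)" using assms by (simp add: bilinear_map_def)
  thus ?case
    by (simp add: tensor_lift_pure[OF assms] complex_linear_def flip: tensor_scaleC_left)
qed (simp add: scaleC_add_right tensor_lift_add[OF assms])

lemma tensor_lift_linear: "bilinear_map f \<Longrightarrow> complex_linear (tensor_lift f)"
  by (simp add: complex_linear_def tensor_lift_add tensor_lift_scaleC)

lemma tensor_lift_zero: "bilinear_map f \<Longrightarrow> tensor_lift f 0 = 0"
  using tensor_lift_add[of f 0 0] by simp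

lemma tensor_lift_sum_fun:
  assumes "bilinear_map f" "bilinear_map g"
  shows "bilinear_map (\<lambda>a b. f a b + g a b)"
    and "tensor_lift (\<lambda>a b. f a b + g a b) t = tensor_lift f t + tensor_lift g t"
proof -
  show *: "bilinear_map (\<lambda>a b. f a b + g a b)"
    using assms by (auto simp: bilinear_map_def complex_linear_def scaleC_add_right algebra_simps)
  show "tensor_lift (\<lambda>a b. f a b + g a b) t = tensor_lift f t + tensor_lift g t"
    by (induction t rule: tensor_induct)
       (simp_all add: tensor_lift_pure tensor_lift_add * assms algebra_simps)
qed

lemma tensor_lift_scale_fun:
  assumes "bilinear_map f"
  shows "bilinear_map (\<lambda>a b. c *\<^sub>C f a b)"
    and "tensor_lift (\<lambda>a b. c *\<^sub>C f a b) t = c *\<^sub>C tensor_lift f t"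
proof -
  show *: "bilinear_map (\<lambda>a b. c *\<^sub>C f a b)"
    using assms
    by (auto simp: bilinear_map_def complex_linear_def scaleC_add_right scaleC_scaleC mult.commute)
  show "tensor_lift (\<lambda>a b. c *\<^sub>C f a b) t = c *\<^sub>C tensor_lift f t"
    by (induction t rule: tensor_induct)
       (simp_all add: tensor_lift_pure tensor_lift_add * assms scaleC_add_right)
qed

definition koszul_sign :: "bool \<Rightarrow> bool \<Rightarrow> complex" where
  "koszul_sign p q = (if p \<and> q then -1 else 1)"

text \<open>The product of \<open>a \<otimes> \<alpha>\<close> and \<open>b \<otimes> \<beta>\<close>: the rule for homogeneous \<open>\<alpha>\<close>, \<open>b\<close>
  (lemma \<open>tensor_mult_homog\<close> below), extended linearly.\<close>

definition graded_mult ::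
    "'a::superalgebra \<Rightarrow> 'b::superalgebra \<Rightarrow> 'a \<Rightarrow> 'b \<Rightarrow> ('a, 'b) tensor" where
  "graded_mult a \<alpha> b \<beta> = (\<Sum>p\<in>UNIV. \<Sum>q\<in>UNIV. koszul_sign p q *\<^sub>C ((a * hpart p b) \<otimes> (hpart q \<alpha> * \<beta>)))"

lemma graded_mult_bilinear_right: "bilinear_map (graded_mult a \<alpha>)"
  by (simp add: bilinear_map_def complex_linear_def graded_mult_def UNIV_bool hpart_add hpart_scaleC
      tensor_add_left tensor_add_right distrib_left distrib_right mult_scaleC_left mult_scaleC_right
      tensor_scaleC_left tensor_scaleC_right scaleC_add_right scaleC_scaleC mult.commute)

lemma graded_mult_bilinear_left: "bilinear_map (\<lambda>a \<alpha>. graded_mult a \<alpha> b \<beta>)"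
  by (simp add: bilinear_map_def complex_linear_def graded_mult_def UNIV_bool hpart_add hpart_scaleC
      tensor_add_left tensor_add_right distrib_left distrib_right mult_scaleC_left mult_scaleC_right
      tensor_scaleC_left tensor_scaleC_right scaleC_add_right scaleC_scaleC mult.commute)

lemma graded_mult_homog:
  assumes "\<alpha> \<in> homog q" "b \<in> homog p"
  shows "graded_mult a \<alpha> b \<beta> = koszul_sign p q *\<^sub>C ((a * b) \<otimes> (\<alpha> * \<beta>))"
  using assms by (cases p; cases q) (simp_all add: graded_mult_def UNIV_bool hpart_same hpart_other)

definition tensor_mult_pure ::
    "'a::superalgebra \<Rightarrow> 'b::superalgebra \<Rightarrow> ('a, 'b) tensor \<Rightarrow> ('a, 'b) tensor" where
  "tensor_mult_pure a \<alpha> = tensor_lift (graded_mult a \<alpha>)"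

lemma tensor_mult_pure_bilinear: "bilinear_map (\<lambda>a \<alpha>. tensor_mult_pure a \<alpha> t)"
proof (induction t rule: tensor_induct)
  case (pure b \<beta>)
  show ?case
    by (simp add: tensor_mult_pure_def tensor_lift_pure graded_mult_bilinear_right
        graded_mult_bilinear_left)
next
  case (add x y)
  thus ?case
    by (simp add: tensor_mult_pure_def tensor_lift_add graded_mult_bilinear_right
        tensor_lift_sum_fun)
qed

inductive_set tensor_homog :: "bool \<Rightarrow> ('a::superalgebra, 'b::superalgebra) tensor set" for r where
  zero: "0 \<in> tensor_homog r"
| pure: "a \<in> homog p \<Longrightarrow> b \<in> homog q \<Longrightarrow> r = (p \<noteq> q) \<Longrightarrow> a \<otimes> b \<in> tensor_homog r"
| add: "x \<in> tensor_homog r \<Longrightarrow> y \<in> tensor_homog r \<Longrightarrow> x + y \<in> tensor_homog r"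

lemma tensor_induct_homog [case_names pure add]:
  assumes pure: "\<And>a b p q. a \<in> homog p \<Longrightarrow> b \<in> homog q \<Longrightarrow> P (a \<otimes> b)"
    and add: "\<And>x y. P x \<Longrightarrow> P y \<Longrightarrow> P (x + y)"
  shows "P (t :: ('a::superalgebra, 'b::superalgebra) tensor)"
proof (induction t rule: tensor_induct)
  case (pure a b)
  have "a \<otimes> b = (hpart False a \<otimes> hpart False b + hpart False a \<otimes> hpart True b)
      + (hpart True a \<otimes> hpart False b + hpart True a \<otimes> hpart True b)"
    by (simp add: hpart_sum flip: tensor_add_left tensor_add_right)
  thus ?case using assms hpart_homog by metis
qed (fact add)

lemma exists_unital_functional:
  "\<exists>f :: 'a::complex_algebra \<Rightarrow> complex. complex_linear f \<and> f 1 = 1"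
proof -
  interpret A: vector_space "scaleC :: complex \<Rightarrow> 'a \<Rightarrow> 'a"
    by standard (simp_all add: scaleC_add_left scaleC_add_right scaleC_scaleC scaleC_one)
  interpret C: vector_space "(*) :: complex \<Rightarrow> complex \<Rightarrow> complex"
    by standard (simp_all add: algebra_simps)
  interpret AC: vector_space_pair "scaleC :: complex \<Rightarrow> 'a \<Rightarrow> 'a" "(*) :: complex \<Rightarrow> complex \<Rightarrow> complex"
    by standard
  have "A.independent {1}"
    by (simp add: A.independent_insert)
  then obtain g :: "'a \<Rightarrow> complex" where g: "Vector_Spaces.linear scaleC (*) g" "\<forall>x\<in>{1}. g x = (1::complex)"
    using AC.linear_independent_extend[of "{1}" "\<lambda>_. 1"] by blast
  interpret g: Vector_Spaces.linear "scaleC :: complex \<Rightarrow> 'a \<Rightarrow> 'a" "(*) :: complex \<Rightarrow> complex \<Rightarrow> complex" g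
    by (fact g)
  show ?thesis
    using g(2) by (intro exI[of _ g]) (simp add: complex_linear_def scaleC_complex_def g.add g.scale)
qed

instantiation tensor :: (superalgebra, superalgebra) superalgebra
begin

definition one_tensor :: "('a, 'b) tensor" where "one_tensor = 1 \<otimes> 1"

definition times_tensor :: "('a, 'b) tensor \<Rightarrow> ('a, 'b) tensor \<Rightarrow> ('a, 'b) tensor" where
  "times_tensor s t = tensor_lift (\<lambda>a \<alpha>. tensor_mult_pure a \<alpha> t) s"

definition homog_tensor :: "bool \<Rightarrow> ('a, 'b) tensor set" where "homog_tensor = tensor_homog"

lemma times_tensor_pure: "(a \<otimes> \<alpha>) * t = tensor_mult_pure a \<alpha> t"
  unfolding times_tensor_def by (rule tensor_lift_pure[OF tensor_mult_pure_bilinear])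

lemma tensor_mult_homog:
  assumes "\<alpha> \<in> homog q" "b \<in> homog p"
  shows "(a \<otimes> \<alpha>) * (b \<otimes> \<beta>) = koszul_sign p q *\<^sub>C ((a * b) \<otimes> (\<alpha> * \<beta>))"
  by (simp add: times_tensor_pure tensor_mult_pure_def tensor_lift_pure
      graded_mult_bilinear_right graded_mult_homog[OF assms])

lemma times_tensor_add_left: "(s + s') * t = s * t + s' * (t :: ('a, 'b) tensor)"
  by (simp add: times_tensor_def tensor_lift_add tensor_mult_pure_bilinear)

lemma times_tensor_add_right: "s * (t + t') = s * t + s * (t' :: ('a, 'b) tensor)"
  by (induction s rule: tensor_induct)
     (simp_all add: times_tensor_pure times_tensor_add_left tensor_mult_pure_def tensor_lift_add
       graded_mult_bilinear_right algebra_simps)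

lemma times_tensor_scaleC_left: "(c *\<^sub>C s) * t = c *\<^sub>C (s * (t :: ('a, 'b) tensor))"
  by (simp add: times_tensor_def tensor_lift_scaleC tensor_mult_pure_bilinear)

lemma times_tensor_scaleC_right: "s * (c *\<^sub>C t) = c *\<^sub>C (s * (t :: ('a, 'b) tensor))"
  by (induction s rule: tensor_induct)
     (simp_all add: times_tensor_pure times_tensor_add_left tensor_mult_pure_def
       graded_mult_bilinear_right tensor_lift_scaleC scaleC_add_right)

lemma times_tensor_assoc: "s * t * u = s * (t * (u :: ('a, 'b) tensor))"
proof (induction s rule: tensor_induct_homog)
  case s: (pure a \<alpha> p1 q1)
  show ?case
  proof (induction t rule: tensor_induct_homog)
    case t: (pure b \<beta> p2 q2)
    show ?case
    proof (induction u rule: tensor_induct_homog)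
      case u: (pure c \<gamma> p3 q3)
      have "a \<otimes> \<alpha> * b \<otimes> \<beta> * c \<otimes> \<gamma>
          = (koszul_sign p2 q1 * koszul_sign p3 (q1 \<noteq> q2)) *\<^sub>C ((a * b * c) \<otimes> (\<alpha> * \<beta> * \<gamma>))"
        by (simp add: tensor_mult_homog[OF s(2) t(1)] times_tensor_scaleC_left
            tensor_mult_homog[OF homog_mult[OF s(2) t(2)] u(1)] scaleC_scaleC)
      moreover have "a \<otimes> \<alpha> * (b \<otimes> \<beta> * c \<otimes> \<gamma>)
          = (koszul_sign p3 q2 * koszul_sign (p2 \<noteq> p3) q1) *\<^sub>C ((a * b * c) \<otimes> (\<alpha> * \<beta> * \<gamma>))"
        by (simp add: tensor_mult_homog[OF t(2) u(1)] times_tensor_scaleC_right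
            tensor_mult_homog[OF s(2) homog_mult[OF t(1) u(1)]] scaleC_scaleC mult.assoc)
      moreover have "koszul_sign p2 q1 * koszul_sign p3 (q1 \<noteq> q2)
          = koszul_sign p3 q2 * koszul_sign (p2 \<noteq> p3) q1"
        by (auto simp: koszul_sign_def)
      ultimately show ?case by simp
    qed (simp add: times_tensor_add_right)
  qed (simp add: times_tensor_add_right times_tensor_add_left)
qed (simp add: times_tensor_add_left)

lemma tensor_homog_decomp:
  "\<exists>x0\<in>tensor_homog False. \<exists>x1\<in>tensor_homog True. (x :: ('a, 'b) tensor) = x0 + x1"
proof (induction x rule: tensor_induct_homog)
  case (pure a b p q)
  show ?case
  proof (cases "p \<noteq> q")
    case True
    hence "a \<otimes> b \<in> tensor_homog True" using pure tensor_homog.pure by blast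
    thus ?thesis using tensor_homog.zero[of False] by (metis add_0)
  next
    case False
    hence "a \<otimes> b \<in> tensor_homog False" using pure tensor_homog.pure by blast
    thus ?thesis using tensor_homog.zero[of True] by (metis add_0_right)
  qed
next
  case (add x y)
  then obtain x0 x1 y0 y1 where *: "x0 \<in> tensor_homog False" "x1 \<in> tensor_homog True"
    "y0 \<in> tensor_homog False" "y1 \<in> tensor_homog True" "x = x0 + x1" "y = y0 + y1"
    by blast
  hence "x + y = (x0 + y0) + (x1 + y1)" by (simp add: algebra_simps)
  thus ?case using * tensor_homog.add by metis
qed

lemma tensor_homog_indep:
  assumes "x \<in> tensor_homog False" "x \<in> tensor_homog True"
  shows "(x :: ('a, 'b) tensor) = 0"
proof -
  define f :: "'a \<Rightarrow> 'b \<Rightarrow> ('a, 'b) tensor" where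
    "f = (\<lambda>a b. hpart False a \<otimes> hpart False b + hpart True a \<otimes> hpart True b)"
  have bl: "bilinear_map f"
    by (simp add: f_def bilinear_map_def complex_linear_def hpart_add hpart_scaleC tensor_add_left
        tensor_add_right tensor_scaleC_left tensor_scaleC_right scaleC_add_right algebra_simps)
  have tl: "tensor_lift f (a \<otimes> b)
      = hpart False a \<otimes> hpart False b + hpart True a \<otimes> hpart True b" for a b
    by (subst tensor_lift_pure[OF bl]) (simp add: f_def)
  have "tensor_lift f y = y" if "y \<in> tensor_homog False" for y
    using that
  proof induction
    case (pure a p b q)
    thus ?case
      by (cases p; cases q) (simp_all add: tl hpart_same hpart_other)
  qed (simp_all add: tensor_lift_zero[OF bl] tensor_lift_add[OF bl])
  moreover have "tensor_lift f y = 0" if "y \<in> tensor_homog True" for y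
    using that
  proof induction
    case (pure a p b q)
    thus ?case
      by (cases p; cases q) (simp_all add: tl hpart_same hpart_other)
  qed (simp_all add: tensor_lift_zero[OF bl] tensor_lift_add[OF bl])
  ultimately show ?thesis using assms by metis
qed

lemma tensor_homog_scaleC:
  assumes "x \<in> tensor_homog p"
  shows "c *\<^sub>C (x :: ('a, 'b) tensor) \<in> tensor_homog p"
  using assms
proof induction
  case (pure a p' b q)
  have "(c *\<^sub>C a) \<otimes> b \<in> tensor_homog p"
    by (rule tensor_homog.pure[OF homog_scaleC[OF pure(1)] pure(2,3)])
  thus ?case by (simp add: tensor_scaleC_left)
qed (simp_all add: tensor_homog.zero tensor_homog.add scaleC_add_right)

lemma tensor_homog_mult:
  assumes "x \<in> tensor_homog p" "y \<in> tensor_homog q"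
  shows "x * y \<in> (tensor_homog (p \<noteq> q) :: ('a, 'b) tensor set)"
  using assms(1)
proof induction
  case zero
  have "0 * y = 0" using times_tensor_scaleC_left[of 0 0 y] by simp
  thus ?case by (simp add: tensor_homog.zero)
next
  case x: (pure a p1 \<alpha> q1)
  show ?case using assms(2)
  proof induction
    case zero
    have "(a \<otimes> \<alpha>) * 0 = (0 :: ('a, 'b) tensor)"
      using times_tensor_scaleC_right[of "a \<otimes> \<alpha>" 0 0] by simp
    thus ?case by (simp add: tensor_homog.zero)
  next
    case y: (pure b p2 \<beta> q2)
    have "(a * b) \<otimes> (\<alpha> * \<beta>) \<in> tensor_homog (p \<noteq> q)"
      by (rule tensor_homog.pure[OF homog_mult[OF x(1) y(1)] homog_mult[OF x(2) y(2)]])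
         (use x(3) y(3) in auto)
    thus ?case by (simp add: tensor_mult_homog[OF x(2) y(1)] tensor_homog_scaleC)
  next
    case (add y y')
    thus ?case by (simp add: times_tensor_add_right tensor_homog.add)
  qed
next
  case (add x x')
  thus ?case by (simp add: times_tensor_add_left tensor_homog.add)
qed

lemma tensor_zero_neq_one: "(0 :: ('a, 'b) tensor) \<noteq> 1"
proof
  assume *: "(0 :: ('a, 'b) tensor) = 1"
  obtain f :: "'a \<Rightarrow> complex" where f: "complex_linear f" "f 1 = 1"
    using exists_unital_functional by blast
  obtain g :: "'b \<Rightarrow> complex" where g: "complex_linear g" "g 1 = 1"
    using exists_unital_functional by blast
  have bl: "bilinear_map (\<lambda>a b. f a * g b)"
    using f g by (auto simp: bilinear_map_def complex_linear_def scaleC_complex_def algebra_simps)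
  show False
    using tensor_lift_pure[OF bl, of 1 1] tensor_lift_zero[OF bl] f g *
    by (simp add: one_tensor_def)
qed

instance
proof
  fix a b c :: "('a, 'b) tensor" and d :: complex and p q :: bool
  show "a * b * c = a * (b * c)" by (fact times_tensor_assoc)
  show "1 * a = a"
    by (induction a rule: tensor_induct_homog)
       (simp_all add: one_tensor_def tensor_mult_homog[OF homog_one] koszul_sign_def scaleC_one
         times_tensor_add_right)
  show "a * 1 = a"
    by (induction a rule: tensor_induct_homog)
       (simp_all add: one_tensor_def tensor_mult_homog[OF _ homog_one] koszul_sign_def scaleC_one
         times_tensor_add_left)
  show "(a + b) * c = a * c + b * c" by (fact times_tensor_add_left)
  show "a * (b + c) = a * b + a * c" by (fact times_tensor_add_right)
  show "(0 :: ('a, 'b) tensor) \<noteq> 1" by (fact tensor_zero_neq_one)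
  show "(d *\<^sub>C a) * b = d *\<^sub>C (a * b)" by (fact times_tensor_scaleC_left)
  show "a * (d *\<^sub>C b) = d *\<^sub>C (a * b)" by (fact times_tensor_scaleC_right)
  show "0 \<in> (homog p :: ('a, 'b) tensor set)"
    by (simp add: homog_tensor_def tensor_homog.zero)
  show "a \<in> homog p \<Longrightarrow> b \<in> homog p \<Longrightarrow> a + b \<in> homog p"
    by (simp add: homog_tensor_def tensor_homog.add)
  show "a \<in> homog p \<Longrightarrow> d *\<^sub>C a \<in> homog p"
    by (simp add: homog_tensor_def tensor_homog_scaleC)
  show "1 \<in> (homog False :: ('a, 'b) tensor set)"
    unfolding homog_tensor_def one_tensor_def
    by (rule tensor_homog.pure[OF homog_one homog_one]) simp
  show "a \<in> homog p \<Longrightarrow> b \<in> homog q \<Longrightarrow> a * b \<in> homog (p \<noteq> q)"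
    unfolding homog_tensor_def by (rule tensor_homog_mult)
  show "\<exists>x0\<in>homog False. \<exists>x1\<in>homog True. a = x0 + x1"
    unfolding homog_tensor_def by (rule tensor_homog_decomp)
  show "a \<in> homog False \<Longrightarrow> a \<in> homog True \<Longrightarrow> a = 0"
    unfolding homog_tensor_def by (rule tensor_homog_indep)
qed

end

section \<open>Superalgebras presented by generators and relations\<close>

text \<open>Words in the generators; the monoid operation, written \<open>+\<close> as the type of
  polynomial mappings requires, is concatenation.\<close>

datatype 'g word = Word (letters: "'g list")

instantiation word :: (type) monoid_add
begin

definition zero_word :: "'a word" where "0 = Word []"

definition plus_word :: "'a word \<Rightarrow> 'a word \<Rightarrow> 'a word" where
  "v + w = Word (letters v @ letters w)"

instance by standard (simp_all add: zero_word_def plus_word_def)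

end

instance poly_mapping :: (monoid_add, complex_algebra) complex_algebra
proof
  fix c :: complex and x y :: "'a \<Rightarrow>\<^sub>0 'b"
  show "(c *\<^sub>C x) * y = c *\<^sub>C (x * y)"
  proof (induction x rule: poly_mapping_single_induct)
    case (single k a)
    show ?case
      by (induction y rule: poly_mapping_single_induct)
         (simp_all add: scaleC_single mult_single mult_scaleC_left distrib_left scaleC_add_right)
  qed (simp_all add: scaleC_add_right distrib_right)
  show "x * (c *\<^sub>C y) = c *\<^sub>C (x * y)"
  proof (induction x rule: poly_mapping_single_induct)
    case (single k a)
    show ?case
      by (induction y rule: poly_mapping_single_induct)
         (simp_all add: scaleC_single mult_single mult_scaleC_right distrib_left scaleC_add_right)
  qed (simp_all add: scaleC_add_right distrib_right)
qed

type_synonym 'g free = "'g word \<Rightarrow>\<^sub>0 complex"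

definition generator :: "'g \<Rightarrow> 'g free" where
  "generator g = Poly_Mapping.single (Word [g]) 1"

definition word_parity :: "('g \<Rightarrow> bool) \<Rightarrow> 'g word \<Rightarrow> bool" where
  "word_parity od w \<longleftrightarrow> odd (length (filter od (letters w)))"

definition free_homog :: "('g \<Rightarrow> bool) \<Rightarrow> bool \<Rightarrow> 'g free set" where
  "free_homog od p = {x. \<forall>w\<in>Poly_Mapping.keys x. word_parity od w = p}"

lemma word_parity_plus: "word_parity od (v + w) = (word_parity od v \<noteq> word_parity od w)"
  by (simp add: word_parity_def plus_word_def)

lemma free_homog_zero: "0 \<in> free_homog od p"
  by (simp add: free_homog_def)

lemma free_homog_one: "1 \<in> free_homog od False"
  by (simp add: free_homog_def word_parity_def zero_word_def)

lemma free_homog_generator: "generator g \<in> free_homog od (od g)"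
  by (simp add: free_homog_def word_parity_def generator_def)

lemma free_homog_add: "x \<in> free_homog od p \<Longrightarrow> y \<in> free_homog od p \<Longrightarrow> x + y \<in> free_homog od p"
  using keys_add[of x y] by (auto simp: free_homog_def)

lemma free_homog_diff: "x \<in> free_homog od p \<Longrightarrow> y \<in> free_homog od p \<Longrightarrow> x - y \<in> free_homog od p"
  using keys_diff[of x y] by (auto simp: free_homog_def)

lemma free_homog_mult:
  "x \<in> free_homog od p \<Longrightarrow> y \<in> free_homog od q \<Longrightarrow> x * y \<in> free_homog od (p \<noteq> q)"
  using keys_mult[of x y] by (force simp: free_homog_def word_parity_plus)

lemma free_homog_scaleC: "x \<in> free_homog od p \<Longrightarrow> c *\<^sub>C x \<in> free_homog od p"
  by (auto simp: free_homog_def in_keys_iff scaleC_complex_def)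

lemma free_homog_uminus: "x \<in> free_homog od p \<Longrightarrow> - x \<in> free_homog od p"
  by (simp add: free_homog_def)

lemma free_homog_sum: "(\<And>i. i \<in> A \<Longrightarrow> f i \<in> free_homog od p) \<Longrightarrow> sum f A \<in> free_homog od p"
  by (induction A rule: infinite_finite_induct) (auto intro: free_homog_zero free_homog_add)

lemma free_homog_decomp: "\<exists>x0\<in>free_homog od False. \<exists>x1\<in>free_homog od True. x = x0 + x1"
proof (induction x rule: poly_mapping_single_induct)
  case zero
  show ?case by (intro bexI[of _ 0]) (simp_all add: free_homog_zero)
next
  case (single w c)
  have *: "Poly_Mapping.single w c \<in> free_homog od (word_parity od w)"
    by (simp add: free_homog_def)
  show ?case
  proof (cases "word_parity od w")
    case True
    thus ?thesis using * by (intro bexI[of _ 0] bexI[of _ "Poly_Mapping.single w c"])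
      (auto intro: free_homog_zero)
  next
    case False
    thus ?thesis using * by (intro bexI[of _ "Poly_Mapping.single w c"] bexI[of _ 0])
      (auto intro: free_homog_zero)
  qed
next
  case (add x y)
  then obtain x0 x1 y0 y1 where *: "x0 \<in> free_homog od False" "x1 \<in> free_homog od True"
    "y0 \<in> free_homog od False" "y1 \<in> free_homog od True" "x = x0 + x1" "y = y0 + y1"
    by blast
  hence "x + y = (x0 + y0) + (x1 + y1)" by (simp add: algebra_simps)
  thus ?case using * free_homog_add by blast
qed

lemma free_homog_indep:
  assumes "x \<in> free_homog od False" "x \<in> free_homog od True"
  shows "x = 0"
proof -
  have "Poly_Mapping.keys x = {}" using assms by (auto simp: free_homog_def)
  thus ?thesis by simp
qed

text \<open>The relators are homogeneous, and they lie in the augmentation ideal, which makes the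
  presented algebra nonzero.\<close>

class presentation =
  fixes odd_generator :: "'a \<Rightarrow> bool"
    and relators :: "'a free set"
  assumes relators_homog: "r \<in> relators \<Longrightarrow> \<exists>p. r \<in> free_homog odd_generator p"
    and relators_augmented: "r \<in> relators \<Longrightarrow> Poly_Mapping.lookup r 0 = 0"

inductive_set relator_ideal :: "'g::presentation free set" where
  zero: "0 \<in> relator_ideal"
| relator: "r \<in> relators \<Longrightarrow> a * r * b \<in> relator_ideal"
| add: "x \<in> relator_ideal \<Longrightarrow> y \<in> relator_ideal \<Longrightarrow> x + y \<in> relator_ideal"

lemma relator_ideal_mult_left: "x \<in> relator_ideal \<Longrightarrow> a * x \<in> relator_ideal"
proof (induction rule: relator_ideal.induct)
  case (relator r b c)
  thus ?case using relator_ideal.relator[of r "a * b" c] by (simp add: mult.assoc)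
qed (auto simp: distrib_left intro: relator_ideal.intros)

lemma relator_ideal_mult_right: "x \<in> relator_ideal \<Longrightarrow> x * a \<in> relator_ideal"
proof (induction rule: relator_ideal.induct)
  case (relator r b c)
  thus ?case using relator_ideal.relator[of r b "c * a"] by (simp add: mult.assoc)
qed (auto simp: distrib_right intro: relator_ideal.intros)

lemma relator_ideal_uminus: "x \<in> relator_ideal \<Longrightarrow> - x \<in> relator_ideal"
  using relator_ideal_mult_left[of x "-1"] by simp

lemma relator_ideal_diff: "x \<in> relator_ideal \<Longrightarrow> y \<in> relator_ideal \<Longrightarrow> x - y \<in> relator_ideal"
  using relator_ideal.add[OF _ relator_ideal_uminus, of x y] by simp

lemma relator_ideal_scaleC: "x \<in> relator_ideal \<Longrightarrow> c *\<^sub>C x \<in> relator_ideal"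
  using relator_ideal_mult_left[of x "c *\<^sub>C 1"] by (simp add: mult_scaleC_left)

lemma relator_ideal_decomp:
  assumes "x \<in> relator_ideal"
  shows "\<exists>x0\<in>relator_ideal \<inter> free_homog odd_generator False.
    \<exists>x1\<in>relator_ideal \<inter> free_homog odd_generator True. x = x0 + x1"
  using assms
proof induction
  case zero
  show ?case by (intro bexI[of _ 0]) (simp_all add: free_homog_zero relator_ideal.zero)
next
  case (relator r a b)
  obtain p where p: "r \<in> free_homog odd_generator p" using relators_homog relator by blast
  obtain a0 a1 where a: "a0 \<in> free_homog odd_generator False" "a1 \<in> free_homog odd_generator True"
    "a = a0 + a1" using free_homog_decomp by blast
  obtain b0 b1 where b: "b0 \<in> free_homog odd_generator False" "b1 \<in> free_homog odd_generator True"
    "b = b0 + b1" using free_homog_decomp by blast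
  define s where "s = a0 * r * b0 + a1 * r * b1"
  define t where "t = a0 * r * b1 + a1 * r * b0"
  have "s \<in> relator_ideal" "t \<in> relator_ideal"
    unfolding s_def t_def using relator by (auto intro: relator_ideal.intros)
  moreover have "s \<in> free_homog odd_generator p"
    unfolding s_def
    using free_homog_mult[OF free_homog_mult[OF a(1) p] b(1)]
      free_homog_mult[OF free_homog_mult[OF a(2) p] b(2)] by (auto intro!: free_homog_add)
  moreover have "t \<in> free_homog odd_generator (\<not> p)"
    unfolding t_def
    using free_homog_mult[OF free_homog_mult[OF a(1) p] b(2)]
      free_homog_mult[OF free_homog_mult[OF a(2) p] b(1)] by (auto intro!: free_homog_add)
  moreover have "a * r * b = s + t"
    by (simp add: a b s_def t_def algebra_simps)
  ultimately show ?case
    by (cases p) (auto intro: bexI[of _ s] bexI[of _ t] simp: add.commute)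
next
  case (add x y)
  then obtain x0 x1 y0 y1 where *:
    "x0 \<in> relator_ideal \<inter> free_homog odd_generator False" "x1 \<in> relator_ideal \<inter> free_homog odd_generator True"
    "y0 \<in> relator_ideal \<inter> free_homog odd_generator False" "y1 \<in> relator_ideal \<inter> free_homog odd_generator True"
    "x = x0 + x1" "y = y0 + y1"
    by blast
  hence "x + y = (x0 + y0) + (x1 + y1)" by (simp add: algebra_simps)
  thus ?case using * free_homog_add relator_ideal.add by blast
qed

lemma augmentation_mult:
  "Poly_Mapping.lookup (x * y) 0 = Poly_Mapping.lookup x 0 * Poly_Mapping.lookup (y :: 'g free) 0"
proof (induction x rule: poly_mapping_single_induct)
  case (single v a)
  show ?case
  proof (induction y rule: poly_mapping_single_induct)
    case (single w b)
    have "v + w = 0 \<longleftrightarrow> v = 0 \<and> w = 0"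
      by (cases v; cases w) (simp add: plus_word_def zero_word_def)
    thus ?case by (simp add: mult_single lookup_single when_def)
  qed (simp_all add: distrib_left lookup_add)
qed (simp_all add: distrib_right lookup_add)

lemma relator_ideal_augmented: "x \<in> relator_ideal \<Longrightarrow> Poly_Mapping.lookup x 0 = 0"
  by (induction rule: relator_ideal.induct)
     (simp_all add: augmentation_mult relators_augmented lookup_add)

definition relator_cong :: "'g::presentation free \<Rightarrow> 'g free \<Rightarrow> bool" where
  "relator_cong x y \<longleftrightarrow> x - y \<in> relator_ideal"

lemma relator_cong_equivp: "equivp (relator_cong :: 'g::presentation free \<Rightarrow> _)"
    (is "equivp ?R")
proof (rule equivpI)
  show "reflp ?R" by (auto simp: reflp_def relator_cong_def relator_ideal.zero)
  show "symp ?R"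
    unfolding symp_def relator_cong_def using relator_ideal_uminus minus_diff_eq by metis
  have "x - z \<in> relator_ideal" if "x - y \<in> relator_ideal" "y - z \<in> relator_ideal"
    for x y z :: "'g free"
    using relator_ideal.add[OF that] by simp
  thus "transp ?R" unfolding transp_def relator_cong_def by blast
qed

quotient_type (overloaded) 'g presented = "'g::presentation free" / relator_cong
  by (rule relator_cong_equivp)

lemma relator_cong_refl: "relator_cong x x"
  by (simp add: relator_cong_def relator_ideal.zero)

instantiation presented :: (presentation) superalgebra
begin

lift_definition zero_presented :: "'a presented" is 0 .

lift_definition one_presented :: "'a presented" is 1 .

lift_definition plus_presented :: "'a presented \<Rightarrow> 'a presented \<Rightarrow> 'a presented" is "(+)"
  unfolding relator_cong_def by (subst add_diff_add) (rule relator_ideal.add)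

lift_definition uminus_presented :: "'a presented \<Rightarrow> 'a presented" is uminus
  unfolding relator_cong_def by (subst minus_diff_minus) (rule relator_ideal_uminus)

lift_definition minus_presented :: "'a presented \<Rightarrow> 'a presented \<Rightarrow> 'a presented" is "(-)"
proof -
  fix x x' y y' :: "'a free"
  assume "relator_cong x x'" "relator_cong y y'"
  hence "(x - x') - (y - y') \<in> relator_ideal"
    unfolding relator_cong_def by (rule relator_ideal_diff)
  thus "relator_cong (x - y) (x' - y')" by (simp add: relator_cong_def algebra_simps)
qed

lift_definition times_presented :: "'a presented \<Rightarrow> 'a presented \<Rightarrow> 'a presented" is "(*)"
proof -
  fix x x' y y' :: "'a free"
  assume "relator_cong x x'" "relator_cong y y'"
  hence "(x - x') * y + x' * (y - y') \<in> relator_ideal"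
    unfolding relator_cong_def
    by (intro relator_ideal.add relator_ideal_mult_right relator_ideal_mult_left)
  thus "relator_cong (x * y) (x' * y')" by (simp add: relator_cong_def algebra_simps)
qed

lift_definition scaleC_presented :: "complex \<Rightarrow> 'a presented \<Rightarrow> 'a presented" is scaleC
  unfolding relator_cong_def by (subst scaleC_diff_right[symmetric]) (rule relator_ideal_scaleC)

definition homog_presented :: "bool \<Rightarrow> 'a presented set" where
  "homog_presented p = abs_presented ` free_homog odd_generator p"

instance
proof
  fix a b c :: "'a presented" and d e :: complex and p q :: bool
  note r = relator_cong_refl
  show "a + b + c = a + (b + c)" by transfer (simp add: add.assoc r)
  show "a + b = b + a" by transfer (simp add: add.commute r)
  show "0 + a = a" by transfer (simp add: r)
  show "- a + a = 0" by transfer (simp add: r)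
  show "a - b = a + - b" by transfer (simp add: r)
  show "a * b * c = a * (b * c)" by transfer (simp add: mult.assoc r)
  show "1 * a = a" by transfer (simp add: r)
  show "a * 1 = a" by transfer (simp add: r)
  show "(a + b) * c = a * c + b * c" by transfer (simp add: distrib_right r)
  show "a * (b + c) = a * b + a * c" by transfer (simp add: distrib_left r)
  show "(0 :: 'a presented) \<noteq> 1"
  proof transfer
    show "\<not> relator_cong (0 :: 'a free) 1"
      using relator_ideal_augmented[of "0 - 1 :: 'a free"] by (auto simp: relator_cong_def)
  qed
  show "d *\<^sub>C (a + b) = d *\<^sub>C a + d *\<^sub>C b" by transfer (simp add: scaleC_add_right r)
  show "(d + e) *\<^sub>C a = d *\<^sub>C a + e *\<^sub>C a" by transfer (simp add: scaleC_add_left r)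
  show "d *\<^sub>C e *\<^sub>C a = (d * e) *\<^sub>C a" by transfer (simp add: scaleC_scaleC r)
  show "1 *\<^sub>C a = a" by transfer (simp add: scaleC_one r)
  show "(d *\<^sub>C a) * b = d *\<^sub>C (a * b)" by transfer (simp add: mult_scaleC_left r)
  show "a * (d *\<^sub>C b) = d *\<^sub>C (a * b)" by transfer (simp add: mult_scaleC_right r)
  show "0 \<in> (homog p :: 'a presented set)"
    unfolding homog_presented_def zero_presented.abs_eq by (rule imageI) (rule free_homog_zero)
  show "1 \<in> (homog False :: 'a presented set)"
    unfolding homog_presented_def one_presented.abs_eq by (rule imageI) (rule free_homog_one)
  show "a + b \<in> homog p" if "a \<in> homog p" "b \<in> homog p"
    using that unfolding homog_presented_def
    by (auto simp: plus_presented.abs_eq intro!: imageI free_homog_add)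
  show "d *\<^sub>C a \<in> homog p" if "a \<in> homog p"
    using that unfolding homog_presented_def
    by (auto simp: scaleC_presented.abs_eq intro!: imageI free_homog_scaleC)
  show "a * b \<in> homog (p \<noteq> q)" if "a \<in> homog p" "b \<in> homog q"
    using that unfolding homog_presented_def
    by (auto simp: times_presented.abs_eq intro!: imageI free_homog_mult simp del: not_iff)
  show "\<exists>x0\<in>homog False. \<exists>x1\<in>homog True. a = x0 + x1"
  proof (induction a rule: presented.abs_induct)
    case (1 x)
    obtain x0 x1 where "x0 \<in> free_homog odd_generator False" "x1 \<in> free_homog odd_generator True"
      "x = x0 + x1" using free_homog_decomp by blast
    thus ?case unfolding homog_presented_def by (auto simp: plus_presented.abs_eq)
  qed
  show "a = 0" if "a \<in> homog False" "a \<in> homog True"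
  proof -
    from that(1) obtain x where x: "x \<in> free_homog odd_generator False" "a = abs_presented x"
      unfolding homog_presented_def by (rule imageE) blast
    from that(2) obtain y where y: "y \<in> free_homog odd_generator True" "a = abs_presented y"
      unfolding homog_presented_def by (rule imageE) blast
    have "abs_presented x = abs_presented y" by (rule trans[OF x(2)[symmetric] y(2)])
    hence "x - y \<in> relator_ideal" by (simp only: presented.abs_eq_iff relator_cong_def)
    then obtain z0 z1 where z: "z0 \<in> relator_ideal" "z0 \<in> free_homog odd_generator False"
      "z1 \<in> free_homog odd_generator True" "x - y = z0 + z1"
      using relator_ideal_decomp by blast
    have "x - z0 = z1 + y" using z(4) by (simp add: algebra_simps)
    hence "x - z0 = 0"
      using free_homog_diff[OF x(1) z(2)] free_homog_add[OF z(3) y(1)] free_homog_indep by metis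
    hence "x \<in> relator_ideal" using z by simp
    thus ?thesis by (simp add: x zero_presented.abs_eq presented.abs_eq_iff relator_cong_def)
  qed
qed

end

definition gen :: "'g::presentation \<Rightarrow> 'g presented" where
  "gen g = abs_presented (generator g)"

section \<open>Formal series\<close>

text \<open>A series in \<open>u\<^sup>-\<^sup>1\<close> is a formal power series; its \<open>n\<close>-th coefficient belongs to \<open>u\<^sup>-\<^sup>n\<close>.\<close>

definition series_of :: "'a::zero \<Rightarrow> (nat \<Rightarrow> 'a) \<Rightarrow> 'a fps" where
  "series_of c a = Abs_fps (case_nat c a)"

definition map_series :: "('a \<Rightarrow> 'b) \<Rightarrow> 'a fps \<Rightarrow> 'b fps" where
  "map_series f F = Abs_fps (\<lambda>n. f (fps_nth F n))"

text \<open>\<open>shift_series c F\<close> is \<open>F(u + c)\<close>, using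
  \<open>(u + c)\<^sup>-\<^sup>1 = u\<^sup>-\<^sup>1 - c u\<^sup>-\<^sup>2 + c\<^sup>2 u\<^sup>-\<^sup>3 - \<dots>\<close>; \<open>reflect_series F\<close> is \<open>F(-u)\<close>.\<close>

definition shift_series :: "complex \<Rightarrow> 'a::complex_algebra fps \<Rightarrow> 'a fps" where
  "shift_series c F = fps_compose F (series_of 0 (\<lambda>n. ((- c) ^ n) *\<^sub>C 1))"

definition reflect_series :: "'a::ring_1 fps \<Rightarrow> 'a fps" where
  "reflect_series F = fps_compose F (- fps_X)"

text \<open>For constant term \<open>1\<close> the left inverse is two-sided.\<close>

definition inverse_series :: "'a::ring_1 fps \<Rightarrow> 'a fps" where
  "inverse_series F = fps_left_inverse F 1"

text \<open>Double series in \<open>u\<^sup>-\<^sup>1\<close> (inner variable) and \<open>v\<^sup>-\<^sup>1\<close> (outer variable) are Laurent series, so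
  that \<open>u\<close> and \<open>v\<close> are available.\<close>

definition in_u :: "'a::ring_1 fps \<Rightarrow> 'a fls fls" where
  "in_u F = fls_const (fps_to_fls F)"

definition in_v :: "'a::ring_1 fps \<Rightarrow> 'a fls fls" where
  "in_v F = fps_to_fls (map_series fls_const F)"

definition u_var :: "'a::ring_1 fls fls" where
  "u_var = fls_const fls_X_inv"

definition v_var :: "'a::ring_1 fls fls" where
  "v_var = fls_X_inv"

definition const_uv :: "'a::ring_1 \<Rightarrow> 'a fls fls" where
  "const_uv a = fls_const (fls_const a)"

definition commutator :: "'a::ring \<Rightarrow> 'a \<Rightarrow> 'a" where
  "commutator a b = a * b - b * a"

definition anticommutator :: "'a::ring \<Rightarrow> 'a \<Rightarrow> 'a" where
  "anticommutator a b = a * b + b * a"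

definition series_coeffs :: "'a::zero fps \<Rightarrow> 'a set" where
  "series_coeffs F = range (fps_nth F)"

definition double_series_coeffs :: "'a::zero fls fls \<Rightarrow> 'a set" where
  "double_series_coeffs F = {fls_nth (fls_nth F m) n | m n. True}"


section \<open>The superalgebra \<open>\<A>\<^sup>+\<close>\<close>

definition kappa :: complex where "kappa = 3 / 2"

datatype A_gen = gen_e nat | gen_f nat | gen_h nat

text \<open>The relations between double series are multiplied by their denominators. This does not
  change the ideal: \<open>u - v\<close>, \<open>u - v + \<kappa>\<close> and \<open>u - v - \<kappa>\<close> are not zero divisors on series in
  \<open>u\<^sup>-\<^sup>1\<close> and \<open>v\<^sup>-\<^sup>1\<close>.\<close>

definition A_relators :: "A_gen free set" where
  "A_relators = (let
     e = series_of 0 (\<lambda>k. generator (gen_e k));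
     f = series_of 0 (\<lambda>k. generator (gen_f k));
     h = series_of 1 (\<lambda>k. generator (gen_h k));
     u = u_var; v = v_var; \<kappa> = const_uv (kappa *\<^sub>C 1);
     eu = in_u e; ev = in_v e; fu = in_u f; fv = in_v f; hu = in_u h; hv = in_v h;
     e0 = generator (gen_e 0); f0 = generator (gen_f 0);
     ce0 = const_uv e0; cf0 = const_uv f0
   in
     double_series_coeffs (commutator hu hv) \<union>
     double_series_coeffs ((u - v) * anticommutator eu fv - (hv - hu)) \<union>
     double_series_coeffs ((u - v) * (u - v + \<kappa>) * commutator hu ev
       - (- (u - v + \<kappa> - 1) * commutator hu (eu - ev)
          + (u - v) * (hu * (ev + eu - ce0) - (eu - ce0) * hu))) \<union>
     double_series_coeffs ((u - v) * (u - v - \<kappa>) * commutator hu fv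
       - ((u - v - \<kappa> + 1) * commutator hu (fu - fv)
          - (u - v) * (hu * (fv + fu + cf0) - (fu + cf0) * hu))) \<union>
     double_series_coeffs (2 * (u - v)\<^sup>2 * anticommutator eu ev
       - ((u - v) * commutator eu ev - 2 * (u - v) * anticommutator ce0 (eu - ev) - (eu - ev)\<^sup>2)) \<union>
     double_series_coeffs (2 * (u - v)\<^sup>2 * anticommutator fu fv
       - (- (u - v) * commutator fu fv - 2 * (u - v) * anticommutator cf0 (fu - fv) - (fu - fv)\<^sup>2)) \<union>
     series_coeffs (e ^ 3 - (e * anticommutator e (fps_const e0) + commutator (fps_const (e0\<^sup>2)) e)) \<union>
     series_coeffs (f ^ 3 - (- f * anticommutator f (fps_const f0) + commutator (fps_const (f0\<^sup>2)) f)))"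


section \<open>The super Yangian \<open>\<U>(R)\<close>\<close>

definition grade :: "3 \<Rightarrow> nat" where
  "grade i = (if i = 2 then 1 else 0)"

text \<open>\<open>M i j k l\<close> is the coefficient of \<open>E\<^sub>i\<^sub>j \<otimes> E\<^sub>k\<^sub>l\<close>. The sign in the product comes from moving
  \<open>E\<^sub>k\<^sub>l\<close> past \<open>E\<^sub>j\<^sub>q\<close> in \<open>(E\<^sub>i\<^sub>j \<otimes> E\<^sub>k\<^sub>l) (E\<^sub>j\<^sub>q \<otimes> E\<^sub>l\<^sub>s)\<close>; the entries commute with the matrices
  without sign.\<close>

type_synonym 'a matrix2 = "3 \<Rightarrow> 3 \<Rightarrow> 3 \<Rightarrow> 3 \<Rightarrow> 'a"

definition matrix2_mult :: "'a::ring_1 matrix2 \<Rightarrow> 'a matrix2 \<Rightarrow> 'a matrix2" where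
  "matrix2_mult M N = (\<lambda>i q k s. \<Sum>j\<in>UNIV. \<Sum>l\<in>UNIV.
     (-1) ^ ((grade k + grade l) * (grade j + grade q)) * M i j k l * N j q l s)"

definition J_matrix :: "3 \<Rightarrow> 3 \<Rightarrow> 'a::ring_1" where
  "J_matrix i j = (if (i, j) = (3, 1) \<or> (i, j) = (2, 2) then 1 else if (i, j) = (1, 3) then -1 else 0)"

definition supertranspose :: "(3 \<Rightarrow> 3 \<Rightarrow> 'a::ring_1) \<Rightarrow> 3 \<Rightarrow> 3 \<Rightarrow> 'a" where
  "supertranspose A = (\<lambda>i l. \<Sum>j\<in>UNIV. \<Sum>k\<in>UNIV.
     (-1) ^ (grade i * grade l + grade i) * J_matrix i j * A k j * J_matrix l k)"

definition id_matrix2 :: "'a::ring_1 matrix2" where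
  "id_matrix2 i j k l = (if i = j \<and> k = l then 1 else 0)"

definition P_matrix :: "'a::ring_1 matrix2" where
  "P_matrix i j k l = (if k = j \<and> l = i then (-1) ^ grade j else 0)"

definition P_matrix_t1 :: "'a::ring_1 matrix2" where
  "P_matrix_t1 i j k l = supertranspose (\<lambda>a b. P_matrix a b k l) i j"

text \<open>\<open>(u - v) (u - v + \<kappa>) R\<^sub>1\<^sub>2(u - v)\<close>; the scalar factor does not matter in the RTT relation.\<close>

definition R_matrix :: "'a::complex_algebra fls fls matrix2" where
  "R_matrix i j k l = (let w = u_var - v_var; \<kappa> = const_uv (kappa *\<^sub>C 1) in
     w * (w + \<kappa>) * id_matrix2 i j k l + (w + \<kappa>) * P_matrix i j k l - w * P_matrix_t1 i j k l)"

definition in_first :: "(3 \<Rightarrow> 3 \<Rightarrow> 'a::zero) \<Rightarrow> 'a matrix2" where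
  "in_first A i j k l = (if k = l then A i j else 0)"

definition in_second :: "(3 \<Rightarrow> 3 \<Rightarrow> 'a::zero) \<Rightarrow> 'a matrix2" where
  "in_second A i j k l = (if i = j then A k l else 0)"

text \<open>\<open>gen_L i j n\<close> is \<open>L\<^sup>i\<^sup>j\<close> with lower index \<open>n + 1\<close>. Note that \<open>3 = 0\<close> in the index type \<open>3\<close>.\<close>

datatype U_gen = gen_L 3 3 nat

definition U_relators :: "U_gen free set" where
  "U_relators = (let
     L = (\<lambda>i j. series_of (if i = j then 1 else 0) (\<lambda>n. generator (gen_L i j n)));
     L1 = in_first (\<lambda>i j. in_u (L i j));
     L2 = in_second (\<lambda>i j. in_v (L i j));
     RLL = matrix2_mult (matrix2_mult R_matrix L1) L2;
     LLR = matrix2_mult (matrix2_mult L2 L1) R_matrix;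
     Lt = supertranspose (\<lambda>i j. shift_series (- kappa) (L i j))
   in
     (\<Union>i j k l. double_series_coeffs (RLL i j k l - LLR i j k l)) \<union>
     (\<Union>i j. series_coeffs ((\<Sum>k\<in>UNIV. Lt i k * L k j) - (if i = j then 1 else 0))))"


subsection \<open>The relators are homogeneous and augmented\<close>

definition homog_uv :: "('g \<Rightarrow> bool) \<Rightarrow> bool \<Rightarrow> 'g free fls fls \<Rightarrow> bool" where
  "homog_uv od p F \<longleftrightarrow> (\<forall>m n. fls_nth (fls_nth F m) n \<in> free_homog od p)"

definition homog_series :: "('g \<Rightarrow> bool) \<Rightarrow> bool \<Rightarrow> 'g free fps \<Rightarrow> bool" where
  "homog_series od p F \<longleftrightarrow> (\<forall>n. fps_nth F n \<in> free_homog od p)"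

lemma free_homog_mult':
  "x \<in> free_homog od p \<Longrightarrow> y \<in> free_homog od q \<Longrightarrow> r = (p \<noteq> q) \<Longrightarrow> x * y \<in> free_homog od r"
  using free_homog_mult by blast

lemma homog_uv_zero: "homog_uv od p 0"
  by (simp add: homog_uv_def free_homog_zero)

lemma homog_uv_add: "homog_uv od p F \<Longrightarrow> homog_uv od p G \<Longrightarrow> homog_uv od p (F + G)"
  by (simp add: homog_uv_def free_homog_add)

lemma homog_uv_diff: "homog_uv od p F \<Longrightarrow> homog_uv od p G \<Longrightarrow> homog_uv od p (F - G)"
  by (simp add: homog_uv_def free_homog_diff)

lemma homog_uv_uminus: "homog_uv od p F \<Longrightarrow> homog_uv od p (- F)"
  by (simp add: homog_uv_def free_homog_uminus)

lemma homog_uv_sum: "(\<And>i. i \<in> A \<Longrightarrow> homog_uv od p (f i)) \<Longrightarrow> homog_uv od p (sum f A)"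
  by (induction A rule: infinite_finite_induct) (auto intro: homog_uv_zero homog_uv_add)

lemma fls_sum_nth: "fls_nth (sum f A) n = (\<Sum>i\<in>A. fls_nth (f i) n)"
  by (induction A rule: infinite_finite_induct) simp_all

lemma homog_uv_mult:
  assumes "homog_uv od p F" "homog_uv od q G" "r = (p \<noteq> q)"
  shows "homog_uv od r (F * G)"
  using assms unfolding homog_uv_def
  by (auto simp: fls_times_nth(1) fls_sum_nth intro!: free_homog_sum free_homog_mult'[of _ od p _ q])

lemma homog_uv_const: "a \<in> free_homog od p \<Longrightarrow> homog_uv od p (const_uv a)"
  by (simp add: homog_uv_def const_uv_def free_homog_zero)

lemma homog_uv_in_u: "homog_series od p F \<Longrightarrow> homog_uv od p (in_u F)"
  by (simp add: homog_uv_def homog_series_def in_u_def free_homog_zero)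

lemma homog_uv_in_v: "homog_series od p F \<Longrightarrow> homog_uv od p (in_v F)"
  by (simp add: homog_uv_def homog_series_def in_v_def map_series_def free_homog_zero)

lemma homog_uv_vars: "homog_uv od False u_var" "homog_uv od False v_var" "homog_uv od False 1"
  by (simp_all add: homog_uv_def u_var_def v_var_def free_homog_zero free_homog_one)

lemma homog_uv_commutator:
  "homog_uv od p F \<Longrightarrow> homog_uv od q G \<Longrightarrow> r = (p \<noteq> q) \<Longrightarrow> homog_uv od r (commutator F G)"
  unfolding commutator_def
  by (intro homog_uv_diff homog_uv_mult[of od p F q] homog_uv_mult[of od q G p]) auto

lemma homog_uv_anticommutator:
  "homog_uv od p F \<Longrightarrow> homog_uv od q G \<Longrightarrow> r = (p \<noteq> q) \<Longrightarrow> homog_uv od r (anticommutator F G)"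
  unfolding anticommutator_def
  by (intro homog_uv_add homog_uv_mult[of od p F q] homog_uv_mult[of od q G p]) auto

lemma homog_series_add: "homog_series od p F \<Longrightarrow> homog_series od p G \<Longrightarrow> homog_series od p (F + G)"
  by (simp add: homog_series_def free_homog_add)

lemma homog_series_diff: "homog_series od p F \<Longrightarrow> homog_series od p G \<Longrightarrow> homog_series od p (F - G)"
  by (simp add: homog_series_def free_homog_diff)

lemma homog_series_uminus: "homog_series od p F \<Longrightarrow> homog_series od p (- F)"
  by (simp add: homog_series_def free_homog_uminus)

lemma homog_series_zero: "homog_series od p 0"
  by (simp add: homog_series_def free_homog_zero)

lemma homog_series_one: "homog_series od False 1"
  by (simp add: homog_series_def free_homog_zero free_homog_one)

lemma homog_series_sum: "(\<And>i. i \<in> A \<Longrightarrow> homog_series od p (f i)) \<Longrightarrow> homog_series od p (sum f A)"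
  by (induction A rule: infinite_finite_induct) (auto intro: homog_series_zero homog_series_add)

lemma homog_series_mult:
  assumes "homog_series od p F" "homog_series od q G" "r = (p \<noteq> q)"
  shows "homog_series od r (F * G)"
  using assms unfolding homog_series_def
  by (auto simp: fps_mult_nth intro!: free_homog_sum free_homog_mult'[of _ od p _ q])

lemma homog_series_const: "a \<in> free_homog od p \<Longrightarrow> homog_series od p (fps_const a)"
  by (simp add: homog_series_def free_homog_zero)

lemma homog_series_of:
  "c \<in> free_homog od p \<Longrightarrow> (\<And>n. a n \<in> free_homog od p) \<Longrightarrow> homog_series od p (series_of c a)"
  by (simp add: homog_series_def series_of_def split: nat.split)

lemma homog_series_shift:
  assumes "homog_series od p F"
  shows "homog_series od p (shift_series c F)"
proof -
  have X: "homog_series od False (series_of 0 (\<lambda>n. ((- c) ^ n) *\<^sub>C 1))"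
    by (intro homog_series_of free_homog_zero free_homog_scaleC free_homog_one)
  have "homog_series od False (series_of 0 (\<lambda>n. ((- c) ^ n) *\<^sub>C 1) ^ k)" for k
    by (induction k) (auto intro: homog_series_one homog_series_mult[OF X])
  thus ?thesis
    using assms unfolding homog_series_def shift_series_def
    by (auto simp: fps_compose_nth intro!: free_homog_sum free_homog_mult'[of _ od p _ False])
qed

lemma double_series_coeffs_homog: "homog_uv od p F \<Longrightarrow> r \<in> double_series_coeffs F \<Longrightarrow> \<exists>p. r \<in> free_homog od p"
  by (auto simp: homog_uv_def double_series_coeffs_def)

lemma series_coeffs_homog: "homog_series od p F \<Longrightarrow> r \<in> series_coeffs F \<Longrightarrow> \<exists>p. r \<in> free_homog od p"
  by (auto simp: homog_series_def series_coeffs_def)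

definition cong_uv :: "'g free fls fls \<Rightarrow> 'g free fls fls \<Rightarrow> bool" where
  "cong_uv F G \<longleftrightarrow> (\<forall>m n. Poly_Mapping.lookup (fls_nth (fls_nth (F - G) m) n) 0 = 0)"

definition cong_series :: "'g free fps \<Rightarrow> 'g free fps \<Rightarrow> bool" where
  "cong_series F G \<longleftrightarrow> (\<forall>n. Poly_Mapping.lookup (fps_nth (F - G) n) 0 = 0)"

lemma lookup_sum': "Poly_Mapping.lookup (sum f A) k = (\<Sum>i\<in>A. Poly_Mapping.lookup (f i) k)"
  by (induction A rule: infinite_finite_induct) (simp_all add: lookup_add)

lemma cong_uv_refl: "cong_uv F F"
  by (simp add: cong_uv_def)

lemma cong_uv_add: "cong_uv F F' \<Longrightarrow> cong_uv G G' \<Longrightarrow> cong_uv (F + G) (F' + G')"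
  by (simp add: cong_uv_def lookup_minus lookup_add)

lemma cong_uv_diff: "cong_uv F F' \<Longrightarrow> cong_uv G G' \<Longrightarrow> cong_uv (F - G) (F' - G')"
  by (simp add: cong_uv_def lookup_minus lookup_add)

lemma cong_uv_uminus: "cong_uv F F' \<Longrightarrow> cong_uv (- F) (- F')"
  by (simp add: cong_uv_def lookup_minus)

lemma cong_uv_sum: "(\<And>i. i \<in> A \<Longrightarrow> cong_uv (f i) (g i)) \<Longrightarrow> cong_uv (sum f A) (sum g A)"
  by (induction A rule: infinite_finite_induct) (auto intro: cong_uv_refl cong_uv_add)

lemma cong_uv_mult:
  assumes "cong_uv F F'" "cong_uv G G'"
  shows "cong_uv (F * G) (F' * G')"
proof -
  have *: "Poly_Mapping.lookup (fls_nth (fls_nth (A * B) m) n) 0 = 0"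
    if "cong_uv A 0 \<or> cong_uv B 0" for A B :: "'a free fls fls" and m n
    using that
    by (auto simp: cong_uv_def fls_times_nth(1) fls_sum_nth lookup_sum' augmentation_mult)
  have "F * G - F' * G' = (F - F') * G + F' * (G - G')" by (simp add: algebra_simps)
  moreover have "cong_uv (F - F') 0" "cong_uv (G - G') 0" using assms by (simp_all add: cong_uv_def)
  hence "Poly_Mapping.lookup (fls_nth (fls_nth ((F - F') * G) m) n) 0 = 0"
    "Poly_Mapping.lookup (fls_nth (fls_nth (F' * (G - G')) m) n) 0 = 0" for m n
    using * by blast+
  ultimately show ?thesis unfolding cong_uv_def by (simp add: lookup_add)
qed

lemma cong_series_refl: "cong_series F F"
  by (simp add: cong_series_def)

lemma cong_series_add: "cong_series F F' \<Longrightarrow> cong_series G G' \<Longrightarrow> cong_series (F + G) (F' + G')"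
  by (simp add: cong_series_def lookup_minus lookup_add)

lemma cong_series_diff: "cong_series F F' \<Longrightarrow> cong_series G G' \<Longrightarrow> cong_series (F - G) (F' - G')"
  by (simp add: cong_series_def lookup_minus lookup_add)

lemma cong_series_uminus: "cong_series F F' \<Longrightarrow> cong_series (- F) (- F')"
  by (simp add: cong_series_def lookup_minus)

lemma cong_series_sum:
  "(\<And>i. i \<in> A \<Longrightarrow> cong_series (f i) (g i)) \<Longrightarrow> cong_series (sum f A) (sum g A)"
  by (induction A rule: infinite_finite_induct) (auto intro: cong_series_refl cong_series_add)

lemma cong_series_mult:
  assumes "cong_series F F'" "cong_series G G'"
  shows "cong_series (F * G) (F' * G')"
proof -
  have *: "Poly_Mapping.lookup (fps_nth (A * B) n) 0 = 0"
    if "cong_series A 0 \<or> cong_series B 0" for A B :: "'a free fps" and n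
    using that by (auto simp: cong_series_def fps_mult_nth lookup_sum' augmentation_mult)
  have "F * G - F' * G' = (F - F') * G + F' * (G - G')" by (simp add: algebra_simps)
  moreover have "cong_series (F - F') 0" "cong_series (G - G') 0"
    using assms by (simp_all add: cong_series_def)
  hence "Poly_Mapping.lookup (fps_nth ((F - F') * G) n) 0 = 0"
    "Poly_Mapping.lookup (fps_nth (F' * (G - G')) n) 0 = 0" for n
    using * by blast+
  ultimately show ?thesis unfolding cong_series_def by (simp add: lookup_add)
qed

lemma cong_series_shift:
  assumes "cong_series F F'"
  shows "cong_series (shift_series c F) (shift_series c F')"
  using assms
  by (simp add: cong_series_def shift_series_def fps_compose_nth lookup_minus lookup_sum'
      augmentation_mult flip: sum_subtractf left_diff_distrib)

lemma cong_series_const: "Poly_Mapping.lookup a 0 = 0 \<Longrightarrow> cong_series (fps_const a) 0"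
  by (simp add: cong_series_def)

lemma cong_uv_const: "Poly_Mapping.lookup a 0 = 0 \<Longrightarrow> cong_uv (const_uv a) 0"
  by (simp add: cong_uv_def const_uv_def)

lemma in_u_simps: "in_u 0 = 0" "in_u 1 = 1" "in_u (F - G) = in_u F - in_u G"
  by (simp_all add: in_u_def fls_minus_const)

lemma in_v_simps: "in_v 0 = 0" "in_v 1 = 1" "in_v (F - G) = in_v F - in_v G"
  by (auto simp: in_v_def map_series_def fls_minus_const fps_eq_iff intro!: fls_eqI)

lemma cong_uv_in_u: "cong_series F G \<Longrightarrow> cong_uv (in_u F) (in_u G)"
  by (simp add: cong_series_def cong_uv_def flip: in_u_simps) (simp add: in_u_def)

lemma cong_uv_in_v: "cong_series F G \<Longrightarrow> cong_uv (in_v F) (in_v G)"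
  by (simp add: cong_series_def cong_uv_def flip: in_v_simps) (simp add: in_v_def map_series_def)

lemma cong_series_of:
  "(\<And>n. Poly_Mapping.lookup (a n) 0 = 0) \<Longrightarrow> cong_series (series_of c a) (fps_const c)"
  by (auto simp: cong_series_def series_of_def lookup_minus split: nat.split)

lemma lookup_generator: "Poly_Mapping.lookup (generator g) 0 = 0"
  by (simp add: generator_def lookup_single when_def zero_word_def)

lemma double_series_coeffs_augmented: "cong_uv F 0 \<Longrightarrow> r \<in> double_series_coeffs F \<Longrightarrow> Poly_Mapping.lookup r 0 = 0"
  by (auto simp: cong_uv_def double_series_coeffs_def)

lemma series_coeffs_augmented: "cong_series F 0 \<Longrightarrow> r \<in> series_coeffs F \<Longrightarrow> Poly_Mapping.lookup r 0 = 0"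
  by (auto simp: cong_series_def series_coeffs_def)

lemmas homog_uv_intros =
  homog_uv_diff homog_uv_vars homog_uv_const free_homog_scaleC free_homog_one

lemma homog_uv_even_mult:
  "homog_uv od False F \<Longrightarrow> homog_uv od p G \<Longrightarrow> homog_uv od p (F * G)"
  by (rule homog_uv_mult) auto

lemma homog_uv_mult_even:
  "homog_uv od p F \<Longrightarrow> homog_uv od False G \<Longrightarrow> homog_uv od p (F * G)"
  by (rule homog_uv_mult) auto

lemma homog_uv_odd_mult_odd:
  "homog_uv od True F \<Longrightarrow> homog_uv od True G \<Longrightarrow> homog_uv od False (F * G)"
  by (rule homog_uv_mult) auto

lemma homog_uv_numeral: "homog_uv od False (numeral n)"
proof -
  have "homog_uv od False (of_nat k)" for k
    by (induction k) (auto intro: homog_uv_zero homog_uv_add homog_uv_vars)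
  from this[of "numeral n"] show ?thesis by simp
qed

lemma cong_uv_trans: "cong_uv F G \<Longrightarrow> G = H \<Longrightarrow> cong_uv F H"
  by simp

lemma cong_series_trans: "cong_series F G \<Longrightarrow> G = H \<Longrightarrow> cong_series F H"
  by simp

instantiation A_gen :: presentation
begin

definition odd_generator_A_gen :: "A_gen \<Rightarrow> bool" where
  "odd_generator_A_gen g = (case g of gen_e _ \<Rightarrow> True | gen_f _ \<Rightarrow> True | gen_h _ \<Rightarrow> False)"

definition relators_A_gen :: "A_gen free set" where
  "relators_A_gen = A_relators"

instance
proof
  define e f h where
    "e = series_of 0 (\<lambda>k. generator (gen_e k))" and
    "f = series_of 0 (\<lambda>k. generator (gen_f k))" and
    "h = series_of 1 (\<lambda>k. generator (gen_h k))"
  define e0 f0 where "e0 = generator (gen_e 0)" and "f0 = generator (gen_f 0)"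
  define k :: "A_gen free fls fls" where "k = const_uv (kappa *\<^sub>C 1)"
  define w :: "A_gen free fls fls" where "w = u_var - v_var"
  define od where "od = (odd_generator :: A_gen \<Rightarrow> bool)"
  note A_rel = A_relators_def[unfolded Let_def, folded e0_def f0_def e_def f_def h_def,
      folded k_def, folded w_def]
  have od: "od (gen_e n)" "od (gen_f n)" "\<not> od (gen_h n)" for n
    by (simp_all add: od_def odd_generator_A_gen_def)
  have g: "generator (gen_e n) \<in> free_homog od True" "generator (gen_f n) \<in> free_homog od True"
    "generator (gen_h n) \<in> free_homog od False" for n
    using free_homog_generator[of "gen_e n" od] free_homog_generator[of "gen_f n" od]
      free_homog_generator[of "gen_h n" od] od[of n] by auto
  have s: "homog_series od True e" "homog_series od True f" "homog_series od False h"
    unfolding e_def f_def h_def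
    by (auto intro!: homog_series_of g free_homog_zero free_homog_one)
  have c: "e0 \<in> free_homog od True" "f0 \<in> free_homog od True"
    unfolding e0_def f0_def by (rule g)+
  have w: "homog_uv od False w" unfolding w_def by (intro homog_uv_intros)
  have k: "homog_uv od False k" unfolding k_def by (intro homog_uv_intros)
  have in_uv: "homog_uv od True (in_u e)" "homog_uv od True (in_v e)" "homog_uv od True (in_u f)"
    "homog_uv od True (in_v f)" "homog_uv od False (in_u h)" "homog_uv od False (in_v h)"
    "homog_uv od True (const_uv e0)" "homog_uv od True (const_uv f0)"
    using s c by (simp_all add: homog_uv_in_u homog_uv_in_v homog_uv_const)
  have two: "homog_uv od False 2" "homog_uv od False 1"
    by (rule homog_uv_numeral homog_uv_vars)+
  have cm: "homog_uv od False F \<Longrightarrow> homog_uv od True G \<Longrightarrow> homog_uv od True (commutator F G)"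
    "homog_uv od True F \<Longrightarrow> homog_uv od True G \<Longrightarrow> homog_uv od False (commutator F G)"
    "homog_uv od False F \<Longrightarrow> homog_uv od False G \<Longrightarrow> homog_uv od False (commutator F G)"
    "homog_uv od True F \<Longrightarrow> homog_uv od True G \<Longrightarrow> homog_uv od False (anticommutator F G)" for F G
    by (auto intro: homog_uv_commutator homog_uv_anticommutator)
  note hom = in_uv two w k cm homog_uv_add homog_uv_diff homog_uv_uminus
    homog_uv_even_mult homog_uv_mult_even homog_uv_odd_mult_odd
  have sm: "homog_series od False F \<Longrightarrow> homog_series od p G \<Longrightarrow> homog_series od p (F * G)"
    "homog_series od p F \<Longrightarrow> homog_series od False G \<Longrightarrow> homog_series od p (F * G)"
    "homog_series od True F \<Longrightarrow> homog_series od True G \<Longrightarrow> homog_series od False (F * G)" for F G p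
    by (auto intro: homog_series_mult)
  have sc: "homog_series od True (fps_const e0)" "homog_series od True (fps_const f0)"
    "homog_series od False (fps_const (e0 * e0))" "homog_series od False (fps_const (f0 * f0))"
    using c free_homog_mult[OF c(1) c(1)] free_homog_mult[OF c(2) c(2)]
    by (auto intro: homog_series_const)
  note homs = s sc sm homog_series_add homog_series_diff homog_series_uminus
  have R: "homog_uv od False (commutator (in_u h) (in_v h))"
    "homog_uv od False (w * anticommutator (in_u e) (in_v f) - (in_v h - in_u h))"
    "homog_uv od True (w * (w + k) * commutator (in_u h) (in_v e)
       - (- (w + k - 1) * commutator (in_u h) (in_u e - in_v e)
          + w * (in_u h * (in_v e + in_u e - const_uv e0) - (in_u e - const_uv e0) * in_u h)))"
    "homog_uv od True (w * (w - k) * commutator (in_u h) (in_v f)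
       - ((w - k + 1) * commutator (in_u h) (in_u f - in_v f)
          - w * (in_u h * (in_v f + in_u f + const_uv f0) - (in_u f + const_uv f0) * in_u h)))"
    "homog_uv od False (2 * w\<^sup>2 * anticommutator (in_u e) (in_v e)
       - (w * commutator (in_u e) (in_v e) - 2 * w * anticommutator (const_uv e0) (in_u e - in_v e)
          - (in_u e - in_v e)\<^sup>2))"
    "homog_uv od False (2 * w\<^sup>2 * anticommutator (in_u f) (in_v f)
       - (- w * commutator (in_u f) (in_v f) - 2 * w * anticommutator (const_uv f0) (in_u f - in_v f)
          - (in_u f - in_v f)\<^sup>2))"
    "homog_series od True
       (e ^ 3 - (e * anticommutator e (fps_const e0) + commutator (fps_const (e0\<^sup>2)) e))"
    "homog_series od True
       (f ^ 3 - (- f * anticommutator f (fps_const f0) + commutator (fps_const (f0\<^sup>2)) f))"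
    unfolding power2_eq_square power3_eq_cube
    by ((unfold anticommutator_def commutator_def)?, blast intro: hom homs)+
  fix r :: "A_gen free"
  assume r: "r \<in> relators"
  show "\<exists>p. r \<in> free_homog odd_generator p"
    using r double_series_coeffs_homog[OF R(1)] double_series_coeffs_homog[OF R(2)] double_series_coeffs_homog[OF R(3)]
      double_series_coeffs_homog[OF R(4)] double_series_coeffs_homog[OF R(5)] double_series_coeffs_homog[OF R(6)]
      series_coeffs_homog[OF R(7)] series_coeffs_homog[OF R(8)]
    unfolding od_def[symmetric] relators_A_gen_def A_rel by (elim UnE) blast+
  have z: "cong_series e 0" "cong_series f 0" "cong_series h 1"
    "cong_series (fps_const e0) 0" "cong_series (fps_const f0) 0"
    "cong_series (fps_const (e0\<^sup>2)) 0" "cong_series (fps_const (f0\<^sup>2)) 0"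
    unfolding e_def f_def h_def e0_def f0_def
    using cong_series_of[of "\<lambda>k. generator (gen_e k)" 0] cong_series_of[of "\<lambda>k. generator (gen_f k)" 0]
      cong_series_of[of "\<lambda>k. generator (gen_h k)" 1]
    by (auto intro: cong_series_const simp: lookup_generator power2_eq_square augmentation_mult)
  have zuv: "cong_uv (in_u e) 0" "cong_uv (in_v e) 0" "cong_uv (in_u f) 0" "cong_uv (in_v f) 0"
    "cong_uv (in_u h) 1" "cong_uv (in_v h) 1" "cong_uv (const_uv e0) 0" "cong_uv (const_uv f0) 0"
    using z[THEN cong_uv_in_u] z[THEN cong_uv_in_v]
    by (auto simp: in_u_simps in_v_simps e0_def f0_def lookup_generator intro: cong_uv_const)
  note cu = zuv cong_uv_add cong_uv_diff cong_uv_uminus cong_uv_mult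
  note cs = z cong_series_add cong_series_diff cong_series_uminus cong_series_mult
  have T: "cong_uv (commutator (in_u h) (in_v h)) 0"
    "cong_uv (w * anticommutator (in_u e) (in_v f) - (in_v h - in_u h)) 0"
    "cong_uv (w * (w + k) * commutator (in_u h) (in_v e)
       - (- (w + k - 1) * commutator (in_u h) (in_u e - in_v e)
          + w * (in_u h * (in_v e + in_u e - const_uv e0) - (in_u e - const_uv e0) * in_u h))) 0"
    "cong_uv (w * (w - k) * commutator (in_u h) (in_v f)
       - ((w - k + 1) * commutator (in_u h) (in_u f - in_v f)
          - w * (in_u h * (in_v f + in_u f + const_uv f0) - (in_u f + const_uv f0) * in_u h))) 0"
    "cong_uv (2 * w\<^sup>2 * anticommutator (in_u e) (in_v e)
       - (w * commutator (in_u e) (in_v e) - 2 * w * anticommutator (const_uv e0) (in_u e - in_v e)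
          - (in_u e - in_v e)\<^sup>2)) 0"
    "cong_uv (2 * w\<^sup>2 * anticommutator (in_u f) (in_v f)
       - (- w * commutator (in_u f) (in_v f) - 2 * w * anticommutator (const_uv f0) (in_u f - in_v f)
          - (in_u f - in_v f)\<^sup>2)) 0"
    unfolding commutator_def anticommutator_def power2_eq_square
    by (rule cong_uv_trans, (rule cu | rule cong_uv_refl)+, simp)+
  have T': "cong_series
       (e ^ 3 - (e * anticommutator e (fps_const e0) + commutator (fps_const (e0\<^sup>2)) e)) 0"
    "cong_series
       (f ^ 3 - (- f * anticommutator f (fps_const f0) + commutator (fps_const (f0\<^sup>2)) f)) 0"
    unfolding commutator_def anticommutator_def power3_eq_cube
    by (rule cong_series_trans, (rule cs)+, simp)+
  show "Poly_Mapping.lookup r 0 = 0"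
    using r T[THEN double_series_coeffs_augmented] T'[THEN series_coeffs_augmented]
    unfolding relators_A_gen_def A_rel by (elim UnE) blast+
qed

end

lemma homog_uv_odd_mult:
  "homog_uv od (odd m) F \<Longrightarrow> homog_uv od (odd n) G \<Longrightarrow> odd (m + n) = p \<Longrightarrow> homog_uv od p (F * G)"
  by (rule homog_uv_mult) auto

lemma homog_series_odd_mult:
  "homog_series od (odd m) F \<Longrightarrow> homog_series od (odd n) G \<Longrightarrow> odd (m + n) = p \<Longrightarrow>
   homog_series od p (F * G)"
  by (rule homog_series_mult) auto

lemma minus_one_power_cases: "(-1) ^ n = (1 :: 'a::ring_1) \<or> (-1) ^ n = (-1 :: 'a)"
  by (cases "even n") auto

lemma homog_uv_sign: "homog_uv od False ((-1) ^ n)"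
  using minus_one_power_cases[of n, where 'a = "'a free fls fls"]
  by (elim disjE) (simp_all only: homog_uv_uminus homog_uv_vars)

lemma homog_series_sign: "homog_series od False ((-1) ^ n)"
  using minus_one_power_cases[of n, where 'a = "'a free fps"]
  by (elim disjE) (simp_all only: homog_series_uminus homog_series_one)

lemma homog_uv_J: "homog_uv od (odd (grade i + grade j)) (J_matrix i j)"
  by (auto simp: J_matrix_def grade_def intro: homog_uv_zero homog_uv_vars homog_uv_uminus)

lemma homog_series_J: "homog_series od (odd (grade i + grade j)) (J_matrix i j)"
  by (auto simp: J_matrix_def grade_def
      intro: homog_series_zero homog_series_one homog_series_uminus)

lemma homog_uv_supertranspose:
  assumes "\<And>i j. homog_uv od (odd (grade i + grade j + n)) (A i j)"
  shows "homog_uv od (odd (grade i + grade j + n)) (supertranspose A i j)"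
  unfolding supertranspose_def
proof (intro homog_uv_sum)
  fix a b :: 3
  have s: "homog_uv od (odd 0) ((-1) ^ (grade i * grade j + grade i))"
    using homog_uv_sign by simp
  show "homog_uv od (odd (grade i + grade j + n))
    ((-1) ^ (grade i * grade j + grade i) * J_matrix i a * A b a * J_matrix j b)"
    by (rule homog_uv_odd_mult[OF homog_uv_odd_mult[OF homog_uv_odd_mult[OF s homog_uv_J refl]
        assms refl] homog_uv_J]) auto
qed

lemma homog_series_supertranspose:
  assumes "\<And>i j. homog_series od (odd (grade i + grade j)) (A i j)"
  shows "homog_series od (odd (grade i + grade j)) (supertranspose A i j)"
  unfolding supertranspose_def
proof (intro homog_series_sum)
  fix a b :: 3
  have s: "homog_series od (odd 0) ((-1) ^ (grade i * grade j + grade i))"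
    using homog_series_sign by simp
  show "homog_series od (odd (grade i + grade j))
    ((-1) ^ (grade i * grade j + grade i) * J_matrix i a * A b a * J_matrix j b)"
    by (rule homog_series_odd_mult[OF homog_series_odd_mult[OF homog_series_odd_mult[OF s
        homog_series_J refl] assms refl] homog_series_J]) auto
qed

lemma homog_uv_matrix2_mult:
  assumes "\<And>i j k l. homog_uv od (odd (grade i + grade j + (grade k + grade l))) (M i j k l)"
    and "\<And>i j k l. homog_uv od (odd (grade i + grade j + (grade k + grade l))) (N i j k l)"
  shows "homog_uv od (odd (grade i + grade j + (grade k + grade l))) (matrix2_mult M N i j k l)"
  unfolding matrix2_mult_def
proof (intro homog_uv_sum)
  fix a b :: 3
  have s: "homog_uv od (odd 0) ((-1) ^ ((grade k + grade b) * (grade a + grade j)))"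
    using homog_uv_sign by simp
  show "homog_uv od (odd (grade i + grade j + (grade k + grade l)))
    ((-1) ^ ((grade k + grade b) * (grade a + grade j)) * M i a k b * N a j b l)"
    by (rule homog_uv_odd_mult[OF homog_uv_odd_mult[OF s assms(1) refl] assms(2)]) auto
qed

lemma homog_uv_R: "homog_uv od (odd (grade i + grade j + (grade k + grade l))) (R_matrix i j k l)"
proof -
  have P: "homog_uv od (odd (grade i + grade j + (grade k + grade l))) (P_matrix i j k l)" for i j k l
  proof (cases "k = j \<and> l = i")
    case True
    hence "even (grade i + grade j + (grade k + grade l))" by auto
    thus ?thesis using True homog_uv_sign by (simp add: P_matrix_def)
  next
    case False
    thus ?thesis by (simp only: P_matrix_def if_False homog_uv_zero)
  qed
  have Pt: "homog_uv od (odd (grade i + grade j + (grade k + grade l))) (P_matrix_t1 i j k l)"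
    unfolding P_matrix_t1_def by (rule homog_uv_supertranspose) (rule P)
  have I: "homog_uv od (odd (grade i + grade j + (grade k + grade l))) (id_matrix2 i j k l)"
    by (auto simp: id_matrix2_def homog_uv_zero homog_uv_vars)
  have w: "homog_uv od False (u_var - v_var)" "homog_uv od False (const_uv (kappa *\<^sub>C 1))"
    by (intro homog_uv_intros)+
  show ?thesis
    unfolding R_matrix_def Let_def
    by (intro homog_uv_diff homog_uv_add homog_uv_even_mult P Pt I w)
qed

lemma cong_uv_matrix2_mult:
  assumes "\<And>i j k l. cong_uv (M i j k l) (M' i j k l)" "\<And>i j k l. cong_uv (N i j k l) (N' i j k l)"
  shows "cong_uv (matrix2_mult M N i j k l) (matrix2_mult M' N' i j k l)"
  unfolding matrix2_mult_def
  by (intro cong_uv_sum cong_uv_mult cong_uv_refl assms)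

lemma matrix2_mult_id: "matrix2_mult M id_matrix2 = M" "matrix2_mult id_matrix2 M = M"
proof -
  have "(-1) ^ ((grade k + grade b) * (grade a + grade q)) * M i a k b * id_matrix2 a q b s
      = (if b = s then if a = q then M i q k s else 0 else 0)" for i q k s a b
    by (auto simp: id_matrix2_def uminus_power_if)
  thus "matrix2_mult M id_matrix2 = M"
    by (intro ext) (simp add: matrix2_mult_def)
  have "(-1) ^ ((grade k + grade b) * (grade a + grade q)) * id_matrix2 i a k b * M a q b s
      = (if k = b then if i = a then M i q k s else 0 else 0)" for i q k s a b
    by (auto simp: id_matrix2_def uminus_power_if)
  thus "matrix2_mult id_matrix2 M = M"
    by (intro ext) (simp add: matrix2_mult_def)
qed

lemma supertranspose_one:
  "supertranspose (\<lambda>i j. if i = j then 1 else 0) i j = (if i = j then 1 else 0)"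
  using exhaust_3[of i] exhaust_3[of j]
  by (auto simp: supertranspose_def sum_3 J_matrix_def grade_def)

instantiation U_gen :: presentation
begin

definition odd_generator_U_gen :: "U_gen \<Rightarrow> bool" where
  "odd_generator_U_gen g = (case g of gen_L i j _ \<Rightarrow> odd (grade i + grade j))"

definition relators_U_gen :: "U_gen free set" where
  "relators_U_gen = U_relators"

instance
proof
  define L where "L = (\<lambda>i j. series_of (if i = j then 1 else 0) (\<lambda>n. generator (gen_L i j n)))"
  define L1 where "L1 = in_first (\<lambda>i j. in_u (L i j))"
  define L2 where "L2 = in_second (\<lambda>i j. in_v (L i j))"
  define RLL where "RLL = matrix2_mult (matrix2_mult R_matrix L1) L2"
  define LLR where "LLR = matrix2_mult (matrix2_mult L2 L1) R_matrix"
  define Lt where "Lt = supertranspose (\<lambda>i j. shift_series (- kappa) (L i j))"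
  define od where "od = (odd_generator :: U_gen \<Rightarrow> bool)"
  have U_rel: "U_relators = (\<Union>i j k l. double_series_coeffs (RLL i j k l - LLR i j k l)) \<union>
     (\<Union>i j. series_coeffs ((\<Sum>k\<in>UNIV. Lt i k * L k j) - (if i = j then 1 else 0)))"
    unfolding U_relators_def Let_def L_def L1_def L2_def RLL_def LLR_def Lt_def by (rule refl)
  have od: "od (gen_L i j n) = odd (grade i + grade j)" for i j n
    by (simp add: od_def odd_generator_U_gen_def)
  have L: "homog_series od (odd (grade i + grade j)) (L i j)" for i j
  proof -
    have "generator (gen_L i j n) \<in> free_homog od (odd (grade i + grade j))" for n
      using free_homog_generator[of "gen_L i j n" od] by (simp only: od)
    thus ?thesis
      unfolding L_def by (intro homog_series_of) (auto simp: free_homog_zero free_homog_one)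
  qed
  have L1: "homog_uv od (odd (grade i + grade j + (grade k + grade l))) (L1 i j k l)" for i j k l
    using homog_uv_in_u[OF L[of i j]] by (auto simp: L1_def in_first_def homog_uv_zero)
  have L2: "homog_uv od (odd (grade i + grade j + (grade k + grade l))) (L2 i j k l)" for i j k l
    using homog_uv_in_v[OF L[of k l]] by (auto simp: L2_def in_second_def homog_uv_zero)
  have RTT: "homog_uv od (odd (grade i + grade j + (grade k + grade l))) (RLL i j k l - LLR i j k l)"
    for i j k l
    unfolding RLL_def LLR_def
    by (intro homog_uv_diff homog_uv_matrix2_mult L1 L2 homog_uv_R)
  have LL: "homog_series od (odd (grade i + grade j))
      ((\<Sum>k\<in>UNIV. Lt i k * L k j) - (if i = j then 1 else 0))" for i j
  proof (intro homog_series_diff homog_series_sum)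
    show "homog_series od (odd (grade i + grade j)) (Lt i k * L k j)" for k
      unfolding Lt_def
      by (rule homog_series_odd_mult[OF homog_series_supertranspose[OF homog_series_shift[OF L]] L])
         auto
    show "homog_series od (odd (grade i + grade j)) (if i = j then 1 else 0)"
      by (auto intro: homog_series_zero homog_series_one)
  qed
  fix r :: "U_gen free"
  assume r: "r \<in> relators"
  show "\<exists>p. r \<in> free_homog odd_generator p"
    using r double_series_coeffs_homog[OF RTT] series_coeffs_homog[OF LL]
    unfolding od_def[symmetric] relators_U_gen_def U_rel by blast
  have Lc: "cong_series (L i j) (if i = j then 1 else 0)" for i j
    using cong_series_of[of "\<lambda>n. generator (gen_L i j n)" "if i = j then 1 else 0"]
    by (auto simp: L_def lookup_generator)
  have L1c: "cong_uv (L1 i j k l) (id_matrix2 i j k l)" for i j k l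
    using cong_uv_in_u[OF Lc[of i j]]
    by (auto simp: L1_def in_first_def id_matrix2_def in_u_simps cong_uv_refl)
  have L2c: "cong_uv (L2 i j k l) (id_matrix2 i j k l)" for i j k l
    using cong_uv_in_v[OF Lc[of k l]]
    by (auto simp: L2_def in_second_def id_matrix2_def in_v_simps cong_uv_refl)
  have RTTc: "cong_uv (RLL i j k l - LLR i j k l) 0" for i j k l
  proof -
    have "cong_uv (RLL i j k l - LLR i j k l)
      (matrix2_mult (matrix2_mult R_matrix id_matrix2) id_matrix2 i j k l
        - matrix2_mult (matrix2_mult id_matrix2 id_matrix2) R_matrix i j k l)"
      unfolding RLL_def LLR_def
      by (intro cong_uv_diff cong_uv_matrix2_mult L1c L2c cong_uv_refl)
    thus ?thesis by (simp add: matrix2_mult_id)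
  qed
  have shift: "cong_series (shift_series (- kappa) (L i j)) (if i = j then 1 else 0)" for i j
  proof -
    have "shift_series (- kappa) (1 :: U_gen free fps) = 1" "shift_series (- kappa) (0 :: U_gen free fps) = 0"
      by (simp_all add: shift_series_def fps_eq_iff fps_compose_nth)
    thus ?thesis using cong_series_shift[OF Lc[of i j], of "- kappa"] by auto
  qed
  have Ltc: "cong_series (Lt i j) (if i = j then 1 else 0)" for i j
  proof -
    have "cong_series (Lt i j) (supertranspose (\<lambda>i j. if i = j then 1 else 0) i j)"
      unfolding Lt_def supertranspose_def
      by (intro cong_series_sum cong_series_mult cong_series_refl shift)
    thus ?thesis by (simp add: supertranspose_one)
  qed
  have LLc: "cong_series ((\<Sum>k\<in>UNIV. Lt i k * L k j) - (if i = j then 1 else 0)) 0" for i j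
  proof -
    have "cong_series ((\<Sum>k\<in>UNIV. Lt i k * L k j) - (if i = j then 1 else 0))
      ((\<Sum>k\<in>UNIV. (if i = k then 1 else 0) * (if k = j then 1 else 0)) - (if i = j then 1 else 0))"
      by (intro cong_series_diff cong_series_sum cong_series_mult Ltc Lc cong_series_refl)
    moreover have "(\<Sum>k\<in>UNIV. (if i = k then 1 else 0) * (if k = j then 1 else 0))
        = (if i = j then 1 else (0 :: U_gen free fps))"
      by (simp add: if_distrib[of "\<lambda>x. x * _"] cong: if_cong)
    ultimately show ?thesis by simp
  qed
  show "Poly_Mapping.lookup r 0 = 0"
    using r double_series_coeffs_augmented[OF RTTc] series_coeffs_augmented[OF LLc]
    unfolding relators_U_gen_def U_rel by blast
qed

end

type_synonym A_plus = "A_gen presented"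

type_synonym U_R = "U_gen presented"


section \<open>Transport of the coalgebra structure\<close>

definition tensor_map ::
    "('a::complex_space \<Rightarrow> 'c::complex_space) \<Rightarrow> ('b::complex_space \<Rightarrow> 'd::complex_space) \<Rightarrow>
     ('a, 'b) tensor \<Rightarrow> ('c, 'd) tensor" where
  "tensor_map f g = tensor_lift (\<lambda>a b. f a \<otimes> g b)"

definition tensor_assoc ::
    "(('a::complex_space, 'b::complex_space) tensor, 'c::complex_space) tensor \<Rightarrow>
     ('a, ('b, 'c) tensor) tensor" where
  "tensor_assoc = tensor_lift (\<lambda>t c. tensor_lift (\<lambda>a b. a \<otimes> (b \<otimes> c)) t)"

text \<open>A coalgebra in superalgebras: comultiplication and counit are superalgebra homomorphisms,
  hence determined by their values on generators.\<close>

definition is_superbialgebra ::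
    "('a::superalgebra \<Rightarrow> ('a, 'a) tensor) \<Rightarrow> ('a \<Rightarrow> complex) \<Rightarrow> bool" where
  "is_superbialgebra \<Delta> \<epsilon> \<longleftrightarrow>
     superalgebra_hom \<Delta> \<and> superalgebra_hom \<epsilon> \<and>
     (\<forall>x. tensor_assoc (tensor_map \<Delta> id (\<Delta> x)) = tensor_map id \<Delta> (\<Delta> x)) \<and>
     (\<forall>x. tensor_lift (\<lambda>a b. \<epsilon> a *\<^sub>C b) (\<Delta> x) = x) \<and>
     (\<forall>x. tensor_lift (\<lambda>a b. \<epsilon> b *\<^sub>C a) (\<Delta> x) = x)"

definition tensor_series ::
    "'a::complex_space fps \<Rightarrow> 'b::complex_space fps \<Rightarrow> ('a, 'b) tensor fps" (infixr \<open>\<otimes>\<^sub>s\<close> 76) where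
  "F \<otimes>\<^sub>s G = Abs_fps (\<lambda>n. \<Sum>i\<le>n. fps_nth F i \<otimes> fps_nth G (n - i))"

definition L_series :: "3 \<Rightarrow> 3 \<Rightarrow> U_R fps" where
  "L_series i j = series_of (if i = j then 1 else 0) (\<lambda>n. gen (gen_L i j n))"

definition is_U_coalgebra :: "(U_R \<Rightarrow> (U_R, U_R) tensor) \<Rightarrow> (U_R \<Rightarrow> complex) \<Rightarrow> bool" where
  "is_U_coalgebra \<Delta> \<epsilon> \<longleftrightarrow>
     superalgebra_hom \<Delta> \<and> superalgebra_hom \<epsilon> \<and>
     (\<forall>i j. map_series \<Delta> (L_series i j) = (\<Sum>k\<in>UNIV. L_series i k \<otimes>\<^sub>s L_series k j)) \<and>
     (\<forall>i j. map_series \<epsilon> (L_series i j) = (if i = j then 1 else 0))"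

definition e_series :: "A_plus fps" where "e_series = series_of 0 (\<lambda>k. gen (gen_e k))"

definition f_series :: "A_plus fps" where "f_series = series_of 0 (\<lambda>k. gen (gen_f k))"

definition h_series :: "A_plus fps" where "h_series = series_of 1 (\<lambda>k. gen (gen_h k))"

definition is_phi :: "(A_plus \<Rightarrow> U_R) \<Rightarrow> bool" where
  "is_phi \<phi> \<longleftrightarrow> superalgebra_iso \<phi> \<and>
     (let L = L_series; K = inverse_series (L_series 3 3) in
       map_series \<phi> (reflect_series e_series) = K * L 2 3 \<and>
       map_series \<phi> (reflect_series f_series) = L 3 2 * K \<and>
       map_series \<phi> (reflect_series h_series) = L 2 2 * K + L 3 2 * K * L 2 3 * K)"

definition is_transported ::
    "(A_plus \<Rightarrow> U_R) \<Rightarrow> (U_R \<Rightarrow> (U_R, U_R) tensor) \<Rightarrow> (U_R \<Rightarrow> complex) \<Rightarrow>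
     (A_plus \<Rightarrow> (A_plus, A_plus) tensor) \<Rightarrow> (A_plus \<Rightarrow> complex) \<Rightarrow> bool" where
  "is_transported \<phi> \<Delta>U \<epsilon>U \<Delta> \<epsilon> \<longleftrightarrow> \<Delta>U \<circ> \<phi> = tensor_map \<phi> \<phi> \<circ> \<Delta> \<and> \<epsilon> = \<epsilon>U \<circ> \<phi>"


section \<open>The coproduct formulas\<close>

text \<open>\<open>\<Sum>\<^sub>k\<^sub>>\<^sub>0 (-1)\<^sup>k Z\<^sup>k\<close>, for \<open>Z\<close> without constant term.\<close>

definition alternating_series :: "'a::ring_1 fps \<Rightarrow> 'a fps" where
  "alternating_series Z = fps_compose (Abs_fps (\<lambda>k. if k = 0 then 0 else (-1) ^ k)) Z"

definition e_zero :: "A_plus fps" where "e_zero = fps_const (gen (gen_e 0))"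

definition f_zero :: "A_plus fps" where "f_zero = fps_const (gen (gen_f 0))"

definition X12 :: "(A_plus, A_plus) tensor fps" where
  "X12 = (let e = e_series; f' = shift_series (-1) f_series in
     alternating_series (f' \<otimes>\<^sub>s e + (f'\<^sup>2 + anticommutator f' f_zero) \<otimes>\<^sub>s (e\<^sup>2 - anticommutator e e_zero)))"

definition Y12 :: "(A_plus, A_plus) tensor fps" where
  "Y12 = (let e' = shift_series 1 e_series; f = f_series in
     alternating_series (f \<otimes>\<^sub>s e' + (f\<^sup>2 + anticommutator f f_zero) \<otimes>\<^sub>s (e'\<^sup>2 - anticommutator e' e_zero)))"

end

theory Submission
  imports Defs
begin

text \<open>Put \<open>K = L\<^sup>3\<^sup>3(u)\<^sup>-\<^sup>1\<close>. The RTT relation at \<open>v = u + 1\<close> moves \<open>K\<close> to the right at the price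
  of a shift: \<open>e(-u) = K(u) L\<^sup>2\<^sup>3(u) = L\<^sup>2\<^sup>3(u + 1) K(u + 1)\<close>, and it gives two formulas for
  \<open>h(-u)\<close>. Its coefficients of \<open>v\<^sup>-\<^sup>1\<close> are commutation relations with \<open>e\<^sub>0\<close> and \<open>f\<^sub>0\<close>; they
  express the remaining entries \<open>L\<^sup>i\<^sup>j K\<close> through \<open>e\<close>, \<open>f\<close>, \<open>h\<close>, \<open>e\<^sub>0\<close>, \<open>f\<^sub>0\<close>. Since \<open>L\<^sup>3\<^sup>3\<close> and
  \<open>K\<close> are even, the coproduct of \<open>L\<^sup>3\<^sup>3\<close> factors as \<open>(1 + Z) (L\<^sup>3\<^sup>3 \<otimes> L\<^sup>3\<^sup>3)\<close>, where \<open>1 + X\<^sub>1\<^sub>2\<close>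
  is the inverse of \<open>1 + Z\<close>. With \<open>K\<close> on the right, \<open>\<Delta>(e) = \<Delta>(L\<^sup>2\<^sup>3) \<Delta>(L\<^sup>3\<^sup>3)\<^sup>-\<^sup>1\<close> at \<open>u + 1\<close>
  becomes the stated formula, and similarly for \<open>\<Delta>(f)\<close> at \<open>u\<close>. The coproduct of \<open>h\<close> follows from
  \<open>h = 1 + {e, f\<^sub>0}\<close>.\<close>

text \<open>The point v = u + 1 is chosen because there, away from the index pairs on which
  \<open>P_matrix_t1\<close> acts, the R-matrix is (kappa - 1)(P - I) up to normalization. It
  annihilates the pair (3,3), so components of the RTT relation shrink to short exchange rules
  between u and u + 1.

  The obstacle: v = u + 1 cannot be put into Laurent double series, because the coefficients of v^-m
  may contain unbounded powers of u. The relation is therefore cleared of poles and read as a power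
  series in x = u^-1 and y = v^-1. Then y = x/(1 + x) gives a finite sum in each degree.

  Two formulas for h are needed because of the Koszul sign: products with e \<otimes> 1 on the left
  carry no sign and call for L^22 K - L^23 K L^32 K at u + 1, while 1 \<otimes> f passes the odd f
  and calls for L^22 K + L^32 K L^23 K at u. The shifts in X_12 and Y_12 arise because, with K on
  the right, L^32 K is f at the same argument but L^23 K is e at an argument lowered by one.\<close>

section \<open>Substitution of scalar series\<close>

text \<open>The inner variable of the double series becomes \<open>g\<close>, the outer one \<open>h\<close>; both must have
  constant term \<open>0\<close>.\<close>

definition subst_two :: "complex fps \<Rightarrow> complex fps \<Rightarrow> 'a::complex_space fps fps \<Rightarrow> 'a fps" where
  "subst_two g h D = Abs_fps (\<lambda>n. \<Sum>m\<le>n. \<Sum>k\<le>n.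
     fps_nth (g ^ k * h ^ m) n *\<^sub>C fps_nth (fps_nth D m) k)"

definition subst_series :: "complex fps \<Rightarrow> 'a::complex_space fps \<Rightarrow> 'a fps" where
  "subst_series g F = Abs_fps (\<lambda>n. \<Sum>k\<le>n. fps_nth (g ^ k) n *\<^sub>C fps_nth F k)"

text \<open>Each factor g or h raises the order by at least one. This makes the truncation at n in
  \<open>subst_two\<close> and \<open>subst_series\<close> lossless and keeps every rearrangement
  below finite.\<close>

lemma nth_power_mult_power_eq_0:
  fixes g h :: "'a::comm_ring_1 fps"
  assumes "fps_nth g 0 = 0" "fps_nth h 0 = 0" "n < k + m"
  shows "fps_nth (g ^ k * h ^ m) n = 0"
  unfolding fps_mult_nth
proof (rule sum.neutral, rule ballI)
  fix i assume "i \<in> {0..n}"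
  hence "i < k \<or> n - i < m" using assms(3) by auto
  thus "fps_nth (g ^ k) i * fps_nth (h ^ m) (n - i) = 0"
    using startsby_zero_power_prefix[OF assms(1), of k] startsby_zero_power_prefix[OF assms(2), of
        m]
    by auto
qed

lemma sum_triangle_rectangle:
  fixes f :: "nat \<Rightarrow> nat \<Rightarrow> 'a::comm_monoid_add"
  assumes "\<And>i j. n < i + j \<Longrightarrow> f i j = 0"
  shows "(\<Sum>k\<le>n. \<Sum>i\<le>k. f i (k - i)) = (\<Sum>i\<le>n. \<Sum>j\<le>n. f i j)"
proof -
  have "(\<Sum>k\<le>n. \<Sum>i\<le>k. f i (k - i)) = (\<Sum>(i, j)\<in>{(i, j). i + j \<le> n}. f i j)"
    by (rule sum.triangle_reindex_eq[symmetric])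
  also have "\<dots> = (\<Sum>(i, j)\<in>{..n} \<times> {..n}. f i j)"
    by (rule sum.mono_neutral_left) (use assms in \<open>auto simp: not_le intro: leI\<close>)
  finally show ?thesis by (simp add: sum.cartesian_product)
qed

lemma scaleC_sum_left: "sum f A *\<^sub>C (x :: 'a::complex_space) = (\<Sum>i\<in>A. f i *\<^sub>C x)"
  by (induction A rule: infinite_finite_induct) (simp_all add: scaleC_add_left)

lemma subst_two_nth_bound:
  assumes "fps_nth g 0 = 0" "fps_nth h 0 = 0" "n \<le> N"
  shows "fps_nth (subst_two g h D) n = (\<Sum>m\<le>N. \<Sum>k\<le>N.
     fps_nth (g ^ k * h ^ m) n *\<^sub>C fps_nth (fps_nth D m) k)"
proof -
  have "(\<Sum>m\<le>N. \<Sum>k\<le>N. fps_nth (g ^ k * h ^ m) n *\<^sub>C fps_nth (fps_nth D m) k)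
     = (\<Sum>m\<le>n. \<Sum>k\<le>N. fps_nth (g ^ k * h ^ m) n *\<^sub>C fps_nth (fps_nth D m) k)"
    using assms by (intro sum.mono_neutral_right) (auto simp: nth_power_mult_power_eq_0 not_le)
  also have "\<dots> = (\<Sum>m\<le>n. \<Sum>k\<le>n. fps_nth (g ^ k * h ^ m) n *\<^sub>C fps_nth (fps_nth D m) k)"
    using assms
    by (intro sum.cong refl sum.mono_neutral_right) (auto simp: nth_power_mult_power_eq_0 not_le)
  finally show ?thesis by (simp add: subst_two_def)
qed

text \<open>The substituted series are complex, so their coefficients pass through the
  noncommutative coefficients of D and D'. Both sides become the same sum over four exponents,
  weighted by the n-th coefficient of \<open>g ^ (k + k') * h ^ (m + m')\<close>; the vanishing of
  this weight for large exponents lets the Cauchy triangles grow to rectangles.\<close>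

lemma subst_two_mult:
  fixes D D' :: "'a::complex_algebra fps fps"
  assumes g: "fps_nth g 0 = 0" and h: "fps_nth h 0 = 0"
  shows "subst_two g h (D * D') = subst_two g h D * subst_two g h D'"
proof (rule fps_ext)
  fix n
  define c where "c = (\<lambda>m k n. fps_nth (g ^ k * h ^ m) n)"
  define d where "d = (\<lambda>m k. fps_nth (fps_nth D m) k)"
  define d' where "d' = (\<lambda>m k. fps_nth (fps_nth D' m) k)"
  have c0: "c m k n = 0" if "n < k + m" for m k n
    using nth_power_mult_power_eq_0[OF g h that] by (simp add: c_def)
  have cc: "(\<Sum>i\<le>n. c m k i * c m' k' (n - i)) = c (m + m') (k + k') n" for m k m' k' n
  proof -
    have "g ^ (k + k') * h ^ (m + m') = (g ^ k * h ^ m) * (g ^ k' * h ^ m')"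
      by (simp add: power_add algebra_simps)
    thus ?thesis by (simp only: c_def) (simp only: fps_mult_nth[of "g ^ k * h ^ m"] atMost_atLeast0)
  qed
  have "fps_nth (subst_two g h (D * D')) n
      = (\<Sum>M\<le>n. \<Sum>K\<le>n. c M K n *\<^sub>C (\<Sum>m\<le>M. \<Sum>k\<le>K. d m k * d' (M - m) (K - k)))"
    by (simp add: subst_two_def c_def d_def d'_def fps_mult_nth fps_sum_nth atMost_atLeast0)
  also have "\<dots> = (\<Sum>M\<le>n. \<Sum>m\<le>M. \<Sum>K\<le>n. \<Sum>k\<le>K.
      c (m + (M - m)) (k + (K - k)) n *\<^sub>C (d m k * d' (M - m) (K - k)))"
  proof (rule sum.cong[OF refl])
    fix M
    have "(\<Sum>K\<le>n. c M K n *\<^sub>C (\<Sum>m\<le>M. \<Sum>k\<le>K. d m k * d' (M - m) (K - k)))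
        = (\<Sum>K\<le>n. \<Sum>m\<le>M. \<Sum>k\<le>K. c (m + (M - m)) (k + (K - k)) n *\<^sub>C (d m k * d' (M - m) (K - k)))"
      by (simp add: scaleC_sum)
    thus "(\<Sum>K\<le>n. c M K n *\<^sub>C (\<Sum>m\<le>M. \<Sum>k\<le>K. d m k * d' (M - m) (K - k)))
        = (\<Sum>m\<le>M. \<Sum>K\<le>n. \<Sum>k\<le>K. c (m + (M - m)) (k + (K - k)) n *\<^sub>C (d m k * d' (M - m) (K - k)))"
      by (simp add: sum.swap[of _ "{..n}" "{..M}"])
  qed
  also have "\<dots> = (\<Sum>m\<le>n. \<Sum>m'\<le>n. \<Sum>K\<le>n. \<Sum>k\<le>K.
      c (m + m') (k + (K - k)) n *\<^sub>C (d m k * d' m' (K - k)))"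
    by (rule sum_triangle_rectangle) (simp add: c0)
  also have "\<dots> = (\<Sum>m\<le>n. \<Sum>m'\<le>n. \<Sum>k\<le>n. \<Sum>k'\<le>n. c (m + m') (k + k') n *\<^sub>C (d m k * d' m' k'))"
    by (intro sum.cong refl sum_triangle_rectangle) (simp add: c0)
  finally have L: "fps_nth (subst_two g h (D * D')) n
    = (\<Sum>m\<le>n. \<Sum>m'\<le>n. \<Sum>k\<le>n. \<Sum>k'\<le>n. c (m + m') (k + k') n *\<^sub>C (d m k * d' m' k'))" .
  have "fps_nth (subst_two g h D * subst_two g h D') n
    = (\<Sum>i\<le>n. (\<Sum>m\<le>n. \<Sum>k\<le>n. c m k i *\<^sub>C d m k) * (\<Sum>m'\<le>n. \<Sum>k'\<le>n. c m' k' (n - i) *\<^sub>C d' m' k'))"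
    unfolding fps_mult_nth atMost_atLeast0[symmetric]
    by (intro sum.cong refl) (simp add: subst_two_nth_bound[OF g h, of _ n] c_def d_def d'_def)
  also have "\<dots> = (\<Sum>i\<le>n. \<Sum>m\<le>n. \<Sum>m'\<le>n. \<Sum>k\<le>n. \<Sum>k'\<le>n.
      (c m k i * c m' k' (n - i)) *\<^sub>C (d m k * d' m' k'))"
    by (simp add: sum_product mult_scaleC_left mult_scaleC_right scaleC_scaleC scaleC_sum
        mult.commute)
  also have "\<dots> = (\<Sum>m\<le>n. \<Sum>m'\<le>n. \<Sum>k\<le>n. \<Sum>k'\<le>n. \<Sum>i\<le>n.
      (c m k i * c m' k' (n - i)) *\<^sub>C (d m k * d' m' k'))"
    by ((rule trans[OF sum.swap], rule sum.cong[OF refl])+, rule refl)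
  finally show "fps_nth (subst_two g h (D * D')) n = fps_nth (subst_two g h D * subst_two g h D') n"
    by (simp add: L scaleC_sum_left[symmetric] cc)
qed

lemma subst_two_add: "subst_two g h (D + D') = subst_two g h D + subst_two g h D'"
  by (rule fps_ext) (simp add: subst_two_def scaleC_add_right sum.distrib)

lemma subst_two_const: "subst_two g h (fps_const F) = subst_series g F"
proof (rule fps_ext)
  fix n
  have "(\<Sum>m\<le>n. \<Sum>k\<le>n. fps_nth (g ^ k * h ^ m) n *\<^sub>C fps_nth (fps_nth (fps_const F) m) k)
    = (\<Sum>m\<in>{0}. \<Sum>k\<le>n. fps_nth (g ^ k * h ^ m) n *\<^sub>C fps_nth (fps_nth (fps_const F) m) k)"
    by (intro sum.mono_neutral_right) auto
  thus "fps_nth (subst_two g h (fps_const F)) n = fps_nth (subst_series g F) n"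
    by (simp add: subst_two_def subst_series_def)
qed

lemma subst_two_outer: "subst_two g h (map_series fps_const F) = subst_series h F"
proof (rule fps_ext)
  fix n
  have "(\<Sum>k\<le>n. fps_nth (g ^ k * h ^ m) n *\<^sub>C fps_nth (fps_nth (map_series fps_const F) m) k)
    = fps_nth (h ^ m) n *\<^sub>C fps_nth F m" for m
  proof -
    have "(\<Sum>k\<le>n. fps_nth (g ^ k * h ^ m) n *\<^sub>C fps_nth (fps_nth (map_series fps_const F) m) k)
      = (\<Sum>k\<in>{0}. fps_nth (g ^ k * h ^ m) n *\<^sub>C fps_nth (fps_nth (map_series fps_const F) m) k)"
      by (intro sum.mono_neutral_right) (auto simp: map_series_def)
    thus ?thesis by (simp add: map_series_def)
  qed
  thus "fps_nth (subst_two g h (map_series fps_const F)) n = fps_nth (subst_series h F) n"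
    by (simp add: subst_two_def subst_series_def)
qed

text \<open>A series in u alone is a double series constant in v, so this is the two-variable case
  with outer series 0.\<close>

lemma subst_series_mult:
  fixes F G :: "'a::complex_algebra fps"
  assumes "fps_nth g 0 = 0"
  shows "subst_series g (F * G) = subst_series g F * subst_series g G"
  using subst_two_mult[OF assms, of 0 "fps_const F" "fps_const G"] by (simp add: subst_two_const)

lemma subst_series_add: "subst_series g (F + G) = subst_series g F + subst_series g G"
  by (rule fps_ext) (simp add: subst_series_def scaleC_add_right sum.distrib)

lemma subst_series_zero: "subst_series g 0 = 0"
  by (rule fps_ext) (simp add: subst_series_def)

lemma subst_series_sum: "subst_series g (sum F A) = (\<Sum>i\<in>A. subst_series g (F i))"
  by (induction A rule: infinite_finite_induct) (simp_all add: subst_series_add subst_series_zero)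

lemma subst_series_const: "subst_series g (fps_const a) = fps_const a"
proof (rule fps_ext)
  fix n
  have "(\<Sum>k\<le>n. fps_nth (g ^ k) n *\<^sub>C fps_nth (fps_const a) k)
    = (\<Sum>k\<in>{0}. fps_nth (g ^ k) n *\<^sub>C fps_nth (fps_const a) k)"
    by (intro sum.mono_neutral_right) auto
  thus "fps_nth (subst_series g (fps_const a)) n = fps_nth (fps_const a) n"
    by (simp add: subst_series_def scaleC_one)
qed

lemma subst_series_one: "subst_series g (1 :: 'a::complex_algebra fps) = 1"
  using subst_series_const[of g 1] by simp

lemma subst_series_X_self: "subst_series fps_X F = F"
proof (rule fps_ext)
  fix n
  have "(\<Sum>k\<le>n. fps_nth (fps_X ^ k) n *\<^sub>C fps_nth F k)
      = (\<Sum>k\<in>{n}. fps_nth (fps_X ^ k) n *\<^sub>C fps_nth F k)"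
    by (intro sum.mono_neutral_right) auto
  thus "fps_nth (subst_series fps_X F) n = fps_nth F n"
    by (simp add: subst_series_def scaleC_one)
qed

lemma subst_series_subst_series:
  assumes g: "fps_nth g 0 = 0" and h: "fps_nth h 0 = 0"
  shows "subst_series g (subst_series h F) = subst_series (h oo g) F"
proof (rule fps_ext)
  fix n
  have "fps_nth (subst_series g (subst_series h F)) n
      = (\<Sum>m\<le>n. fps_nth (g ^ m) n *\<^sub>C (\<Sum>k\<le>n. fps_nth (h ^ k) m *\<^sub>C fps_nth F k))"
  proof -
    have "(\<Sum>k\<le>m. fps_nth (h ^ k) m *\<^sub>C fps_nth F k) = (\<Sum>k\<le>n. fps_nth (h ^ k) m *\<^sub>C fps_nth F k)"
      if "m \<le> n" for m
      using that startsby_zero_power_prefix[OF h] by (intro sum.mono_neutral_left) auto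
    thus ?thesis by (simp add: subst_series_def)
  qed
  also have "\<dots> = (\<Sum>m\<le>n. \<Sum>k\<le>n. (fps_nth (h ^ k) m * fps_nth (g ^ m) n) *\<^sub>C fps_nth F k)"
    by (simp add: scaleC_sum scaleC_scaleC mult.commute)
  also have "\<dots> = (\<Sum>k\<le>n. (\<Sum>m\<le>n. fps_nth (h ^ k) m * fps_nth (g ^ m) n) *\<^sub>C fps_nth F k)"
    by (subst sum.swap) (simp add: scaleC_sum_left)
  also have "\<dots> = (\<Sum>k\<le>n. fps_nth ((h oo g) ^ k) n *\<^sub>C fps_nth F k)"
    by (simp add: fps_compose_power[OF g] fps_compose_nth atMost_atLeast0)
  finally show "fps_nth (subst_series g (subst_series h F)) n = fps_nth (subst_series (h oo g) F) n"
    by (simp add: subst_series_def)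
qed

lemma map_series_nth [simp]: "fps_nth (map_series f F) n = f (fps_nth F n)"
  by (simp add: map_series_def)

lemma complex_linear_simps:
  assumes "complex_linear f"
  shows "f (x + y) = f x + f y" "f (c *\<^sub>C x) = c *\<^sub>C f x" "f 0 = 0" "f (- x) = - f x"
    "f (x - y) = f x - f y" "f (sum g A) = (\<Sum>i\<in>A. f (g i))"
proof -
  show add: "f (x + y) = f x + f y" for x y using assms by (simp add: complex_linear_def)
  show scale: "f (c *\<^sub>C x) = c *\<^sub>C f x" for c x using assms by (simp add: complex_linear_def)
  show zero: "f 0 = 0" using scale[of 0 0] by simp
  show minus: "f (- x) = - f x" for x using scale[of "-1" x] by
      (simp add: scaleC_minus_left scaleC_one)
  show "f (x - y) = f x - f y" using add[of x "- y"] minus by simp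
  show "f (sum g A) = (\<Sum>i\<in>A. f (g i))"
    by (induction A rule: infinite_finite_induct) (simp_all add: add zero)
qed

lemma map_series_subst_series:
  assumes "complex_linear f"
  shows "map_series f (subst_series g F) = subst_series g (map_series f F)"
  by (rule fps_ext) (simp add: subst_series_def complex_linear_simps[OF assms])

text \<open>Links composition over a noncommutative ring, as in \<open>shift_series\<close> and
  \<open>reflect_series\<close>, to substitution of a complex series. Identities between shifts then
  become identities between complex series under \<open>fps_compose\<close>.\<close>

lemma fps_compose_scalar_eq_subst_series:
  fixes F :: "'a::complex_algebra fps"
  shows "fps_compose F (map_series (\<lambda>c. c *\<^sub>C 1) g) = subst_series g F"
proof -
  have "map_series (\<lambda>c. c *\<^sub>C (1 :: 'a)) g ^ k = map_series (\<lambda>c. c *\<^sub>C 1) (g ^ k)" for k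
  proof (induction k)
    case 0
    show ?case by (rule fps_ext) (simp add: scaleC_one)
  next
    case (Suc k)
    thus ?case
      by (intro fps_ext)
        (simp add: fps_mult_nth mult_scaleC_left mult_scaleC_right scaleC_scaleC scaleC_sum_left
            mult.commute)
  qed
  thus ?thesis
    by (intro fps_ext) (simp add: fps_compose_nth subst_series_def mult_scaleC_right
        atMost_atLeast0)
qed

section \<open>Shifts and reflection of the argument u\<close>

definition shifted_inverse :: "complex \<Rightarrow> complex fps" where
  "shifted_inverse c = series_of 0 (\<lambda>n. (- c) ^ n)"

lemma shifted_inverse_nth_0: "fps_nth (shifted_inverse c) 0 = 0"
  by (simp add: shifted_inverse_def series_of_def)

lemma shift_series_eq_subst: "shift_series c F = subst_series (shifted_inverse c) F"
proof -
  have "series_of 0 (\<lambda>n. ((- c) ^ n) *\<^sub>C (1::'a)) = map_series (\<lambda>c. c *\<^sub>C 1) (shifted_inverse c)"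
    by (rule fps_ext) (auto simp: series_of_def shifted_inverse_def split: nat.split)
  thus ?thesis by (simp add: shift_series_def fps_compose_scalar_eq_subst_series)
qed

lemma reflect_series_eq_subst:
  fixes F :: "'a::complex_algebra fps"
  shows "reflect_series F = subst_series (- fps_X) F"
proof -
  have "(- fps_X :: 'a fps) = map_series (\<lambda>c. c *\<^sub>C 1) (- fps_X)"
    by (rule fps_ext) (simp add: fps_X_nth scaleC_minus_left scaleC_one)
  thus ?thesis by (simp add: reflect_series_def fps_compose_scalar_eq_subst_series)
qed

text \<open>With x = u^-1 this is (u + c)^-1 = x / (1 + c x), stated without division. As 1 + c x is
  not a zero divisor, it determines \<open>shifted_inverse c\<close>.\<close>

lemma shifted_inverse_mult: "shifted_inverse c * (1 + fps_const c * fps_X) = fps_X"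
proof (rule fps_ext)
  fix n
  show "fps_nth (shifted_inverse c * (1 + fps_const c * fps_X)) n = fps_nth fps_X n"
    by (cases n)
       (auto simp: distrib_left mult.left_commute[of _
           "fps_const c"] shifted_inverse_def series_of_def
         fps_X_nth split: nat.split)
qed

lemma fps_mult_left_cancel_nth_0:
  fixes a b c :: "complex fps"
  assumes "a * c = b * c" "fps_nth c 0 \<noteq> 0"
  shows "a = b"
  using assms by auto

text \<open>Translations of u compose additively; in the coordinate x they are the Moebius maps x /
  (1 + c x).\<close>

lemma shifted_inverse_compose: "shifted_inverse c oo shifted_inverse d = shifted_inverse (c + d)"
proof -
  let ?d = "shifted_inverse d"
  have d: "?d * (1 + fps_const d * fps_X) = fps_X" by (rule shifted_inverse_mult)
  have "(shifted_inverse c oo ?d) * (1 + fps_const c * ?d) = ?d"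
    using arg_cong[OF shifted_inverse_mult[of c], of "\<lambda>F. F oo ?d"]
    by (simp add: fps_compose_mult_distrib fps_compose_add_distrib shifted_inverse_nth_0)
  hence "(shifted_inverse c oo ?d) * ((1 + fps_const c * ?d) * (1 + fps_const d * fps_X)) = fps_X"
    by (metis d mult.assoc)
  moreover have "(1 + fps_const c * ?d) * (1 + fps_const d * fps_X) = 1 + fps_const (c + d) * fps_X"
  proof -
    have "(1 + fps_const c * ?d) * (1 + fps_const d * fps_X)
        = 1 + fps_const d * fps_X + fps_const c * (?d * (1 + fps_const d * fps_X))"
      by (simp only: distrib_right mult_1_left mult.assoc)
    thus ?thesis by (simp only: d) (simp add: distrib_right flip: fps_const_add)
  qed
  ultimately have "(shifted_inverse c oo ?d) * (1 + fps_const (c + d) * fps_X)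
      = shifted_inverse (c + d) * (1 + fps_const (c + d) * fps_X)"
    by (simp add: shifted_inverse_mult)
  thus ?thesis by (rule fps_mult_left_cancel_nth_0) simp
qed

text \<open>(-u + c)^-1 = -(u - c)^-1. Reflection therefore reverses the direction of a
  shift.\<close>

lemma shifted_inverse_reflect:
  "shifted_inverse c oo - fps_X = - shifted_inverse (- c)"
proof -
  have "fps_nth (- fps_X :: complex fps) 0 = 0" by simp
  hence "(shifted_inverse c oo - fps_X) * (1 + fps_const (- c) * fps_X) = - fps_X"
    using arg_cong[OF shifted_inverse_mult[of c], of "\<lambda>F. F oo - fps_X"]
    by (simp add: fps_compose_mult_distrib fps_compose_add_distrib flip: fps_const_neg)
  also have "\<dots> = - shifted_inverse (- c) * (1 + fps_const (- c) * fps_X)"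
    by (simp only: shifted_inverse_mult mult_minus_left)
  finally show ?thesis by (rule fps_mult_left_cancel_nth_0) simp
qed

lemma neg_X_compose:
  assumes "fps_nth g 0 = 0" shows "- fps_X oo g = - (g :: complex fps)"
  using assms by (simp add: fps_compose_uminus)

lemma shift_series_shift_series:
  "shift_series c (shift_series d F) = shift_series (c + d) F"
  by (simp add: shift_series_eq_subst subst_series_subst_series shifted_inverse_nth_0
      shifted_inverse_compose add.commute)

lemma shift_series_0: "shift_series 0 F = F"
proof -
  have "shifted_inverse 0 = fps_X"
    using shifted_inverse_mult[of 0] by simp
  thus ?thesis by (simp add: shift_series_eq_subst subst_series_X_self)
qed

lemma reflect_series_reflect_series:
  fixes F :: "'a::complex_algebra fps"
  shows "reflect_series (reflect_series F) = F"
  by (simp add: reflect_series_eq_subst subst_series_subst_series neg_X_compose subst_series_X_self)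

lemma reflect_series_shift_series:
  "reflect_series (shift_series c F) = shift_series (- c) (reflect_series F)"
  by (simp add: reflect_series_eq_subst shift_series_eq_subst subst_series_subst_series
      shifted_inverse_nth_0 shifted_inverse_reflect neg_X_compose)

text \<open>Geometric series in a noncommutative ring: \<open>1 + alternating_series Z\<close> is
  the sum of all (-Z)^k. In degree n only k \<le> n matter, since Z has no constant term, and the
  product with 1 + Z telescopes.\<close>

lemma alternating_series_inverse:
  fixes Z :: "'a::ring_1 fps"
  assumes "fps_nth Z 0 = 0"
  shows "(1 + alternating_series Z) * (1 + Z) = 1"
proof (rule fps_ext)
  fix n
  have Z: "fps_nth (Z ^ k) j = 0" if "j < k" for j k
    using startsby_zero_power_prefix[OF assms] that by blast
  \<comment> \<open>The common bound n, rather than j, lets the sums over j and k be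
    exchanged.\<close>
  have Y: "fps_nth (1 + alternating_series Z) j = (\<Sum>k\<le>n. (- 1) ^ k * fps_nth (Z ^ k) j)"
    if "j \<le> n" for j
  proof -
    have "fps_nth (1 + alternating_series Z) j
        = (\<Sum>k\<le>j. (- 1) ^ k * fps_nth (Z ^ k) j)"
    proof -
      have "(\<Sum>k\<le>j. (- 1) ^ k * fps_nth (Z ^ k) j)
        = fps_nth 1 j + (\<Sum>k\<in>{..j} - {0}. (- 1) ^ k * fps_nth (Z ^ k) j)"
        by (subst sum.remove[of _ 0]) simp_all
      also have "(\<Sum>k\<in>{..j} - {0}. (- 1) ^ k * fps_nth (Z ^ k) j)
        = (\<Sum>k\<in>{..j} - {0}. (if k = 0 then 0 else (- 1) ^ k) * fps_nth (Z ^ k) j)"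
        by (intro sum.cong) auto
      also have "\<dots> = (\<Sum>k\<le>j. (if k = 0 then 0 else (- 1) ^ k) * fps_nth (Z ^ k) j)"
        by (rule sum.mono_neutral_left) auto
      finally show ?thesis
        by (simp add: alternating_series_def fps_compose_nth atMost_atLeast0)
    qed
    also have "\<dots> = (\<Sum>k\<le>n. (- 1) ^ k * fps_nth (Z ^ k) j)"
      using that by (intro sum.mono_neutral_left) (auto simp: Z)
    finally show ?thesis .
  qed
  have "fps_nth ((1 + alternating_series Z) * Z) n
      = (\<Sum>j\<le>n. (\<Sum>k\<le>n. (- 1) ^ k * fps_nth (Z ^ k) j) * fps_nth Z (n - j))"
    unfolding fps_mult_nth atMost_atLeast0[symmetric] by (intro sum.cong refl)
        (simp only: Y atMost_iff)
  also have "\<dots> = (\<Sum>k\<le>n. (- 1) ^ k * (\<Sum>j\<le>n. fps_nth (Z ^ k) j * fps_nth Z (n - j)))"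
    by (simp add: sum_distrib_right sum_distrib_left mult.assoc) (rule sum.swap)
  also have "\<dots> = (\<Sum>k\<le>n. (- 1) ^ k * fps_nth (Z ^ Suc k) n)"
    by (simp only: power_Suc2 fps_mult_nth atMost_atLeast0)
  finally have "fps_nth ((1 + alternating_series Z) * (1 + Z)) n
    = (\<Sum>k\<le>n. (- 1) ^ k * fps_nth (Z ^ k) n) + (\<Sum>k\<le>n. (- 1) ^ k * fps_nth (Z ^ Suc k) n)"
    by (simp add: distrib_left Y[OF order_refl, simplified])
  also have "\<dots> = (\<Sum>k\<le>n. (- 1) ^ k * fps_nth (Z ^ k) n - (- 1) ^ Suc k * fps_nth (Z ^ Suc k) n)"
    by (simp add: sum.distrib sum_negf)
  also have "\<dots> = fps_nth 1 n"
    by (subst sum_telescope) (simp add: Z del: power_Suc)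
  finally show "fps_nth ((1 + alternating_series Z) * (1 + Z)) n = fps_nth 1 n" .
qed

lemma inverse_series_right:
  fixes F :: "'a::ring_1 fps"
  assumes "fps_nth F 0 = 1"
  shows "F * inverse_series F = 1"
  using fps_right_inverse'[of 1 F 1] assms by (simp add: inverse_series_def)

lemma inverse_series_left:
  fixes F :: "'a::ring_1 fps"
  assumes "fps_nth F 0 = 1"
  shows "inverse_series F * F = 1"
  using fps_left_inverse[of 1 F] assms by (simp add: inverse_series_def)

section \<open>The RTT relation in the super Yangian\<close>

text \<open>Series rings carry no parity and no \<open>complex_space\<close> structure here, so
  coefficient maps, embeddings and substitutions of series share only this weaker notion. It
  suffices to transport matrix relations.\<close>

definition ring_map :: "('a::ring_1 \<Rightarrow> 'b::ring_1) \<Rightarrow> bool" where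
  "ring_map \<phi> \<longleftrightarrow> (\<forall>x y. \<phi> (x + y) = \<phi> x + \<phi> y) \<and> (\<forall>x y. \<phi> (x * y) = \<phi> x * \<phi> y) \<and> \<phi> 1 = 1"

lemma ring_map_simps:
  assumes "ring_map \<phi>"
  shows "\<phi> (x + y) = \<phi> x + \<phi> y" "\<phi> (x * y) = \<phi> x * \<phi> y" "\<phi> 1 = 1" "\<phi> 0 = 0" "\<phi> (- x) = - \<phi> x"
    "\<phi> (x - y) = \<phi> x - \<phi> y" "\<phi> (sum f A) = (\<Sum>i\<in>A. \<phi> (f i))" "\<phi> (x ^ n) = \<phi> x ^ n"
proof -
  show add: "\<phi> (x + y) = \<phi> x + \<phi> y" for x y using assms by (simp add: ring_map_def)
  show mult: "\<phi> (x * y) = \<phi> x * \<phi> y" for x y using assms by (simp add: ring_map_def)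
  show one: "\<phi> 1 = 1" using assms by (simp add: ring_map_def)
  show zero: "\<phi> 0 = 0" using add[of 0 0] by simp
  show minus: "\<phi> (- x) = - \<phi> x" for x
    using add[of x "- x"] by (simp add: zero eq_neg_iff_add_eq_0 add.commute)
  show "\<phi> (x - y) = \<phi> x - \<phi> y" using add[of x "- y"] minus by simp
  show "\<phi> (sum f A) = (\<Sum>i\<in>A. \<phi> (f i))"
    by (induction A rule: infinite_finite_induct) (simp_all add: add zero)
  show "\<phi> (x ^ n) = \<phi> x ^ n" by (induction n) (simp_all add: one mult)
qed

lemma ring_map_matrix2_mult:
  "ring_map \<phi> \<Longrightarrow> \<phi> (matrix2_mult M N i j k l)
    = matrix2_mult (\<lambda>i j k l. \<phi> (M i j k l)) (\<lambda>i j k l. \<phi> (N i j k l)) i j k l"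
  by (simp add: matrix2_mult_def ring_map_simps)

lemma ring_map_J_matrix: "ring_map \<phi> \<Longrightarrow> \<phi> (J_matrix i j) = J_matrix i j"
  by (simp add: J_matrix_def ring_map_simps)

lemma ring_map_compose: "ring_map f \<Longrightarrow> ring_map g \<Longrightarrow> ring_map (\<lambda>x. g (f x))"
  by (simp add: ring_map_def)

lemma ring_map_supertranspose:
  "ring_map \<phi> \<Longrightarrow> \<phi> (supertranspose M i j) = supertranspose (\<lambda>i j. \<phi> (M i j)) i j"
  by (simp add: supertranspose_def ring_map_simps ring_map_J_matrix)

lemma ring_map_id_matrix2: "ring_map \<phi> \<Longrightarrow> \<phi> (id_matrix2 i j k l) = id_matrix2 i j k l"
  by (simp add: id_matrix2_def ring_map_simps)

lemma ring_map_P_matrix: "ring_map \<phi> \<Longrightarrow> \<phi> (P_matrix i j k l) = P_matrix i j k l"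
  by (simp add: P_matrix_def ring_map_simps)

lemma ring_map_P_matrix_t1: "ring_map \<phi> \<Longrightarrow> \<phi> (P_matrix_t1 i j k l) = P_matrix_t1 i j k l"
  by (simp add: P_matrix_t1_def ring_map_supertranspose ring_map_P_matrix)

lemma ring_map_in_first: "ring_map \<phi> \<Longrightarrow> \<phi> (in_first A i j k l) = in_first (\<lambda>i j. \<phi> (A i j)) i j k l"
  by (simp add: in_first_def ring_map_simps)

lemma ring_map_in_second: "ring_map \<phi> \<Longrightarrow> \<phi> (in_second A i j k l) =
    in_second (\<lambda>i j. \<phi> (A i j)) i j k l"
  by (simp add: in_second_def ring_map_simps)

lemma ring_map_map_series:
  assumes "ring_map \<phi>"
  shows "ring_map (map_series \<phi>)"
proof -
  have "\<phi> (if n = 0 then 1 else 0) = (if n = 0 then 1 else 0)" for n :: nat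
    by (simp add: ring_map_simps[OF assms])
  thus ?thesis
    unfolding ring_map_def
    by (auto simp: fps_eq_iff fps_mult_nth ring_map_simps[OF assms])
qed

lemma ring_map_abs_presented: "ring_map abs_presented"
  by (simp add: ring_map_def plus_presented.abs_eq times_presented.abs_eq one_presented.abs_eq)

lemma abs_presented_eq_0_iff: "abs_presented x = 0 \<longleftrightarrow> x \<in> relator_ideal"
  by (simp add: zero_presented.abs_eq presented.abs_eq_iff relator_cong_def)

lemma relator_in_ideal: "r \<in> relators \<Longrightarrow> r \<in> relator_ideal"
  using relator_ideal.relator[of r 1 1] by simp

section \<open>The RTT relation without poles, in x = u^-1 and y = v^-1\<close>

definition laurent_of :: "'a::ring_1 fps fps \<Rightarrow> 'a fls fls" where
  "laurent_of F = fps_to_fls (map_series fps_to_fls F)"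

lemma ring_map_fps_to_fls: "ring_map fps_to_fls"
  by (simp add: ring_map_def fls_times_fps_to_fls)

lemma ring_map_laurent_of: "ring_map laurent_of"
  unfolding laurent_of_def
  by (rule ring_map_compose[OF ring_map_map_series[OF ring_map_fps_to_fls] ring_map_fps_to_fls])

lemma laurent_of_nth: "fls_nth (fls_nth (laurent_of F) (int m)) (int n) = fps_nth (fps_nth F m) n"
  by (simp add: laurent_of_def)

lemma laurent_of_in_u: "laurent_of (fps_const F) = in_u F"
  by (simp add: laurent_of_def in_u_def fls_eq_iff)

lemma laurent_of_in_v: "laurent_of (map_series fps_const F) = in_v F"
proof -
  have "fps_to_fls (fps_const a) = fls_const a" for a :: 'a
    by (simp add: fls_eq_iff)
  hence "map_series fps_to_fls (map_series fps_const F) = map_series fls_const F"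
    by (intro fps_ext) simp
  thus ?thesis by (simp add: laurent_of_def in_v_def)
qed

abbreviation x_var :: "'a::ring_1 fps fps" where "x_var \<equiv> fps_const fps_X"

abbreviation y_var :: "'a::ring_1 fps fps" where "y_var \<equiv> fps_X"

text \<open>\<open>u\<^sup>-\<^sup>2 v\<^sup>-\<^sup>2\<close> times the matrix \<open>R_matrix\<close>, which has no poles in \<open>x = u\<^sup>-\<^sup>1\<close> and \<open>y =
  v\<^sup>-\<^sup>1\<close>.\<close>

definition R_poly :: "'a::complex_algebra fps fps matrix2" where
  "R_poly i j k l = (let d = y_var - x_var; p = x_var * y_var; \<kappa>
      = fps_const (fps_const (kappa *\<^sub>C 1)) in
     d * (d + p * \<kappa>) * id_matrix2 i j k l + p * (d + p * \<kappa>) * P_matrix i j k l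
       - p * d * P_matrix_t1 i j k l)"

lemma laurent_of_vars:
  fixes a :: "'a::ring_1"
  shows "laurent_of (x_var :: 'a fps fps) = fls_const fls_X" "laurent_of (y_var :: 'a fps fps)
      = fls_X"
    "laurent_of (fps_const (fps_const a)) = const_uv a"
proof -
  have "fps_to_fls (fps_X :: 'a fps) = fls_X" "fps_to_fls (fps_X :: 'a fls fps) = fls_X"
    by (auto simp: fls_eq_iff fps_X_nth)
  moreover have "map_series fps_to_fls (fps_X :: 'a fps fps) = fps_X"
    by (auto intro!: fps_ext simp: fps_X_nth)
  moreover have "fps_to_fls (fps_const a) = fls_const a" for a :: 'a
    by (simp add: fls_eq_iff)
  ultimately show "laurent_of (x_var :: 'a fps fps) = fls_const fls_X"
    "laurent_of (y_var :: 'a fps fps) = fls_X" "laurent_of (fps_const (fps_const a)) = const_uv a"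
    by (simp_all add: laurent_of_in_u in_u_def const_uv_def, simp add: laurent_of_def)
qed

lemma fls_X_central: "fls_X * F = F * (fls_X :: 'a::ring_1 fls)"
  by (simp add: fls_X_times_conv_shift)

lemma laurent_of_xy_central: "laurent_of (x_var * y_var) * F = F * laurent_of (x_var * y_var)"
proof -
  have "fls_const fls_X * G = G * fls_const (fls_X :: 'a fls)" for G :: "'a fls fls"
    by (simp add: fls_eq_iff fls_X_central)
  thus ?thesis
    using fls_X_central[of F]
    by (simp add: laurent_of_vars ring_map_simps[OF ring_map_laurent_of]) (metis mult.assoc)
qed

text \<open>Since (u v)^-1 (u - v) = v^-1 - u^-1, each factor w or w + kappa absorbs one p. Terms
  with a single such factor keep the other p, which explains the shape of
  \<open>R_poly\<close>.\<close>

lemma laurent_of_R_poly: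
  fixes i j k l :: 3
  defines "p \<equiv> laurent_of (x_var * y_var) :: 'a::complex_algebra fls fls"
  shows "laurent_of (R_poly i j k l) = p * p * (R_matrix i j k l :: 'a fls fls)"
proof -
  define w :: "'a fls fls" where "w = u_var - v_var"
  define \<kappa> :: "'a fls fls" where "\<kappa> = const_uv (kappa *\<^sub>C 1)"
  define d :: "'a fls fls" where "d = laurent_of (y_var - x_var)"
  note lr = ring_map_simps[OF ring_map_laurent_of]
  have p: "p * F = F * p" for F unfolding p_def by (rule laurent_of_xy_central)
  have "fls_const fls_X * u_var = (1 :: 'a fls fls)" "fls_X * v_var = (1 :: 'a fls fls)"
    by (simp_all add: u_var_def v_var_def fls_X_times_conv_shift)
  hence "p * w = d"
    unfolding p_def w_def d_def lr laurent_of_vars right_diff_distrib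
  proof -
    assume u: "fls_const fls_X * u_var = (1 :: 'a fls fls)" and v: "fls_X * v_var
        = (1 :: 'a fls fls)"
    have "fls_const fls_X * fls_X * u_var = fls_X * (fls_const fls_X * (u_var :: 'a fls fls))"
      by (simp only: fls_X_central mult.assoc)
    thus "fls_const fls_X * fls_X * u_var - fls_const fls_X * fls_X * v_var
        = fls_X - fls_const (fls_X :: 'a fls)"
      by (simp add: u v mult.assoc)
  qed
  hence pw: "p * (w * F) = d * F" "p * ((w + \<kappa>) * F) = (d + p * \<kappa>) * F" for F
    by (simp_all only: mult.assoc[symmetric, of p] distrib_left)
  have "p * p * (w * (w + \<kappa>) * F) = d * (d + p * \<kappa>) * F" for F
  proof -
    have "p * p * (w * (w + \<kappa>) * F) = (p * d) * ((w + \<kappa>) * F)"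
      by (simp only: mult.assoc pw)
    also have "\<dots> = d * (p * ((w + \<kappa>) * F))" by (simp only: p[of d] mult.assoc)
    finally show ?thesis by (simp only: pw mult.assoc)
  qed
  moreover have "p * p * ((w + \<kappa>) * F) = p * (d + p * \<kappa>) * F" "p * p * (w * F) = p * d * F" for F
    by (simp_all add: mult.assoc pw)
  ultimately have "p * p * R_matrix i j k l
      = d * (d + p * \<kappa>) * id_matrix2 i j k l + p * (d + p * \<kappa>) * P_matrix i j k l
        - p * d * P_matrix_t1 i j k l"
    by (simp only: R_matrix_def Let_def w_def[symmetric] \<kappa>_def[symmetric] right_diff_distrib[of
        "p * p"]
        distrib_left[of "p * p"])
  also have "\<dots> = laurent_of (R_poly i j k l)"
    by (simp only: R_poly_def Let_def lr ring_map_id_matrix2 ring_map_P_matrix ring_map_P_matrix_t1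
        ring_map_laurent_of \<kappa>_def d_def p_def laurent_of_vars)
  finally show ?thesis ..
qed

lemma matrix2_mult_central:
  fixes p :: "'a::ring_1"
  assumes "\<And>F. p * F = F * p"
  shows "matrix2_mult (\<lambda>i j k l. p * M i j k l) N i j k l = p * matrix2_mult M N i j k l"
    and "matrix2_mult M (\<lambda>i j k l. p * N i j k l) i j k l = p * matrix2_mult M N i j k l"
proof -
  have "p * (s * m * n) = s * (p * m) * n" "p * (s * m * n) = s * m * (p * n)" for s m n
    by (metis assms mult.assoc)+
  thus "matrix2_mult (\<lambda>i j k l. p * M i j k l) N i j k l = p * matrix2_mult M N i j k l"
    "matrix2_mult M (\<lambda>i j k l. p * N i j k l) i j k l = p * matrix2_mult M N i j k l"
    by (simp_all add: matrix2_mult_def sum_distrib_left)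
qed

definition L_first :: "U_R fps fps matrix2" where
  "L_first = in_first (\<lambda>i j. fps_const (L_series i j))"

definition L_second :: "U_R fps fps matrix2" where
  "L_second = in_second (\<lambda>i j. map_series fps_const (L_series i j))"

text \<open>Multiplication by u^-2 v^-2 only relabels coefficients, so those of the pole-free
  difference D are among the relators and vanish in the presented algebra. The map
  \<open>laurent_of\<close> preserves coefficients, which brings the relation down to power
  series.\<close>

theorem rtt_relation:
  "matrix2_mult (matrix2_mult R_poly L_first) L_second i j k l
    = matrix2_mult (matrix2_mult L_second L_first) R_poly i j k l"
proof -
  define L where "L = (\<lambda>i j. series_of (if i = j then 1 else 0) (\<lambda>n. generator (gen_L i j n)))"
  define L1 where "L1 = in_first (\<lambda>i j. fps_const (L i j))"
  define L2 where "L2 = in_second (\<lambda>i j. map_series fps_const (L i j))"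
  define D where "D = matrix2_mult (matrix2_mult R_poly L1) L2 i j k l
    - matrix2_mult (matrix2_mult L2 L1) R_poly i j k l"
  define D' where "D' = matrix2_mult (matrix2_mult R_matrix (in_first (\<lambda>i j.
      in_u (L i j)))) (in_second (\<lambda>i j. in_v (L i j))) i j k l
    - matrix2_mult (matrix2_mult (in_second (\<lambda>i j. in_v (L i j))) (in_first (\<lambda>i j.
        in_u (L i j)))) R_matrix i j k l"
  define p where "p = (laurent_of (x_var * y_var) :: U_gen free fls fls)"
  note lr = ring_map_simps[OF ring_map_laurent_of]
  have p: "p * F = F * p" for F unfolding p_def by (rule laurent_of_xy_central)
  have pp: "p * p * F = F * (p * p)" for F by (metis p mult.assoc)
  have R: "laurent_of (R_poly i j k l) = p * p * R_matrix i j k l" for i j k l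
    unfolding p_def by (rule laurent_of_R_poly)
  have D: "laurent_of D = p * p * D'"
    unfolding D_def D'_def lr ring_map_matrix2_mult[OF ring_map_laurent_of] L1_def L2_def
      ring_map_in_first[OF ring_map_laurent_of] ring_map_in_second[OF ring_map_laurent_of]
      laurent_of_in_u laurent_of_in_v R right_diff_distrib
    by (simp only: matrix2_mult_central[OF pp])
  have "double_series_coeffs D' \<subseteq> U_relators"
    unfolding U_relators_def Let_def D'_def L_def by blast
  hence D'_ideal: "fls_nth (fls_nth D' m) n \<in> relator_ideal" for m n
    using relator_in_ideal unfolding double_series_coeffs_def relators_U_gen_def[symmetric] by blast
  have "fls_nth (fls_nth (p * F) m) n = fls_nth (fls_nth F (m - 1)) (n - 1)" for F m n
    unfolding p_def lr laurent_of_vars mult.assoc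
    by (simp add: fls_X_times_conv_shift)
  hence "fls_nth (fls_nth (laurent_of D) m) n \<in> relator_ideal" for m n
    by (simp add: D D'_ideal mult.assoc)
  hence D_ideal: "fps_nth (fps_nth D m) n \<in> relator_ideal" for m n
    by (metis laurent_of_nth)
  define \<phi> :: "U_gen free fps fps \<Rightarrow> U_R fps fps" where "\<phi> = map_series (map_series abs_presented)"
  have \<phi>: "ring_map \<phi>"
    unfolding \<phi>_def by (intro ring_map_map_series ring_map_abs_presented)
  note pr = ring_map_simps[OF \<phi>]
  have abs_0: "abs_presented (0 :: U_gen free) = 0" by (simp add: zero_presented.abs_eq)
  have abs_1: "abs_presented (1 :: U_gen free) = 1" by (simp add: one_presented.abs_eq)
  have "\<phi> D = 0"
    by (intro fps_ext) (simp add: \<phi>_def abs_presented_eq_0_iff D_ideal)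
  moreover have LL: "map_series abs_presented (L i j) = L_series i j" for i j
    by (rule fps_ext) (auto simp: L_def L_series_def series_of_def gen_def abs_0 abs_1 split:
        nat.split)
  have c: "\<phi> (fps_const F) = fps_const (map_series abs_presented F)"
    "\<phi> (map_series fps_const F) = map_series fps_const (map_series abs_presented F)" for F
    by (auto intro!: fps_ext simp: \<phi>_def abs_0)
  have "\<phi> x_var = x_var"  "\<phi> y_var = y_var" "\<phi> (fps_const (fps_const (kappa *\<^sub>C 1)))
      = fps_const (fps_const (kappa *\<^sub>C 1))"
    using abs_1 by (auto intro!: fps_ext simp: \<phi>_def fps_X_nth abs_0
        scaleC_presented.abs_eq[symmetric])
  hence "\<phi> (R_poly i j k l) = R_poly i j k l" for i j k l
    by (simp add: R_poly_def Let_def pr ring_map_id_matrix2 ring_map_P_matrix ring_map_P_matrix_t1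
        \<phi>)
  ultimately show ?thesis
    by (simp add: D_def L1_def L2_def pr ring_map_matrix2_mult[OF \<phi>] ring_map_in_first[OF \<phi>]
        ring_map_in_second[OF \<phi>]
        c LL L_first_def[symmetric] L_second_def[symmetric])
qed

section \<open>The RTT relation on the line v = u + c\<close>

lemma subst_series_X: "subst_series g (fps_X :: 'a::complex_algebra fps)
    = map_series (\<lambda>c. c *\<^sub>C 1) g"
  if "fps_nth g 0 = 0"
proof (rule fps_ext)
  fix n
  have "(\<Sum>k\<le>n. fps_nth (g ^ k) n *\<^sub>C fps_nth (fps_X :: 'a fps) k)
    = (\<Sum>k\<in>{..n} \<inter> {1}. fps_nth (g ^ k) n *\<^sub>C fps_nth (fps_X :: 'a fps) k)"
    by (rule sum.mono_neutral_right) (auto simp: fps_X_nth)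
  thus "fps_nth (subst_series g (fps_X :: 'a fps)) n = fps_nth (map_series (\<lambda>c. c *\<^sub>C 1) g) n"
    using that by (cases n) (auto simp: subst_series_def)
qed

lemma ring_map_subst_two:
  "fps_nth g 0 = 0 \<Longrightarrow> fps_nth h 0 = 0 \<Longrightarrow> ring_map (subst_two g h :: 'a::complex_algebra fps fps \<Rightarrow> _)"
  using subst_two_const[of g h "1 :: 'a fps"]
  by (simp add: ring_map_def subst_two_add subst_two_mult subst_series_one)

lemma scalar_central: "(c *\<^sub>C 1) * x = x * (c *\<^sub>C 1 :: 'a::complex_algebra)"
  by (simp add: mult_scaleC_left mult_scaleC_right)

lemma scalar_series_central:
  fixes F :: "'a::complex_algebra fps"
  shows "map_series (\<lambda>c. c *\<^sub>C 1) g * F = F * map_series (\<lambda>c. c *\<^sub>C 1) g"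
proof (rule fps_ext)
  fix n
  have "fps_nth (map_series (\<lambda>c. c *\<^sub>C 1) g * F) n = (\<Sum>i\<le>n. fps_nth F (n
      - i) * (fps_nth g i *\<^sub>C 1))"
    by (simp add: fps_mult_nth atMost_atLeast0 scalar_central)
  also have "\<dots> = (\<Sum>i\<le>n. fps_nth F i * (fps_nth g (n - i) *\<^sub>C 1))"
    by (rule sum.reindex_bij_witness[of _ "\<lambda>i. n - i" "\<lambda>i. n - i"]) auto
  also have "\<dots> = fps_nth (F * map_series (\<lambda>c. c *\<^sub>C 1) g) n"
    by (simp add: fps_mult_nth atMost_atLeast0)
  finally show "fps_nth (map_series (\<lambda>c. c *\<^sub>C 1) g * F) n
      = fps_nth (F * map_series (\<lambda>c. c *\<^sub>C 1) g) n" .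
qed

text \<open>\<open>R_matrix\<close> at \<open>u - v = -c\<close>.\<close>

definition R_at :: "complex \<Rightarrow> 'a::complex_algebra fps matrix2" where
  "R_at c i j k l = fps_const ((- c * (kappa - c)) *\<^sub>C 1) * id_matrix2 i j k l
     + fps_const ((kappa - c) *\<^sub>C 1) * P_matrix i j k l + fps_const (c *\<^sub>C 1) * P_matrix_t1 i j k l"

text \<open>This is the RTT relation at \<open>v = u + c\<close>.\<close>

theorem rtt_relation_shifted:
  "matrix2_mult (matrix2_mult (R_at c) (in_first L_series)) (in_second (\<lambda>i j. shift_series c
      (L_series i j))) i j k l
    = matrix2_mult (matrix2_mult (in_second (\<lambda>i j. shift_series c (L_series i j))) (in_first
        L_series)) (R_at c) i j k l"
    (is "?A = ?B")
proof -
  let ?h = "shifted_inverse c"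
  define \<psi> where "\<psi> = (subst_two fps_X ?h :: U_R fps fps \<Rightarrow> U_R fps)"
  define Y :: "U_R fps" where "Y = map_series (\<lambda>c. c *\<^sub>C 1) ?h"
  define p :: "U_R fps" where "p = fps_X * Y"
  have \<psi>: "ring_map \<psi>" unfolding \<psi>_def by (rule ring_map_subst_two)
      (simp_all add: shifted_inverse_nth_0)
  note lr = ring_map_simps[OF \<psi>]
  have u: "\<psi> (fps_const F) = F" for F
    by (simp add: \<psi>_def subst_two_const subst_series_X_self)
  have v: "\<psi> (map_series fps_const F) = shift_series c F" for F
    by (simp add: \<psi>_def subst_two_outer shift_series_eq_subst)
  have "map_series fps_const (fps_X :: U_R fps) = y_var"
    by (auto intro!: fps_ext simp: fps_X_nth)
  hence y: "\<psi> y_var = Y"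
    using v[of fps_X] by (simp add: shift_series_eq_subst subst_series_X shifted_inverse_nth_0
        Y_def)
  have cen: "Y * F = F * Y" for F by (simp add: Y_def scalar_series_central)
  have cenX: "fps_X * F = F * fps_X" for F :: "U_R fps" by (rule fps_mult_fps_X_commute)
  have p: "p * F = F * p" for F unfolding p_def by (metis cen cenX mult.assoc)
  have Y: "Y * (1 + fps_const (c *\<^sub>C 1) * fps_X) = fps_X"
  proof -
    have m: "ring_map (map_series (\<lambda>c. c *\<^sub>C (1::U_R)))"
      by (rule ring_map_map_series)
        (simp add: ring_map_def scaleC_add_left scaleC_one mult_scaleC_left scaleC_scaleC
            mult_scaleC_right mult.commute)
    have *: "map_series (\<lambda>c. c *\<^sub>C (1::U_R)) fps_X = fps_X"
      "map_series (\<lambda>c. c *\<^sub>C (1::U_R)) (fps_const c) = fps_const (c *\<^sub>C 1)"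
      by (auto intro!: fps_ext simp: fps_X_nth scaleC_one)
    show ?thesis
      using arg_cong[OF shifted_inverse_mult[of c], of "map_series (\<lambda>c. c *\<^sub>C (1::U_R))"]
      unfolding ring_map_simps[OF m] * Y_def .
  qed
  \<comment> \<open>This is (u + c)^-1 - u^-1 = -c u^-1 (u + c)^-1. Hence every factor y - x yields
    one p, and \<open>p * p\<close> splits off from \<open>R_poly\<close>, leaving
    \<open>R_at c\<close>.\<close>
  have d: "Y - fps_X = p * fps_const ((- c) *\<^sub>C 1)"
  proof -
    have "Y * (fps_const (c *\<^sub>C 1) * fps_X) = p * fps_const (c *\<^sub>C 1)"
      unfolding p_def by (metis cen cenX mult.assoc)
    hence "Y + p * fps_const (c *\<^sub>C 1) = fps_X" using Y by (simp add: distrib_left)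
    hence "Y - fps_X = - (p * fps_const (c *\<^sub>C 1))" by (simp add: algebra_simps)
    thus ?thesis by (simp add: scaleC_minus_left flip: fps_const_neg)
  qed
  have const_mult: "fps_const (a *\<^sub>C 1) * fps_const (b *\<^sub>C 1) = fps_const ((a * b) *\<^sub>C (1::U_R))"
    "fps_const (a *\<^sub>C 1) + fps_const (b *\<^sub>C 1) = fps_const ((a + b) *\<^sub>C (1::U_R))" for a b
    by (simp_all add: mult_scaleC_left scaleC_scaleC scaleC_add_left)
  have pp: "p * a * (p * b) = p * p * (a * b)" for a b by (metis p mult.assoc)
  have R: "\<psi> (R_poly i j k l) = p * p * R_at c i j k l" for i j k l
  proof -
    have 1: "p * fps_const ((- c) *\<^sub>C 1) + p * fps_const (kappa *\<^sub>C 1) = p * fps_const ((kappa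
        - c) *\<^sub>C (1::U_R))"
      by (simp only: distrib_left[symmetric] const_mult) simp
    have 2: "p * fps_const ((- c) *\<^sub>C 1) * (p * fps_const ((kappa - c) *\<^sub>C 1))
        = p * p * fps_const ((- c * (kappa - c)) *\<^sub>C (1::U_R))"
      by (simp only: pp const_mult)
    have 3: "p * (p * fps_const ((- c) *\<^sub>C 1)) = - (p * p * fps_const (c *\<^sub>C (1::U_R)))"
      by (simp add: scaleC_minus_left mult.assoc flip: fps_const_neg)
    show ?thesis
      unfolding R_poly_def Let_def lr u y ring_map_id_matrix2[OF \<psi>] ring_map_P_matrix[OF \<psi>]
        ring_map_P_matrix_t1[OF \<psi>] p_def[symmetric] d 1 2 3 R_at_def
      by (simp only: distrib_left mult.assoc) (simp add: algebra_simps)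
  qed
  have ppc: "p * p * F = F * (p * p)" for F by (metis p mult.assoc)
  have L1: "\<psi> (L_first i j k l) = in_first L_series i j k l" for i j k l
    by (simp add: L_first_def ring_map_in_first[OF \<psi>] u)
  have L2: "\<psi> (L_second i j k l) = in_second (\<lambda>i j. shift_series c (L_series i j)) i j k l"
      for i j k l
    by (simp add: L_second_def ring_map_in_second[OF \<psi>] v)
  have "p * p * ?A = p * p * ?B"
    using arg_cong[OF rtt_relation[of i j k l], of \<psi>]
    unfolding ring_map_matrix2_mult[OF \<psi>] R L1 L2
    by (simp only: matrix2_mult_central[OF ppc])
  hence "p * (p * (?A - ?B)) = 0" by (simp add: algebra_simps)
  \<comment> \<open>p is not a zero divisor: (1 + c x) p = x^2, and multiplication by x only shifts
    coefficients.\<close>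
  moreover have "F = 0" if "p * F = 0" for F
  proof -
    have "fps_X * (fps_X * F) = (1 + fps_const (c *\<^sub>C 1) * fps_X) * (p * F)"
      unfolding p_def using Y cen cenX by (metis mult.assoc)
    hence "fps_nth (fps_X * (fps_X * F)) (Suc (Suc n)) = 0" for n by (simp add: that)
    thus "F = 0" by (intro fps_ext) simp
  qed
  ultimately have "?A - ?B = 0" by metis
  thus ?thesis by simp
qed

section \<open>The RTT relation in the limit of large v\<close>

definition L_mode :: "3 \<Rightarrow> 3 \<Rightarrow> U_R fps" where
  "L_mode i j = fps_const (gen (gen_L i j 0))"

lemma fps_nth_minus_one_power: "fps_nth ((- 1) ^ n :: 'a::ring_1 fps) m = (if m
    = 0 then (- 1) ^ n else 0)"
  by (cases "even n") simp_all

lemma matrix2_mult_nth_1: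
  "fps_nth (matrix2_mult M N i j k l) 1
    = matrix2_mult (\<lambda>i j k l. fps_nth (M i j k l) 0) (\<lambda>i j k l. fps_nth (N i j k l) 1) i j k l
      + matrix2_mult (\<lambda>i j k l. fps_nth (M i j k l) 1) (\<lambda>i j k l. fps_nth (N i j k l) 0) i j k l"
  by (simp add: matrix2_mult_def fps_sum_nth fps_nth_minus_one_power mult.assoc fps_mult_nth_1
      distrib_left
      sum.distrib)

lemma matrix2_mult_nth_0:
  "fps_nth (matrix2_mult M N i j k l) 0
    = matrix2_mult (\<lambda>i j k l. fps_nth (M i j k l) 0) (\<lambda>i j k l. fps_nth (N i j k l) 0) i j k l"
  by (simp add: matrix2_mult_def fps_sum_nth fps_nth_minus_one_power mult.assoc)

lemma matrix2_mult_add: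
  "matrix2_mult (\<lambda>i j k l. M i j k l + M' i j k l) N i j k l = matrix2_mult M N i j k l
      + matrix2_mult M' N i j k l"
  "matrix2_mult M (\<lambda>i j k l. N i j k l + N' i j k l) i j k l = matrix2_mult M N i j k l
      + matrix2_mult M N' i j k l"
  by (simp_all add: matrix2_mult_def distrib_left distrib_right sum.distrib)

text \<open>This is the coefficient of \<open>v\<^sup>-\<^sup>1\<close> in the RTT relation.\<close>

theorem rtt_relation_mode:
  defines "W \<equiv> (\<lambda>i j k l. P_matrix_t1 i j k l - P_matrix i j k l :: U_R fps)"
  shows "matrix2_mult (in_first L_series) (in_second L_mode) i j k l
      + matrix2_mult W (in_first L_series) i j k l
    = matrix2_mult (in_second L_mode) (in_first L_series) i j k l
        + matrix2_mult (in_first L_series) W i j k l"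
proof -
  let ?L1 = "in_first L_series" and ?l2 = "in_second L_mode"
  let ?X = "fps_X :: U_R fps"
  \<comment> \<open>The coefficient of y in (y - x)(y - x + x y kappa). It multiplies the identity
    matrix and is central, so its contributions to the two sides cancel.\<close>
  define z :: "U_R fps" where "z = - (?X * (1 + ?X * fps_const (kappa *\<^sub>C 1)) + ?X)"
  have cenX: "?X * F = F * ?X" for F by (rule fps_mult_fps_X_commute)
  have cenXX: "?X * ?X * F = F * (?X * ?X)" for F by (metis cenX mult.assoc)
  have cenk: "fps_const (kappa *\<^sub>C 1) * F = F * fps_const (kappa *\<^sub>C 1)" for F :: "U_R fps"
    by (rule fps_ext) (simp add: scalar_central)
  have "?X * ?X * fps_const (kappa *\<^sub>C 1) * F = F * (?X * ?X * fps_const (kappa *\<^sub>C 1))" for F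
    by (metis cenk cenXX mult.assoc)
  hence cenz: "z * F = F * z" for F
    using cenX[of F] by (simp add: z_def algebra_simps)
  \<comment> \<open>The entries of these matrices are 0, 1 or -1, so the ring map
    \<open>fps_const\<close> carries each matrix to its namesake over double series; hence they
    involve only y^0.\<close>
  have const: "fps_const F = (F' :: U_R fps fps) \<Longrightarrow> fps_nth F' 0 = F \<and> fps_nth F' (Suc 0) = 0"
      for F F'
    by (metis fps_nth_fps_const nat.distinct(1))
  have c: "ring_map (fps_const :: U_R fps \<Rightarrow> _)" by (simp add: ring_map_def)
  note const = const[OF ring_map_P_matrix[OF c]] const[OF ring_map_P_matrix_t1[OF c]]
    const[OF ring_map_id_matrix2[OF c]]
  have R0: "fps_nth (R_poly i j k l) 0 = ?X * ?X * id_matrix2 i j k l" for i j k l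
    by (simp add: R_poly_def Let_def const)
  have R1: "fps_nth (R_poly i j k l) 1 = z * id_matrix2 i j k l + ?X * ?X * W i j k l" for i j k l
    by (simp add: R_poly_def Let_def const fps_mult_nth_1 z_def W_def algebra_simps)
  have L1: "fps_nth (L_first i j k l) 0 = ?L1 i j k l" "fps_nth (L_first i j k l) 1 = 0" for i j k l
    by (simp_all add: L_first_def in_first_def)
  have L2: "fps_nth (L_second i j k l) 0 = id_matrix2 i j k l" "fps_nth (L_second i j k l) 1
      = ?l2 i j k l"
    for i j k l
    by (auto simp: L_second_def in_second_def id_matrix2_def L_series_def series_of_def L_mode_def)
  have zero: "matrix2_mult M (\<lambda>i j k l. 0) i j k l = 0" for M :: "U_R fps matrix2" and i j k l
    by (simp add: matrix2_mult_def)
  have "?X * ?X * (matrix2_mult ?L1 ?l2 i j k l + matrix2_mult W ?L1 i j k l)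
    = ?X * ?X * (matrix2_mult ?l2 ?L1 i j k l + matrix2_mult ?L1 W i j k l)"
    using arg_cong[OF rtt_relation[of i j k l], of "\<lambda>F. fps_nth F 1"]
    unfolding matrix2_mult_nth_1 matrix2_mult_nth_0 R0 R1 L1 L2 zero
      matrix2_mult_add matrix2_mult_central[OF cenz] matrix2_mult_central[OF cenXX] matrix2_mult_id
    by (simp add: matrix2_mult_id distrib_left)
  hence "fps_nth (?X * (?X * (matrix2_mult ?L1 ?l2 i j k l + matrix2_mult W ?L1 i j k l))) n
    = fps_nth (?X * (?X * (matrix2_mult ?l2 ?L1 i j k l + matrix2_mult ?L1 W i j k l))) n" for n
    by (simp only: mult.assoc)
  from this[of "Suc (Suc _)"] show ?thesis by (intro fps_ext) simp
qed

section \<open>Exchange rules between L(u) and L(u + 1)\<close>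

lemmas matrix2_component_simps =
  matrix2_mult_def sum_3 in_first_def in_second_def R_at_def P_matrix_t1_def P_matrix_def
      id_matrix2_def
  supertranspose_def J_matrix_def grade_def

lemma scalar_series_cancel:
  assumes "a \<noteq> 0" "fps_const (a *\<^sub>C 1) * F = fps_const (a *\<^sub>C 1) * (G :: 'a::complex_algebra fps)"
  shows "F = G"
proof -
  have "fps_const (inverse a *\<^sub>C 1) * (fps_const (a *\<^sub>C 1) * H) = H" for H :: "'a fps"
    using assms(1) by (simp add: mult_scaleC_left mult_scaleC_right scaleC_scaleC scaleC_one flip:
        mult.assoc)
  thus ?thesis using assms(2) by metis
qed

abbreviation L_shift :: "3 \<Rightarrow> 3 \<Rightarrow> U_R fps" where "L_shift i j \<equiv> shift_series 1 (L_series i j)"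

lemma scalar_series_right:
  fixes F G :: "'a::complex_algebra fps"
  shows "F * fps_const (a *\<^sub>C 1) = fps_const (a *\<^sub>C 1) * F"
    and "F * (G * fps_const (a *\<^sub>C 1)) = fps_const (a *\<^sub>C 1) * (F * G)"
    and "F * (fps_const (a *\<^sub>C 1) * G) = fps_const (a *\<^sub>C 1) * (F * G)"
proof -
  have *: "F * fps_const (a *\<^sub>C 1) = fps_const (a *\<^sub>C 1) * F" for F :: "'a fps"
    by (rule fps_ext) (simp add: scalar_central)
  show "F * fps_const (a *\<^sub>C 1) = fps_const (a *\<^sub>C 1) * F"
    "F * (G * fps_const (a *\<^sub>C 1)) = fps_const (a *\<^sub>C 1) * (F * G)"
    "F * (fps_const (a *\<^sub>C 1) * G) = fps_const (a *\<^sub>C 1) * (F * G)"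
    using *[of F] *[of "F * G"] by (simp_all flip: mult.assoc)
qed

lemma kappa_scalars:
  "kappa - 1 \<noteq> 0" "fps_const ((1 - kappa) *\<^sub>C 1 :: U_R) = - fps_const ((kappa - 1) *\<^sub>C 1)"
  by (simp_all add: kappa_def flip: scaleC_minus_left)

lemma fps_const_uminus: "fps_const (- a) = - fps_const (a :: 'a::ring_1)"
  by simp

text \<open>The matrix \<open>P_matrix_t1\<close> lives on the pairs (1,3), (2,2), (3,1) and does
  not contribute. What is left of R is (kappa - 1)(P - I), which annihilates (3,3): one side of the
  component vanishes and the other has two terms.\<close>

lemma L33_L23_shift: "L_series 3 3 * L_shift 2 3 = L_series 2 3 * L_shift 3 3"
  by (rule scalar_series_cancel[OF kappa_scalars(1)])
     (use rtt_relation_shifted[of 1 3 3 2 3] in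
       \<open>simp add: matrix2_component_simps scalar_series_right kappa_scalars(2) fps_const_uminus
           algebra_simps
         del: fps_const_neg\<close>)

lemma L33_L32_shift: "L_shift 3 3 * L_series 3 2 = L_shift 3 2 * L_series 3 3"
  by (rule scalar_series_cancel[OF kappa_scalars(1)])
     (use rtt_relation_shifted[of 1 3 3 3 2] in
       \<open>simp add: matrix2_component_simps scalar_series_right kappa_scalars(2) fps_const_uminus
           algebra_simps
         del: fps_const_neg\<close>)

text \<open>P - I does not annihilate (3,2) or (2,3), so all four terms survive. This relation links
  the two formulas for h.\<close>

lemma L32_L23_shift: "L_series 3 2 * L_shift 2 3 + L_shift 2 3 * L_series 3 2
   = L_shift 2 2 * L_series 3 3 - L_series 2 2 * L_shift 3 3"
  by (rule scalar_series_cancel[OF kappa_scalars(1)])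
     (use rtt_relation_shifted[of 1 3 2 2 3] in
       \<open>simp add: matrix2_component_simps scalar_series_right kappa_scalars(2) fps_const_uminus
           algebra_simps
         del: fps_const_neg\<close>)

text \<open>At v = u + 1 this component is vacuous, because the contributions of I and P cancel on
  (3,3). At v = u - 1 they add up to 2 (kappa + 1), and shifting u by 1 gives the claim.\<close>

lemma L33_L33_shift: "L_series 3 3 * L_shift 3 3 = L_shift 3 3 * L_series 3 3"
proof -
  let ?V = "shift_series (- 1) (L_series 3 3)"
  have "kappa + 1 \<noteq> 0" by (simp add: kappa_def)
  hence "2 * (kappa + 1) \<noteq> 0" by (simp only: mult_eq_0_iff) simp
  hence "L_series 3 3 * ?V = ?V * L_series 3 3"
  proof (rule scalar_series_cancel)
    have "fps_const ((2 * (kappa + 1)) *\<^sub>C 1 :: U_R) = fps_const ((kappa + 1) *\<^sub>C 1)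
        + fps_const ((kappa + 1) *\<^sub>C 1)"
      by (simp flip: scaleC_add_left)
    note * = this
    show "fps_const ((2 * (kappa + 1)) *\<^sub>C 1) * (L_series 3 3 * ?V) = fps_const ((2 * (kappa
        + 1)) *\<^sub>C 1) * (?V * L_series 3 3)"
      unfolding * using rtt_relation_shifted[of "-1" 3 3 3 3]
      by (simp add: matrix2_component_simps scalar_series_right distrib_right distrib_left
          mult.assoc
          del: fps_const_add)
  qed
  hence "shift_series 1 (L_series 3 3 * ?V) = shift_series 1 (?V * L_series 3 3)" by simp
  moreover have "shift_series 1 ?V = L_series 3 3"
    by (simp add: shift_series_shift_series shift_series_0)
  ultimately show ?thesis
    by (simp add: shift_series_eq_subst subst_series_mult shifted_inverse_nth_0)
qed

section \<open>Commutators of L(u) with the first modes\<close>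

lemma L23_mode23: "L_series 2 3 * L_mode 2 3 + L_mode 2 3 * L_series 2 3 = L_series 1 3"
  using rtt_relation_mode[of 2 3 2 3]
  by (simp add: matrix2_component_simps algebra_simps)
lemma L33_mode23: "L_series 3 3 * L_mode 2 3 - L_mode 2 3 * L_series 3 3 = L_series 2 3"
  using rtt_relation_mode[of 3 3 2 3]
  by (simp add: matrix2_component_simps algebra_simps)
lemma L32_mode32: "L_series 3 2 * L_mode 3 2 + L_mode 3 2 * L_series 3 2 = - L_series 3 1"
  using rtt_relation_mode[of 3 2 3 2]
  by (simp add: matrix2_component_simps algebra_simps)
lemma L33_mode32: "L_series 3 3 * L_mode 3 2 - L_mode 3 2 * L_series 3 3 = - L_series 3 2"
  using rtt_relation_mode[of 3 3 3 2]
  by (simp add: matrix2_component_simps algebra_simps)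
lemma L22_mode32: "L_series 2 2 * L_mode 3 2 - L_mode 3 2 * L_series 2 2 = - L_series 3 2
    - L_series 2 1"
  using rtt_relation_mode[of 2 2 3 2]
  by (simp add: matrix2_component_simps algebra_simps)
lemma L23_mode32: "L_series 2 3 * L_mode 3 2 + L_mode 3 2 * L_series 2 3 = L_series 3 3
    - L_series 2 2"
  using rtt_relation_mode[of 2 3 3 2]
  by (simp add: matrix2_component_simps algebra_simps)
lemma L22_mode23: "L_series 2 2 * L_mode 2 3 - L_mode 2 3 * L_series 2 2 = L_series 2 3
    - L_series 1 2"
  using rtt_relation_mode[of 2 2 2 3]
  by (simp add: matrix2_component_simps algebra_simps)
lemma L32_mode23: "L_series 3 2 * L_mode 2 3 + L_mode 2 3 * L_series 3 2 = L_series 3 3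
    - L_series 2 2"
  using rtt_relation_mode[of 3 2 2 3]
  by (simp add: matrix2_component_simps algebra_simps)

section \<open>Gauss coordinates\<close>

definition K_series :: "U_R fps" where "K_series = inverse_series (L_series 3 3)"

abbreviation K_shift :: "U_R fps" where "K_shift \<equiv> shift_series 1 K_series"

lemma L33_nth_0: "fps_nth (L_series 3 3) 0 = 1"
  by (simp add: L_series_def series_of_def)

lemma K_series_inverse: "L_series 3 3 * K_series = 1" "K_series * L_series 3 3 = 1"
  by (simp_all add: K_series_def inverse_series_right inverse_series_left L33_nth_0)

lemma K_shift_inverse: "L_shift 3 3 * K_shift = 1" "K_shift * L_shift 3 3 = 1"
  using arg_cong[OF K_series_inverse(1), of "shift_series 1"]
    arg_cong[OF K_series_inverse(2), of "shift_series 1"]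
  by (simp_all add: shift_series_eq_subst subst_series_mult shifted_inverse_nth_0 subst_series_one)

lemma inverse_cancel:
  fixes l k :: "'a::monoid_mult"
  assumes "l * k = 1" "k * l = 1"
  shows "l * (k * a) = a" "k * (l * a) = a" "a * l * k = a" "a * k * l = a"
  using assms by (metis mult.assoc mult_1_left mult_1_right)+

lemmas K_cancel = inverse_cancel[OF K_series_inverse] K_series_inverse
lemmas K_shift_cancel = inverse_cancel[OF K_shift_inverse] K_shift_inverse

text \<open>\<open>e_U\<close>, \<open>f_U\<close> and \<open>h_U\<close> are the images of \<open>e(-u)\<close>, \<open>f(-u)\<close> and \<open>h(-u)\<close>; the images of \<open>e\<^sub>0\<close>
  and \<open>f\<^sub>0\<close> are \<open>- L_mode 2 3\<close> and \<open>- L_mode 3 2\<close>.\<close>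

definition e_U :: "U_R fps" where "e_U = K_series * L_series 2 3"
definition f_U :: "U_R fps" where "f_U = L_series 3 2 * K_series"
definition h_U :: "U_R fps" where
  "h_U = L_series 2 2 * K_series + L_series 3 2 * K_series * L_series 2 3 * K_series"

lemma e_U_shift: "e_U = L_shift 2 3 * K_shift"
proof -
  have "K_series * (L_series 2 3 * L_shift 3 3) * K_shift
      = K_series * (L_series 3 3 * L_shift 2 3) * K_shift"
    by (simp add: L33_L23_shift)
  thus ?thesis unfolding e_U_def by (simp add: mult.assoc K_cancel K_shift_cancel)
qed

lemma f_U_shift: "f_U = K_shift * L_shift 3 2"
proof -
  have "K_shift * (L_shift 3 3 * L_series 3 2) * K_series
      = K_shift * (L_shift 3 2 * L_series 3 3) * K_series"
    by (simp add: L33_L32_shift)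
  thus ?thesis unfolding f_U_def by (simp add: mult.assoc K_cancel K_shift_cancel)
qed

lemma K_K_shift: "K_series * K_shift = K_shift * K_series"
proof -
  have "K_series * K_shift * (L_series 3 3 * L_shift 3 3 * (K_shift * K_series))
      = K_series * K_shift * (L_shift 3 3 * L_series 3 3 * (K_shift * K_series))"
    by (simp add: L33_L33_shift)
  thus ?thesis by (simp add: mult.assoc K_cancel K_shift_cancel)
qed

text \<open>Multiplying by L^33(u) and L^33(u + 1), which commute, clears the inverses and leaves
  the exchange rule \<open>L32_L23_shift\<close>.\<close>

lemma h_U_shift: "h_U = L_shift 2 2 * K_shift - L_shift 2 3 * K_shift * L_shift 3 2 * K_shift"
proof -
  have "h_U * L_series 3 3 * L_shift 3 3 = (L_shift 2 2 * K_shift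
      - L_shift 2 3 * K_shift * L_shift 3 2 * K_shift) * L_shift 3 3 * L_series 3 3"
  proof -
    have "h_U * L_series 3 3 * L_shift 3 3 = L_series 2 2 * L_shift 3 3
        + L_series 3 2 * e_U * L_shift 3 3"
      by (simp add: h_U_def e_U_def distrib_right mult.assoc K_cancel)
    also have "\<dots> = L_series 2 2 * L_shift 3 3 + L_series 3 2 * L_shift 2 3"
      by (simp add: e_U_shift mult.assoc K_shift_cancel)
    also have "\<dots> = L_shift 2 2 * L_series 3 3 - L_shift 2 3 * L_series 3 2"
      using L32_L23_shift by (simp add: algebra_simps)
    also have "\<dots> = L_shift 2 2 * L_series 3 3 - L_shift 2 3 * f_U * L_series 3 3"
      by (simp add: f_U_def mult.assoc K_cancel)
    also have "\<dots> = (L_shift 2 2 * K_shift - L_shift 2 3 * K_shift * L_shift 3 2 * K_shift) * L_shift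
        3 3 * L_series 3 3"
      by (simp add: f_U_shift left_diff_distrib mult.assoc K_shift_cancel)
    finally show ?thesis .
  qed
  hence "h_U * L_series 3 3 * L_shift 3 3 * (K_shift * K_series)
    = (L_shift 2 2 * K_shift - L_shift 2 3 * K_shift * L_shift 3 2 * K_shift) * L_shift 3 3 *
        L_series 3 3 * (K_series * K_shift)"
    by (simp only: K_K_shift)
  thus ?thesis by (simp add: mult.assoc K_cancel K_shift_cancel)
qed

lemma L_mode_const: "shift_series c (L_mode i j) = L_mode i j"
  by (simp add: L_mode_def shift_series_eq_subst subst_series_const)

text \<open>In the following lemmas \<open>l\<close>, \<open>a\<close>, \<open>b\<close>, \<open>g\<close> stand for \<open>L\<^sup>3\<^sup>3\<close>, \<open>L\<^sup>2\<^sup>3\<close>, \<open>L\<^sup>3\<^sup>2\<close>, \<open>L\<^sup>2\<^sup>2\<close> and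
  \<open>m\<close> for the first coefficient of \<open>L\<^sup>2\<^sup>3\<close> or \<open>L\<^sup>3\<^sup>2\<close>; the simplifier moves \<open>m\<close> to the left.\<close>

lemma inverse_commutes_past:
  fixes l k m :: "'a::ring_1"
  assumes "l * k = 1" "k * l = 1" "l * m - m * l = a"
  shows "k * m = m * k - k * a * k" "k * (m * x) = m * (k * x) - k * (a * (k * x))"
proof -
  \<comment> \<open>The commutator with m is a derivation, so [k, m] = -k [l, m] k for the inverse k
    of l.\<close>
  have "k * a * k = k * (l * m - m * l) * k" by (simp add: assms(3))
  also have "\<dots> = m * k - k * m"
    by (simp add: right_diff_distrib left_diff_distrib mult.assoc
        inverse_cancel[OF assms(1,2)] assms(1,2))
  finally show *: "k * m = m * k - k * a * k" by (simp add: algebra_simps)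
  have "k * (m * x) = (k * m) * x" by (simp add: mult.assoc)
  thus "k * (m * x) = m * (k * x) - k * (a * (k * x))"
    unfolding * by (simp add: left_diff_distrib mult.assoc)
qed

lemma moves_past:
  fixes a m :: "'a::ring_1"
  shows "a * m - m * a = c \<Longrightarrow> a * m = m * a + c \<and> a * (m * x) = m * (a * x) + c * x"
    and "a * m + m * a = c \<Longrightarrow> a * m = c - m * a \<and> a * (m * x) = c * x - m * (a * x)"
  by (metis add.commute diff_add_cancel mult.assoc distrib_right)
     (metis add_diff_cancel_right' mult.assoc left_diff_distrib)

text \<open>As m is carried to the left, passing k produces -(a k)^2 and passing a produces c k. The
  squares in the coproduct formulas are thus the cost of commuting with the inverse.\<close>

lemma gauss_13:
  fixes l k a m c :: "'a::ring_1"
  assumes "l * k = 1" "k * l = 1" "l * m - m * l = a" "a * m + m * a = c"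
  shows "c * k = (a * k)\<^sup>2 - anticommutator (a * k) (- m)"
  by (simp add: anticommutator_def power2_eq_square mult.assoc inverse_commutes_past[OF assms(1-3)]
      moves_past(2)[OF assms(4)] algebra_simps)

lemma gauss_31:
  fixes l k b m d :: "'a::ring_1"
  assumes "l * k = 1" "k * l = 1" "l * m - m * l = - b" "b * m + m * b = - d"
  shows "d * k = (b * k)\<^sup>2 + anticommutator (b * k) (- m)"
  by (simp add: anticommutator_def power2_eq_square mult.assoc inverse_commutes_past[OF assms(1-3)]
      moves_past(2)[OF assms(4)] algebra_simps)

lemma gauss_22:
  fixes l k a b g m :: "'a::ring_1"
  assumes "l * k = 1" "k * l = 1" "l * m - m * l = - b" "a * m + m * a = l - g"
  shows "anticommutator (a * k) (- m) = g * k - a * k * b * k - 1"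
  by (simp add: anticommutator_def mult.assoc inverse_commutes_past[OF assms(1-3)]
      moves_past(2)[OF assms(4)] assms(1) algebra_simps)

text \<open>When m passes both terms of g k - a k b k, the contributions b k, g k b k and a k b k b
  k cancel, and only the new entries c and d remain. This is the coefficient left in the coproduct
  of e once e \<otimes> 1 has been split off.\<close>

lemma gauss_21:
  fixes l k a b c d g m :: "'a::ring_1"
  assumes "l * k = 1" "k * l = 1" "l * m - m * l = - b" "a * m + m * a = l - g"
    "b * m + m * b = - d" "g * m - m * g = - b - c"
  shows "c * k - a * k * d * k = commutator (g * k - a * k * b * k) (- m)"
  by (simp add: commutator_def mult.assoc inverse_commutes_past[OF assms(1-3)]
      moves_past(2)[OF assms(4)] moves_past(2)[OF assms(5)] moves_past(1)[OF assms(6)]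
      inverse_cancel[OF assms(1,2)] assms(1) algebra_simps)

lemma gauss_12:
  fixes l k a b c d g m :: "'a::ring_1"
  assumes "l * k = 1" "k * l = 1" "l * m - m * l = a" "b * m + m * b = l - g"
    "a * m + m * a = c" "g * m - m * g = a - d"
  shows "d * k - b * k * c * k = commutator (g * k + b * k * a * k) (- m)"
  by (simp add: commutator_def mult.assoc inverse_commutes_past[OF assms(1-3)]
      moves_past(2)[OF assms(4)] moves_past(2)[OF assms(5)] moves_past(1)[OF assms(6)]
      inverse_cancel[OF assms(1,2)] assms(1) algebra_simps)

lemma ring_map_shift_series: "ring_map (shift_series c :: 'a::complex_algebra fps \<Rightarrow> _)"
  by (simp add: ring_map_def shift_series_eq_subst subst_series_add subst_series_mult
      subst_series_one
      shifted_inverse_nth_0)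

lemmas shift_hom = ring_map_simps[OF ring_map_shift_series]

text \<open>The modes are constant in u, so each relation holds unchanged at u + 1, where e has its
  inverse on the right.\<close>

lemmas mode_shift =
  L33_mode23[THEN arg_cong[of _ _ "shift_series 1"], unfolded shift_hom L_mode_const]
  L23_mode23[THEN arg_cong[of _ _ "shift_series 1"], unfolded shift_hom L_mode_const]
  L33_mode32[THEN arg_cong[of _ _ "shift_series 1"], unfolded shift_hom L_mode_const]
  L23_mode32[THEN arg_cong[of _ _ "shift_series 1"], unfolded shift_hom L_mode_const]
  L32_mode32[THEN arg_cong[of _ _ "shift_series 1"], unfolded shift_hom L_mode_const]
  L22_mode32[THEN arg_cong[of _ _ "shift_series 1"], unfolded shift_hom L_mode_const]

lemma L_shift_13: "L_shift 1 3 * K_shift = e_U\<^sup>2 - anticommutator e_U (- L_mode 2 3)"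
  unfolding e_U_shift
  by (rule gauss_13[OF K_shift_inverse mode_shift(1,2)])

lemma L_31: "L_series 3 1 * K_series = f_U\<^sup>2 + anticommutator f_U (- L_mode 3 2)"
  unfolding f_U_def by (rule gauss_31[OF K_series_inverse L33_mode32 L32_mode32])

text \<open>Read back through the isomorphism this is h = 1 + {e, f_0}. Both e and h enter through
  their expressions at u + 1.\<close>

lemma anticommutator_e_U: "anticommutator e_U (- L_mode 3 2) = h_U - 1"
  unfolding e_U_shift h_U_shift
  by (rule gauss_22[OF K_shift_inverse mode_shift(3,4)])

lemma L_shift_21: "L_shift 2 1 * K_shift - e_U * (L_shift 3 1 * K_shift)
    = commutator h_U (- L_mode 3 2)"
  unfolding e_U_shift h_U_shift mult.assoc[symmetric]
  by (rule gauss_21[OF K_shift_inverse mode_shift(3-6)])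

lemma L_12: "L_series 1 2 * K_series - f_U * (L_series 1 3 * K_series)
    = commutator h_U (- L_mode 2 3)"
  unfolding f_U_def h_U_def mult.assoc[symmetric]
  by (rule gauss_12[OF K_series_inverse L33_mode23 L32_mode23 L23_mode23 L22_mode23])

section \<open>Superalgebra homomorphisms and tensor products\<close>

lemma superalgebra_hom_linear: "superalgebra_hom f \<Longrightarrow> complex_linear f"
  by (simp add: superalgebra_hom_def)

lemma superalgebra_hom_ring_map: "superalgebra_hom f \<Longrightarrow> ring_map f"
  by (simp add: superalgebra_hom_def complex_linear_def ring_map_def)

lemma superalgebra_hom_homog: "superalgebra_hom f \<Longrightarrow> x \<in> homog p \<Longrightarrow> f x \<in> homog p"
  by (simp add: superalgebra_hom_def image_subset_iff)

lemma superalgebra_homI: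
  assumes "complex_linear f" "f 1 = 1" "\<And>x y. f (x * y) = f x * f y"
    "\<And>p x. x \<in> homog p \<Longrightarrow> f x \<in> homog p"
  shows "superalgebra_hom f"
  using assms by (auto simp: superalgebra_hom_def)

lemma superalgebra_hom_id: "superalgebra_hom id"
  by (simp add: superalgebra_hom_def complex_linear_def)

lemma superalgebra_hom_comp: "superalgebra_hom f \<Longrightarrow> superalgebra_hom g \<Longrightarrow> superalgebra_hom (g \<circ> f)"
  by (fastforce simp: superalgebra_hom_def complex_linear_def)

lemma superalgebra_iso_inv:
  fixes f :: "'a::superalgebra \<Rightarrow> 'b::superalgebra"
  assumes "superalgebra_iso f"
  shows "superalgebra_hom (inv f)"
proof -
  have f: "superalgebra_hom f" and bij: "bij f" using assms by (auto simp: superalgebra_iso_def)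
  note lin = complex_linear_simps[OF superalgebra_hom_linear[OF f]]
  note ring = ring_map_simps[OF superalgebra_hom_ring_map[OF f]]
  have inj: "inj f" using bij by (rule bij_is_inj)
  have f_inv: "f (inv f y) = y" for y using bij by (simp add: bij_is_surj surj_f_inv_f)
  have eqI: "inv f y = x" if "f x = y" for x y using inj that by (auto simp: inv_f_f)
  show ?thesis
  proof (rule superalgebra_homI)
    show "complex_linear (inv f)"
      by (auto simp: complex_linear_def lin f_inv intro!: eqI)
    show "inv f 1 = 1" by (rule eqI) (simp add: ring)
    show "inv f (x * y) = inv f x * inv f y" for x y by (rule eqI) (simp add: ring f_inv)
  next
    fix p and y :: 'b assume y: "y \<in> homog p"
    define x where "x = inv f y"
    \<comment> \<open>The component of x of the wrong parity is sent into both homogeneous parts,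
      hence to 0, and injectivity makes it 0.\<close>
    have "f (x - hpart p x) = y - f (hpart p x)" by (simp add: lin x_def f_inv)
    moreover have "y - f (hpart p x) \<in> homog p"
      using y superalgebra_hom_homog[OF f hpart_homog] by (rule homog_diff)
    moreover have "f (x - hpart p x) \<in> homog (\<not> p)"
      by (rule superalgebra_hom_homog[OF f diff_hpart_homog])
    ultimately have "f (x - hpart p x) = 0"
      using homog_indep[of "f (x - hpart p x)"] by (cases p) auto
    hence "x - hpart p x = 0" using inj by (metis injD lin(3))
    thus "inv f y \<in> homog p" using hpart_homog[of p x] by (simp add: x_def)
  qed
qed

text \<open>A sign requires both middle factors to be odd. With one of them even the other may be
  arbitrary, being a sum of homogeneous parts.\<close>

lemma tensor_mult_even_left:
  assumes "\<alpha> \<in> homog False"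
  shows "(a \<otimes> \<alpha>) * (b \<otimes> \<beta>) = (a * b) \<otimes> (\<alpha> * \<beta>)"
proof -
  have "(a \<otimes> \<alpha>) * (hpart p b \<otimes> \<beta>) = (a * hpart p b) \<otimes> (\<alpha> * \<beta>)" for p
    by (simp add: tensor_mult_homog[OF assms hpart_homog] koszul_sign_def scaleC_one)
  hence "(a \<otimes> \<alpha>) * (hpart False b \<otimes> \<beta>) + (a \<otimes> \<alpha>) * (hpart True b \<otimes> \<beta>)
      = (a * hpart False b + a * hpart True b) \<otimes> (\<alpha> * \<beta>)"
    by (simp add: tensor_add_left)
  thus ?thesis by (simp add: hpart_sum flip: distrib_left tensor_add_left)
qed

lemma tensor_mult_even_right:
  assumes "b \<in> homog False"
  shows "(a \<otimes> \<alpha>) * (b \<otimes> \<beta>) = (a * b) \<otimes> (\<alpha> * \<beta>)"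
proof -
  have "(a \<otimes> hpart q \<alpha>) * (b \<otimes> \<beta>) = (a * b) \<otimes> (hpart q \<alpha> * \<beta>)" for q
    by (simp add: tensor_mult_homog[OF hpart_homog assms] koszul_sign_def scaleC_one)
  hence "(a \<otimes> hpart False \<alpha>) * (b \<otimes> \<beta>) + (a \<otimes> hpart True \<alpha>) * (b \<otimes> \<beta>)
      = (a * b) \<otimes> (hpart False \<alpha> * \<beta> + hpart True \<alpha> * \<beta>)"
    by (simp add: tensor_add_right)
  thus ?thesis by (simp add: hpart_sum flip: distrib_right tensor_add_right)
qed

lemma one_tensor_eq: "(1 :: ('a::superalgebra, 'b::superalgebra) tensor) = 1 \<otimes> 1"
  by (rule one_tensor_def)

lemma tensor_map_bilinear:
  assumes "complex_linear f" "complex_linear g"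
  shows "bilinear_map (\<lambda>a b. f a \<otimes> g b)"
  using assms by (simp add: bilinear_map_def complex_linear_def tensor_add_left tensor_add_right
      tensor_scaleC_left tensor_scaleC_right)

lemma tensor_map_pure:
  "complex_linear f \<Longrightarrow> complex_linear g \<Longrightarrow> tensor_map f g (a \<otimes> b) = f a \<otimes> g b"
  by (simp add: tensor_map_def tensor_lift_pure tensor_map_bilinear)

lemma tensor_map_linear:
  "complex_linear f \<Longrightarrow> complex_linear g \<Longrightarrow> complex_linear (tensor_map f g)"
  unfolding tensor_map_def by (intro tensor_lift_linear tensor_map_bilinear)

lemma complex_linear_comp: "complex_linear f \<Longrightarrow> complex_linear g \<Longrightarrow> complex_linear (\<lambda>x. f (g x))"
  by (simp add: complex_linear_def)

lemma linear_tensor_eqI: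
  assumes "complex_linear f" "complex_linear g" "\<And>a b. f (a \<otimes> b) = g (a \<otimes> b)"
  shows "f t = g t"
  using assms(3) by (induction t rule: tensor_induct)
      (simp_all add: complex_linear_simps(1) assms(1,2))

lemma tensor_map_tensor_map:
  assumes "complex_linear f" "complex_linear g" "complex_linear f'" "complex_linear g'"
  shows "tensor_map f g (tensor_map f' g' t) = tensor_map (f \<circ> f') (g \<circ> g') t"
  by (rule linear_tensor_eqI)
     (simp_all add: assms tensor_map_linear tensor_map_pure complex_linear_comp o_def)

lemma tensor_map_id: "tensor_map id id t = t"
proof -
  have id: "complex_linear (id :: 'x::complex_space \<Rightarrow> 'x)" "complex_linear (\<lambda>t :: 'x. t)"
    by (simp_all add: complex_linear_def)
  show ?thesis
    by (rule linear_tensor_eqI[where g = "\<lambda>t. t"])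
        (simp_all add: id tensor_map_linear tensor_map_pure)
qed

text \<open>Homogeneous pure tensors span the tensor product, and on them the graded multiplication
  is explicit.\<close>

lemma superalgebra_hom_tensorI:
  fixes F :: "('a::superalgebra, 'b::superalgebra) tensor \<Rightarrow> 'c::superalgebra"
  assumes lin: "complex_linear F" and one: "F 1 = 1"
    and mult: "\<And>a \<alpha> b \<beta> p q p' q'. a \<in> homog p' \<Longrightarrow> \<alpha> \<in> homog q \<Longrightarrow> b \<in> homog p \<Longrightarrow> \<beta> \<in> homog q' \<Longrightarrow>
      F (a \<otimes> \<alpha>) * F (b \<otimes> \<beta>) = koszul_sign p q *\<^sub>C F ((a * b) \<otimes> (\<alpha> * \<beta>))"
    and homog: "\<And>a b p q. a \<in> homog p \<Longrightarrow> b \<in> homog q \<Longrightarrow> F (a \<otimes> b) \<in> homog (p \<noteq> q)"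
  shows "superalgebra_hom F"
proof (rule superalgebra_homI[OF lin one])
  note simps = complex_linear_simps[OF lin]
  show "F (s * t) = F s * F t" for s t
  proof (induction s rule: tensor_induct_homog)
    case s: (pure a \<alpha> p' q)
    show ?case
    proof (induction t rule: tensor_induct_homog)
      case t: (pure b \<beta> p q')
      show ?case by (simp add: mult[OF s t] tensor_mult_homog[OF s(2) t(1)] simps)
    qed (simp add: distrib_left simps)
  qed (simp add: distrib_right simps)
  show "F t \<in> homog r" if "t \<in> homog r" for r t
    using that unfolding homog_tensor_def
  proof induction
    case (pure a p b q)
    show ?case using homog[OF pure(1,2)] by (simp only: pure(3))
  qed (simp_all add: simps homog_zero homog_add)
qed

lemma superalgebra_hom_tensor_map:
  assumes f: "superalgebra_hom f" and g: "superalgebra_hom g"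
  shows "superalgebra_hom (tensor_map f g)"
proof (rule superalgebra_hom_tensorI)
  note lin = superalgebra_hom_linear[OF f] superalgebra_hom_linear[OF g]
  note ring = ring_map_simps[OF superalgebra_hom_ring_map[OF f]] ring_map_simps[OF
      superalgebra_hom_ring_map[OF g]]
  show "complex_linear (tensor_map f g)" by (rule tensor_map_linear[OF lin])
  show "tensor_map f g 1 = 1" by (simp add: one_tensor_eq tensor_map_pure[OF lin] ring)
  show "tensor_map f g (a \<otimes> \<alpha>) * tensor_map f g (b \<otimes> \<beta>)
      = koszul_sign p q *\<^sub>C tensor_map f g ((a * b) \<otimes> (\<alpha> * \<beta>))"
    if "a \<in> homog p'" "\<alpha> \<in> homog q" "b \<in> homog p" "\<beta> \<in> homog q'" for a \<alpha> b \<beta> p q p' q'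
    by (simp add: tensor_map_pure[OF lin] ring
        tensor_mult_homog[OF superalgebra_hom_homog[OF g that(2)] superalgebra_hom_homog[OF f
            that(3)]])
  show "tensor_map f g (a \<otimes> b) \<in> homog (p \<noteq> q)" if "a \<in> homog p" "b \<in> homog q" for a b p q
    using superalgebra_hom_homog[OF f that(1)] superalgebra_hom_homog[OF g that(2)]
    by (auto simp: tensor_map_pure[OF lin] homog_tensor_def intro: tensor_homog.pure)
qed

lemma tensor_assoc_bilinear_left: "bilinear_map (\<lambda>a b. a \<otimes> (b \<otimes> c))"
  by (simp add: bilinear_map_def complex_linear_def tensor_add_left tensor_add_right
    tensor_scaleC_left tensor_scaleC_right)

lemma tensor_assoc_bilinear: "bilinear_map (\<lambda>t c. tensor_lift (\<lambda>a b. a \<otimes> (b \<otimes> c)) t)"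
  unfolding bilinear_map_def
proof (intro conjI allI)
  note b = tensor_assoc_bilinear_left
  show "complex_linear (tensor_lift (\<lambda>a b. a \<otimes> (b \<otimes> c)))" for c
    by (rule tensor_lift_linear[OF b])
  show "complex_linear (\<lambda>c. tensor_lift (\<lambda>a b. a \<otimes> (b \<otimes> c)) t)" for t
    by (simp add: complex_linear_def tensor_add_right tensor_lift_sum_fun(2)[OF b b]
        tensor_scaleC_right tensor_lift_scale_fun(2)[OF b])
qed

lemma tensor_assoc_pure: "tensor_assoc ((a \<otimes> b) \<otimes> c) = a \<otimes> (b \<otimes> c)"
  by (simp add: tensor_assoc_def tensor_lift_pure tensor_assoc_bilinear
      tensor_assoc_bilinear_left)

lemma tensor_assoc_linear: "complex_linear tensor_assoc"
  unfolding tensor_assoc_def by (rule tensor_lift_linear[OF tensor_assoc_bilinear])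

lemma tensor_induct3_homog [case_names pure add]:
  assumes pure: "\<And>a b c p q r. a \<in> homog p \<Longrightarrow> b \<in> homog q \<Longrightarrow> c \<in> homog r \<Longrightarrow> P ((a \<otimes> b) \<otimes> c)"
    and add: "\<And>x y. P x \<Longrightarrow> P y \<Longrightarrow> P (x + y)"
  shows "P (t :: (('a::superalgebra, 'b::superalgebra) tensor, 'c::superalgebra) tensor)"
proof (induction t rule: tensor_induct_homog)
  case (pure t c p q)
  show ?case
    by (induction t rule: tensor_induct_homog) (auto simp: tensor_add_left intro: assms pure(2))
qed (fact add)

lemma tensor_homog_pure: "a \<in> homog p \<Longrightarrow> b \<in> homog q \<Longrightarrow> a \<otimes> b \<in> homog (p \<noteq> q)"
  unfolding homog_tensor_def by (rule tensor_homog.pure) auto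

lemma superalgebra_hom_tensor_assoc:
  "superalgebra_hom (tensor_assoc :: (('a::superalgebra, 'b::superalgebra) tensor, 'c::superalgebra)
      tensor \<Rightarrow> _)"
proof (rule superalgebra_homI[OF tensor_assoc_linear])
  note simps = complex_linear_simps[OF tensor_assoc_linear]
  show "tensor_assoc (1 :: (('a, 'b) tensor, 'c) tensor) = 1"
    by (simp add: one_tensor_eq tensor_assoc_pure)
  show "tensor_assoc (s * t) = tensor_assoc s * tensor_assoc t"
    for s t :: "(('a, 'b) tensor, 'c) tensor"
  proof (induction s rule: tensor_induct3_homog)
    case s: (pure a b c p q r)
    show ?case
    proof (induction t rule: tensor_induct3_homog)
      case t: (pure a' b' c' p' q' r')
      \<comment> \<open>Either bracketing moves a' past b and c, and b' past c, so the total signs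
        agree.\<close>
      have "koszul_sign (p' \<noteq> q') r * koszul_sign p' q = koszul_sign p' (q \<noteq> r) * koszul_sign q' r"
        by (auto simp: koszul_sign_def)
      thus ?case
        by (simp add: tensor_mult_homog[OF s(3) tensor_homog_pure[OF t(1,2)]] tensor_mult_homog[OF
            s(2) t(1)]
            tensor_assoc_pure simps tensor_scaleC_left tensor_mult_homog[OF tensor_homog_pure[OF
                s(2,3)] t(1)]
            tensor_mult_homog[OF s(3) t(2)] tensor_scaleC_right scaleC_scaleC)
    qed (simp add: distrib_left simps)
  qed (simp add: distrib_right simps)
  have 1: "tensor_assoc (s \<otimes> c) \<in> homog (p \<noteq> q)" if s: "s \<in> homog p" and c: "c \<in> homog q"
    for p q and s :: "('a, 'b) tensor" and c :: 'c
    using s[unfolded homog_tensor_def]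
  proof induction
    case (pure a p1 b p2)
    have "(p \<noteq> q) = (p1 \<noteq> (p2 \<noteq> q))" using pure(3) by auto
    thus ?case
      using tensor_homog_pure[OF pure(1) tensor_homog_pure[OF pure(2) c]]
      by (simp only: tensor_assoc_pure)
  qed (simp_all add: simps homog_zero homog_add tensor_add_left del: not_iff)
  fix p and t :: "(('a, 'b) tensor, 'c) tensor"
  assume "t \<in> homog p"
  hence "t \<in> tensor_homog p" by (simp add: homog_tensor_def)
  thus "tensor_assoc t \<in> homog p"
  proof induction
    case (pure s q c r)
    show ?case using 1[OF pure(1,2)] by (simp only: pure(3))
  qed (simp_all add: simps homog_zero homog_add)
qed

lemma tensor_assoc_tensor_map:
  fixes f :: "'a::superalgebra \<Rightarrow> 'a'::complex_space" and g ::
      "'b::superalgebra \<Rightarrow> 'b'::complex_space"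
    and h :: "'c::superalgebra \<Rightarrow> 'c'::complex_space"
  assumes "complex_linear f" "complex_linear g" "complex_linear h"
  shows "tensor_assoc (tensor_map (tensor_map f g) h t)
      = tensor_map f (tensor_map g h) (tensor_assoc t)"
proof (induction t rule: tensor_induct3_homog)
  case (pure a b c p q r)
  show ?case by (simp add: tensor_assoc_pure tensor_map_pure tensor_map_linear assms)
next
  case (add x y)
  thus ?case
    using assms
    by (simp add: complex_linear_simps[OF tensor_assoc_linear] complex_linear_simps[OF
        tensor_map_linear] tensor_map_linear)
qed

lemma homog_odd_complex: "(x :: complex) \<in> homog True \<Longrightarrow> x = 0"
  by (simp add: homog_complex_def)

lemma counit_bilinear:
  assumes "complex_linear \<epsilon>"
  shows "bilinear_map (\<lambda>a b. \<epsilon> a *\<^sub>C b)" "bilinear_map (\<lambda>a b. \<epsilon> b *\<^sub>C a)"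
  using assms by (auto simp: bilinear_map_def complex_linear_def scaleC_add_left scaleC_add_right
      scaleC_scaleC scaleC_complex_def mult.commute)

text \<open>Since the complex numbers are purely even, \<epsilon> kills odd elements: whenever the
  Koszul sign is -1, both sides vanish. Hence contracting one tensor factor with \<epsilon> is
  multiplicative for the graded product.\<close>

lemma superalgebra_hom_counit:
  fixes \<epsilon> :: "'a::superalgebra \<Rightarrow> complex"
  assumes \<epsilon>: "superalgebra_hom \<epsilon>"
  shows "superalgebra_hom (tensor_lift (\<lambda>a (b :: 'b::superalgebra). \<epsilon> a *\<^sub>C b))"
    and "superalgebra_hom (tensor_lift (\<lambda>(b :: 'b::superalgebra) a. \<epsilon> a *\<^sub>C b))"
proof -
  have lin: "complex_linear \<epsilon>" by (rule superalgebra_hom_linear[OF \<epsilon>])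
  note bl = counit_bilinear[OF lin]
  note ring = ring_map_simps[OF superalgebra_hom_ring_map[OF \<epsilon>]]
  have odd: "\<epsilon> a = 0" if "a \<in> homog True" for a
    using superalgebra_hom_homog[OF \<epsilon> that] by (rule homog_odd_complex)
  have h: "\<epsilon> a *\<^sub>C b \<in> homog (p \<noteq> q)" "\<epsilon> a *\<^sub>C b \<in> homog (q \<noteq> p)"
    if "a \<in> homog p" "b \<in> homog q" for a p and b :: 'b and q
    using that odd[of a] by (cases p; auto simp: homog_zero homog_scaleC)+
  show "superalgebra_hom (tensor_lift (\<lambda>a (b :: 'b). \<epsilon> a *\<^sub>C b))"
  proof (rule superalgebra_hom_tensorI)
    fix a b :: 'a and \<alpha> \<beta> :: 'b and p q p' q'
    assume "a \<in> homog p'" "\<alpha> \<in> homog q" "b \<in> homog p" "(\<beta> :: 'b) \<in> homog q'"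
    thus "tensor_lift (\<lambda>a (b :: 'b). \<epsilon> a *\<^sub>C b) (a \<otimes> \<alpha>) * tensor_lift (\<lambda>a b. \<epsilon> a *\<^sub>C b) (b \<otimes> \<beta>)
       = koszul_sign p q *\<^sub>C tensor_lift (\<lambda>a b. \<epsilon> a *\<^sub>C b) ((a * b) \<otimes> (\<alpha> * \<beta>))"
      using odd[of b]
      by (cases p) (simp_all add: tensor_lift_pure[OF bl(1)] ring koszul_sign_def scaleC_one
        mult_scaleC_left mult_scaleC_right scaleC_scaleC mult.commute)
  qed (simp_all add: tensor_lift_linear[OF bl(1)] tensor_lift_pure[OF bl(1)] one_tensor_eq ring
      scaleC_one h
        del: not_iff)
  show "superalgebra_hom (tensor_lift (\<lambda>(b :: 'b) a. \<epsilon> a *\<^sub>C b))"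
  proof (rule superalgebra_hom_tensorI)
    fix a b :: 'b and \<alpha> \<beta> :: 'a and p q p' q'
    assume "(a :: 'b) \<in> homog p'" "\<alpha> \<in> homog q" "b \<in> homog p" "\<beta> \<in> homog q'"
    thus "tensor_lift (\<lambda>(b :: 'b) a. \<epsilon> a *\<^sub>C b) (a \<otimes> \<alpha>) * tensor_lift (\<lambda>b a. \<epsilon> a *\<^sub>C b) (b \<otimes> \<beta>)
       = koszul_sign p q *\<^sub>C tensor_lift (\<lambda>b a. \<epsilon> a *\<^sub>C b) ((a * b) \<otimes> (\<alpha> * \<beta>))"
      using odd[of \<alpha>]
      by (cases q) (simp_all add: tensor_lift_pure[OF bl(2)] ring koszul_sign_def scaleC_one
        mult_scaleC_left mult_scaleC_right scaleC_scaleC mult.commute)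
  qed (simp_all add: tensor_lift_linear[OF bl(2)] tensor_lift_pure[OF bl(2)] one_tensor_eq ring
      scaleC_one h
        del: not_iff)
qed

section \<open>Presented algebras are generated by their generators\<close>

lemma abs_presented_scaleC: "abs_presented (c *\<^sub>C x) = c *\<^sub>C abs_presented x"
  by (simp add: scaleC_presented.abs_eq)

lemma superalgebra_hom_presented_eqI:
  fixes f g :: "'g::presentation presented \<Rightarrow> 'a::superalgebra"
  assumes f: "superalgebra_hom f" and g: "superalgebra_hom g"
    and gen: "\<And>x. f (gen x) = g (gen x)"
  shows "f = g"
proof
  note fs = complex_linear_simps[OF superalgebra_hom_linear[OF f]] ring_map_simps(2,3)[OF
      superalgebra_hom_ring_map[OF f]]
  note gs = complex_linear_simps[OF superalgebra_hom_linear[OF g]] ring_map_simps(2,3)[OF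
      superalgebra_hom_ring_map[OF g]]
  note abs = ring_map_simps[OF ring_map_abs_presented]
  have word: "f (abs_presented (Poly_Mapping.single (Word w) c))
      = g (abs_presented (Poly_Mapping.single (Word w) c))"
    for w :: "'g list" and c
  proof (induction w)
    case Nil
    have "Poly_Mapping.single (Word []) c = c *\<^sub>C (1 :: 'g free)"
      by (simp add: scaleC_single scaleC_complex_def flip: single_one zero_word_def)
    thus ?case by (simp add: abs_presented_scaleC abs fs gs)
  next
    case (Cons a w)
    have "Poly_Mapping.single (Word (a # w)) c = generator a * Poly_Mapping.single (Word w) c"
      by (simp add: generator_def mult_single plus_word_def)
    thus ?case using Cons gen[of a] by (simp add: abs fs gs gen_def)
  qed
  have "f (abs_presented x) = g (abs_presented x)" for x
  proof (induction x rule: poly_mapping_single_induct)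
    case (single k c)
    show ?case using word[of "letters k" c] by simp
  qed (simp_all add: abs fs gs)
  fix x
  show "f x = g x"
    by (induction x rule: presented.abs_induct) fact
qed

section \<open>Series with tensor coefficients\<close>

definition left_series :: "'a::superalgebra fps \<Rightarrow> ('a, 'b::superalgebra) tensor fps" where
  "left_series = map_series (\<lambda>a. a \<otimes> 1)"

definition right_series :: "'b::superalgebra fps \<Rightarrow> ('a::superalgebra, 'b) tensor fps" where
  "right_series = map_series (\<lambda>b. 1 \<otimes> b)"

text \<open>Both embeddings are ring maps, so additivity, substitution and products of tensor series
  reduce to them; only their mutual order can produce a sign.\<close>

lemma tensor_series_factor: "F \<otimes>\<^sub>s G = left_series F * right_series G"
  by (rule fps_ext) (simp add: tensor_series_def left_series_def right_series_def fps_mult_nth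
      tensor_mult_even_left[OF homog_one] atMost_atLeast0)

lemma left_right_linear: "complex_linear (\<lambda>a. a \<otimes> b)" "complex_linear (\<lambda>b. a \<otimes> b)"
  by (simp_all add: complex_linear_def tensor_add_left tensor_add_right tensor_scaleC_left
      tensor_scaleC_right)

lemma ring_map_left_series: "ring_map (left_series :: 'a::superalgebra fps \<Rightarrow> ('a, 'b::superalgebra)
    tensor fps)"
  unfolding left_series_def
  by (rule ring_map_map_series) (simp add: ring_map_def tensor_add_left tensor_mult_even_left[OF
      homog_one] one_tensor_eq)

lemma ring_map_right_series: "ring_map (right_series :: 'b::superalgebra fps \<Rightarrow> ('a::superalgebra,
    'b) tensor fps)"
  unfolding right_series_def
  by (rule ring_map_map_series) (simp add: ring_map_def tensor_add_right tensor_mult_even_right[OF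
      homog_one] one_tensor_eq)

lemmas left_right_simps = ring_map_simps[OF ring_map_left_series] ring_map_simps[OF
    ring_map_right_series]

lemma tensor_series_simps:
  "(F + F') \<otimes>\<^sub>s G = F \<otimes>\<^sub>s G + F' \<otimes>\<^sub>s G" "(F - F') \<otimes>\<^sub>s G = F \<otimes>\<^sub>s G - F' \<otimes>\<^sub>s G" "(- F) \<otimes>\<^sub>s G =
      - (F \<otimes>\<^sub>s G)"
  "F \<otimes>\<^sub>s (G + G') = F \<otimes>\<^sub>s G + F \<otimes>\<^sub>s G'" "F \<otimes>\<^sub>s (G - G') = F \<otimes>\<^sub>s G - F \<otimes>\<^sub>s G'" "F \<otimes>\<^sub>s (- G) =
      - (F \<otimes>\<^sub>s G)"
  "1 \<otimes>\<^sub>s 1 = (1 :: ('a::superalgebra, 'b::superalgebra) tensor fps)"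
  for F F' :: "'a::superalgebra fps" and G G' :: "'b::superalgebra fps"
  by (simp_all add: tensor_series_factor left_right_simps algebra_simps)

definition homog_coeffs :: "bool \<Rightarrow> 'a::superalgebra fps \<Rightarrow> bool" where
  "homog_coeffs p F \<longleftrightarrow> (\<forall>n. fps_nth F n \<in> homog p)"

lemma right_left_series_commute:
  fixes F :: "'a::superalgebra fps" and G :: "'b::superalgebra fps"
  assumes "homog_coeffs p F" "homog_coeffs q G"
  shows "right_series G * left_series F
    = (if p \<and> q then - (left_series F * right_series G) else left_series F * right_series G)"
proof (rule fps_ext)
  fix n
  have "fps_nth (right_series G * left_series F) n = (\<Sum>i\<le>n. koszul_sign p q *\<^sub>C (fps_nth F (n
      - i) \<otimes> fps_nth G i))"
    using assms by (simp add: fps_mult_nth atMost_atLeast0 left_series_def right_series_def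
        homog_coeffs_def
        tensor_mult_homog[of _ q _ p])
  also have "\<dots> = (\<Sum>i\<le>n. koszul_sign p q *\<^sub>C (fps_nth F i \<otimes> fps_nth G (n - i)))"
    by (rule sum.reindex_bij_witness[of _ "\<lambda>i. n - i" "\<lambda>i. n - i"]) auto
  also have "\<dots> = koszul_sign p q *\<^sub>C fps_nth (left_series F * right_series G) n"
    by (simp add: fps_mult_nth atMost_atLeast0 left_series_def right_series_def scaleC_sum
        tensor_mult_even_left[OF homog_one])
  finally show "fps_nth (right_series G * left_series F) n = fps_nth
     (if p \<and> q then - (left_series F * right_series G) else left_series F * right_series G) n"
    by (simp add: koszul_sign_def scaleC_minus_left scaleC_one)
qed

lemma tensor_series_mult:
  fixes F F' :: "'a::superalgebra fps" and G G' :: "'b::superalgebra fps"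
  assumes "homog_coeffs p F'" "homog_coeffs q G"
  shows "(F \<otimes>\<^sub>s G) * (F' \<otimes>\<^sub>s G') = (if p \<and> q then
      - ((F * F') \<otimes>\<^sub>s (G * G')) else (F * F') \<otimes>\<^sub>s (G * G'))"
proof -
  have "(F \<otimes>\<^sub>s G) * (F' \<otimes>\<^sub>s G') = left_series F * (right_series G * left_series F') * right_series
      G'"
    by (simp add: tensor_series_factor mult.assoc)
  thus ?thesis
    by (simp add: right_left_series_commute[OF assms] tensor_series_factor left_right_simps
        mult.assoc)
qed

text \<open>Used for right multiplication by K \<otimes> K: as K is even, it is absorbed into every
  term of a coproduct without signs.\<close>

lemma tensor_series_mult_even_right:
  fixes F F' :: "'a::superalgebra fps" and G G' :: "'b::superalgebra fps"
  assumes "homog_coeffs False F'"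
  shows "(F \<otimes>\<^sub>s G) * (F' \<otimes>\<^sub>s G') = (F * F') \<otimes>\<^sub>s (G * G')"
proof (rule fps_ext)
  have "right_series G * left_series F' = left_series F' * (right_series G :: ('a, 'b) tensor fps)"
  proof (rule fps_ext)
    fix n
    have "fps_nth (right_series G * left_series F') n = (\<Sum>i\<le>n. fps_nth F' (n - i) \<otimes> fps_nth G i)"
      using assms by (simp add: fps_mult_nth atMost_atLeast0 left_series_def right_series_def
          homog_coeffs_def
          tensor_mult_even_right)
    also have "\<dots> = (\<Sum>i\<le>n. fps_nth F' i \<otimes> fps_nth G (n - i))"
      by (rule sum.reindex_bij_witness[of _ "\<lambda>i. n - i" "\<lambda>i. n - i"]) auto
    also have "\<dots> = fps_nth (left_series F' * right_series G) n"
      by (simp add: fps_mult_nth atMost_atLeast0 left_series_def right_series_def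
          tensor_mult_even_left[OF homog_one])
    finally show "fps_nth (right_series G * left_series F' :: ('a, 'b) tensor fps) n
        = fps_nth (left_series F' * right_series G) n" .
  qed
  note * = this
  have "(F \<otimes>\<^sub>s G) * (F' \<otimes>\<^sub>s G') = left_series F * (right_series G * left_series F') * right_series
      G'"
    by (simp add: tensor_series_factor mult.assoc)
  note this[unfolded *]
  thus "fps_nth ((F \<otimes>\<^sub>s G) * (F' \<otimes>\<^sub>s G')) n = fps_nth ((F * F') \<otimes>\<^sub>s (G * G')) n" for n
    by (simp add: tensor_series_factor left_right_simps mult.assoc)
qed

lemma tensor_series_mult_left: "(F \<otimes>\<^sub>s 1) * (F' \<otimes>\<^sub>s G) = (F * F') \<otimes>\<^sub>s G"
  for F F' :: "'a::superalgebra fps" and G :: "'b::superalgebra fps"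
  by (simp add: tensor_series_factor left_right_simps mult.assoc)

lemma subst_series_tensor_series:
  fixes F :: "'a::superalgebra fps" and G :: "'b::superalgebra fps"
  assumes "fps_nth g 0 = 0"
  shows "subst_series g (F \<otimes>\<^sub>s G) = subst_series g F \<otimes>\<^sub>s subst_series g G"
  by (simp add: tensor_series_factor subst_series_mult[OF assms] left_series_def right_series_def
      map_series_subst_series left_right_linear)

lemma map_series_tensor_map:
  assumes "superalgebra_hom f" "superalgebra_hom g"
  shows "map_series (tensor_map f g) (F \<otimes>\<^sub>s G) = map_series f F \<otimes>\<^sub>s map_series g G"
  by (rule fps_ext)
     (simp add: tensor_series_def tensor_map_pure assms superalgebra_hom_linear tensor_map_linear
        complex_linear_simps(6)[OF tensor_map_linear])

lemma map_series_tensor_assoc: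
  fixes F :: "'a::superalgebra fps" and G :: "'b::superalgebra fps" and H :: "'c::superalgebra fps"
  shows "map_series tensor_assoc ((F \<otimes>\<^sub>s G) \<otimes>\<^sub>s H) = F \<otimes>\<^sub>s (G \<otimes>\<^sub>s H)"
proof -
  have "ring_map (map_series (tensor_assoc :: (('a, 'b) tensor, 'c) tensor \<Rightarrow> _))"
    by (intro ring_map_map_series superalgebra_hom_ring_map superalgebra_hom_tensor_assoc)
  note ring_map_simps(2)[OF this]
  moreover have "map_series tensor_assoc (left_series (left_series F) :: (('a, 'b) tensor, 'c)
      tensor fps) = left_series F"
    by (rule fps_ext) (simp add: left_series_def tensor_assoc_pure one_tensor_eq)
  moreover have "map_series tensor_assoc (left_series (right_series G) :: (('a, 'b) tensor, 'c)
      tensor fps) = right_series (left_series G)"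
    by (rule fps_ext) (simp add: left_series_def right_series_def tensor_assoc_pure)
  moreover have "map_series tensor_assoc (right_series H :: (('a, 'b) tensor, 'c) tensor fps)
      = right_series (right_series H)"
    by (rule fps_ext) (simp add: right_series_def tensor_assoc_pure one_tensor_eq)
  ultimately show ?thesis
    by (simp add: tensor_series_factor left_right_simps mult.assoc)
qed

section \<open>The coalgebra structure of the super Yangian\<close>

lemma homog_sum: "(\<And>i. i \<in> A \<Longrightarrow> f i \<in> homog p) \<Longrightarrow> sum f A \<in> (homog p :: 'a::superalgebra set)"
  by (induction A rule: infinite_finite_induct) (auto intro: homog_zero homog_add)

lemma homog_coeffs_mult:
  assumes "homog_coeffs p F" "homog_coeffs q G"
  shows "homog_coeffs (p \<noteq> q) (F * G)"
  using assms unfolding homog_coeffs_def fps_mult_nth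
  by (intro allI homog_sum homog_mult) auto

lemma homog_coeffs_subst_series: "homog_coeffs p F \<Longrightarrow> homog_coeffs p (subst_series g F)"
  unfolding homog_coeffs_def subst_series_def by (auto intro!: homog_sum homog_scaleC)

lemma homog_coeffs_shift_series: "homog_coeffs p F \<Longrightarrow> homog_coeffs p (shift_series c F)"
  by (simp add: shift_series_eq_subst homog_coeffs_subst_series)

lemma gen_homog: "gen g \<in> homog (odd_generator g)"
  unfolding gen_def homog_presented_def by (intro imageI free_homog_generator)

lemma homog_coeffs_L_series: "homog_coeffs (odd (grade i + grade j)) (L_series i j)"
  unfolding homog_coeffs_def
proof
  fix n
  show "fps_nth (L_series i j) n \<in> homog (odd (grade i + grade j))"
  proof (cases n)
    case 0
    thus ?thesis by (auto simp: L_series_def series_of_def homog_zero homog_one)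
  next
    case (Suc m)
    thus ?thesis
      using gen_homog[of "gen_L i j m"] by (simp add: L_series_def series_of_def
          odd_generator_U_gen_def)
  qed
qed

lemma homog_coeffs_L:
  "homog_coeffs False (L_series 3 3)" "homog_coeffs False (L_series 3 1)"
  "homog_coeffs True (L_series 3 2)" "homog_coeffs True (L_series 2 3)"
  using homog_coeffs_L_series[of 3 3] homog_coeffs_L_series[of 3 1] homog_coeffs_L_series[of 3 2]
    homog_coeffs_L_series[of 2 3]
  by (simp_all add: grade_def)

text \<open>The odd part of \<open>K\<close> vanishes because \<open>K L\<^sup>3\<^sup>3 = 1\<close> with \<open>L\<^sup>3\<^sup>3\<close> even.\<close>

lemma homog_coeffs_K_series: "homog_coeffs False K_series"
proof -
  have hpart_mult: "hpart True (x * y) = hpart True x * y" if "y \<in> homog False" for x y :: U_R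
  proof (rule hpart_eqI)
    show "hpart True x * y \<in> homog True"
      using homog_mult[OF hpart_homog[of True x] that] by simp
    show "x * y - hpart True x * y \<in> homog (\<not> True)"
      using homog_mult[OF diff_hpart_homog[of x True] that] by (simp add: left_diff_distrib)
  qed
  have hpart_zero: "hpart True (0 :: U_R) = 0" by (rule hpart_other) (rule homog_zero)
  have hpart_sum': "hpart True (sum f A) = (\<Sum>i\<in>A. hpart True (f i :: U_R))" for f and A :: "nat set"
    by (induction A rule: infinite_finite_induct) (simp_all add: hpart_add hpart_zero)
  have "map_series (hpart True) K_series * L_series 3 3
      = map_series (hpart True) (K_series * L_series 3 3)"
    using homog_coeffs_L(1)
    by (intro fps_ext) (simp add: fps_mult_nth hpart_sum' hpart_mult homog_coeffs_def)
  also have "\<dots> = 0"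
    by (intro fps_ext) (simp add: K_series_inverse hpart_zero hpart_other homog_one)
  finally have "map_series (hpart True) K_series * L_series 3 3 * K_series = 0" by simp
  hence "map_series (hpart True) K_series = 0" by (simp add: mult.assoc K_series_inverse)
  hence "hpart True (fps_nth K_series n) = 0" for n
    by (metis fps_zero_nth map_series_nth)
  thus ?thesis unfolding homog_coeffs_def using diff_hpart_homog[of "fps_nth K_series _" True]
    by (metis diff_zero)
qed

lemma homog_coeffs_K_shift: "homog_coeffs False K_shift"
  by (rule homog_coeffs_shift_series[OF homog_coeffs_K_series])

lemma homog_coeffs_f_U: "homog_coeffs True f_U"
  using homog_coeffs_mult[OF homog_coeffs_L(3) homog_coeffs_K_series] by (simp add: f_U_def)

lemma homog_coeffs_L31_K: "homog_coeffs False (L_series 3 1 * K_series)"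
  using homog_coeffs_mult[OF homog_coeffs_L(2) homog_coeffs_K_series] by simp

section \<open>The bialgebra axioms on U(R)\<close>

lemma map_series_comp: "map_series (f \<circ> g) F = map_series f (map_series g F)"
  by (rule fps_ext) simp

lemma map_series_id: "map_series id F = F"
  by (rule fps_ext) simp

lemma ring_map_map_hom: "superalgebra_hom f \<Longrightarrow> ring_map (map_series f)"
  by (intro ring_map_map_series superalgebra_hom_ring_map)

lemma tensor_series_zero: "(0 :: 'a fps) \<otimes>\<^sub>s G = 0" "F \<otimes>\<^sub>s (0 :: 'b fps) = 0"
  for F :: "'a::superalgebra fps" and G :: "'b::superalgebra fps"
  by (simp_all add: tensor_series_factor left_right_simps)

lemma tensor_series_sum:
  fixes F :: "'i \<Rightarrow> 'a::superalgebra fps" and G :: "'b::superalgebra fps"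
  shows "sum F A \<otimes>\<^sub>s G = (\<Sum>i\<in>A. F i \<otimes>\<^sub>s G)" and "G \<otimes>\<^sub>s sum F A = (\<Sum>i\<in>A. G \<otimes>\<^sub>s F i)"
  by (induction A rule: infinite_finite_induct)
      (simp_all add: tensor_series_simps tensor_series_zero)

lemma gen_L_eq: "gen (gen_L i j n) = fps_nth (L_series i j) (Suc n)"
  by (simp add: L_series_def series_of_def)

lemma U_hom_eqI:
  assumes "superalgebra_hom f" "superalgebra_hom g"
    and "\<And>i j. map_series f (L_series i j) = map_series g (L_series i j)"
  shows "f = g"
proof (rule superalgebra_hom_presented_eqI[OF assms(1,2)])
  fix x :: U_gen
  obtain i j n where x: "x = gen_L i j n" by (cases x)
  show "f (gen x) = g (gen x)"
    using arg_cong[OF assms(3)[of i j], of "\<lambda>F. fps_nth F (Suc n)"] by (simp add: x gen_L_eq)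
qed

text \<open>Every map involved is a superalgebra homomorphism, so the axioms need checking only on
  L(u). There coassociativity is an exchange of two summations, and the counit axioms are
  multiplication by the identity matrix.\<close>

lemma U_bialgebra:
  assumes "is_U_coalgebra \<Delta> \<epsilon>"
  shows "is_superbialgebra \<Delta> \<epsilon>"
proof -
  have \<Delta>: "superalgebra_hom \<Delta>" and \<epsilon>: "superalgebra_hom \<epsilon>"
    and \<Delta>L: "\<And>i j. map_series \<Delta> (L_series i j) = (\<Sum>k\<in>UNIV. L_series i k \<otimes>\<^sub>s L_series k j)"
    and \<epsilon>L: "\<And>i j. map_series \<epsilon> (L_series i j) = (if i = j then 1 else 0)"
    using assms by (auto simp: is_U_coalgebra_def)
  note id = superalgebra_hom_id
  note \<Delta>id = superalgebra_hom_tensor_map[OF \<Delta> id] superalgebra_hom_tensor_map[OF id \<Delta>]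
  note sums = ring_map_simps(7)[OF ring_map_map_hom]
  have "tensor_assoc \<circ> tensor_map \<Delta> id \<circ> \<Delta> = tensor_map id \<Delta> \<circ> \<Delta>"
  proof (rule U_hom_eqI)
    fix i j
    have "map_series (tensor_assoc \<circ> tensor_map \<Delta> id \<circ> \<Delta>) (L_series i j)
      = (\<Sum>k\<in>UNIV. \<Sum>m\<in>UNIV. L_series i m \<otimes>\<^sub>s (L_series m k \<otimes>\<^sub>s L_series k j))"
      by (simp add: map_series_comp \<Delta>L sums[OF \<Delta>id(1)] sums[OF superalgebra_hom_tensor_assoc]
          map_series_tensor_map[OF \<Delta> id] map_series_id tensor_series_sum map_series_tensor_assoc)
    also have "\<dots> = (\<Sum>m\<in>UNIV. \<Sum>k\<in>UNIV. L_series i m \<otimes>\<^sub>s (L_series m k \<otimes>\<^sub>s L_series k j))"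
      by (rule sum.swap)
    also have "\<dots> = map_series (tensor_map id \<Delta> \<circ> \<Delta>) (L_series i j)"
      by (simp add: map_series_comp \<Delta>L sums[OF \<Delta>id(2)]
          map_series_tensor_map[OF id \<Delta>] map_series_id tensor_series_sum)
    finally show "map_series (tensor_assoc \<circ> tensor_map \<Delta> id \<circ> \<Delta>) (L_series i j)
      = map_series (tensor_map id \<Delta> \<circ> \<Delta>) (L_series i j)" .
  qed (intro superalgebra_hom_comp superalgebra_hom_tensor_assoc \<Delta> \<Delta>id)+
  hence coassoc: "tensor_assoc (tensor_map \<Delta> id (\<Delta> x)) = tensor_map id \<Delta> (\<Delta> x)" for x
    by (metis comp_apply)
  define l :: "(U_R, U_R) tensor \<Rightarrow> U_R" where "l = tensor_lift (\<lambda>a b. \<epsilon> a *\<^sub>C b)"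
  define r :: "(U_R, U_R) tensor \<Rightarrow> U_R" where "r = tensor_lift (\<lambda>a b. \<epsilon> b *\<^sub>C a)"
  have l: "superalgebra_hom l" and r: "superalgebra_hom r"
    unfolding l_def r_def by (rule superalgebra_hom_counit[OF \<epsilon>])+
  note bl = counit_bilinear[OF superalgebra_hom_linear[OF \<epsilon>]]
  have one: "\<epsilon> 1 = 1" using \<epsilon> by (simp add: superalgebra_hom_def)
  have coeff: "\<epsilon> (fps_nth (L_series i j) n) = (if i = j \<and> n = 0 then 1 else 0)" for i j n
    using arg_cong[OF \<epsilon>L[of i j], of "\<lambda>F. fps_nth F n"] by simp
  have scalar: "map_series (\<lambda>a. \<epsilon> a *\<^sub>C 1) (L_series i j) = (if i = j then 1 else (0 :: U_R fps))"
      for i j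
    by (rule fps_ext) (simp add: coeff scaleC_one)
  have ll: "map_series l (F \<otimes>\<^sub>s G) = map_series (\<lambda>a. \<epsilon> a *\<^sub>C 1) F * G" for F G
  proof -
    have "map_series l (left_series F) = map_series (\<lambda>a. \<epsilon> a *\<^sub>C 1) F"
        "map_series l (right_series G) = G"
      by (auto intro!: fps_ext simp: left_series_def right_series_def l_def tensor_lift_pure[OF
          bl(1)] one scaleC_one)
    thus ?thesis by (simp add: tensor_series_factor ring_map_simps(2)[OF ring_map_map_hom[OF l]])
  qed
  have rr: "map_series r (F \<otimes>\<^sub>s G) = F * map_series (\<lambda>a. \<epsilon> a *\<^sub>C 1) G" for F G
  proof -
    have "map_series r (right_series G) = map_series (\<lambda>a. \<epsilon> a *\<^sub>C 1) G"
        "map_series r (left_series F) = F"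
      by (auto intro!: fps_ext simp: left_series_def right_series_def r_def tensor_lift_pure[OF
          bl(2)] one scaleC_one)
    thus ?thesis by (simp add: tensor_series_factor ring_map_simps(2)[OF ring_map_map_hom[OF r]])
  qed
  have "l \<circ> \<Delta> = id"
    by (rule U_hom_eqI)
      (simp_all add: superalgebra_hom_comp \<Delta> l id map_series_comp \<Delta>L map_series_id sums[OF l] ll
          scalar
        if_distrib[of "\<lambda>x. x * _"] cong: if_cong)
  hence L: "l (\<Delta> x) = x" for x by (metis comp_apply id_apply)
  have "r \<circ> \<Delta> = id"
    by (rule U_hom_eqI)
      (simp_all add: superalgebra_hom_comp \<Delta> r id map_series_comp \<Delta>L map_series_id sums[OF r] rr
          scalar
        if_distrib[of "\<lambda>x. _ * x"] cong: if_cong)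
  hence R: "r (\<Delta> x) = x" for x by (metis comp_apply id_apply)
  show ?thesis
    unfolding is_superbialgebra_def l_def[symmetric] r_def[symmetric]
    using \<Delta> \<epsilon> coassoc L R by blast
qed

text \<open>The starting point is L^23 = e L^33 with L taken at u + 1. Subtracting (e \<otimes> 1)(1
  + Z) removes the term from L^23 \<otimes> L^33 and completes L^22 K to h and L^21 K to [h, f_0].
  The unit in e \<otimes> 1 keeps these products free of signs.\<close>

lemma U_coproduct_e:
  assumes "is_U_coalgebra \<Delta> \<epsilon>"
  defines "g \<equiv> shift_series 1 f_U" and "e2 \<equiv> e_U\<^sup>2 - anticommutator e_U (- L_mode 2 3)"
  defines "Z \<equiv> g \<otimes>\<^sub>s e_U + (g\<^sup>2 + anticommutator g (- L_mode 3 2)) \<otimes>\<^sub>s e2"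
  shows "(map_series \<Delta> e_U - e_U \<otimes>\<^sub>s 1) * (1 + Z)
    = h_U \<otimes>\<^sub>s e_U + commutator h_U (- L_mode 3 2) \<otimes>\<^sub>s e2"
proof -
  have \<Delta>: "superalgebra_hom \<Delta>"
    and \<Delta>L: "\<And>i j. map_series \<Delta> (L_series i j) = (\<Sum>k\<in>UNIV. L_series i k \<otimes>\<^sub>s L_series k j)"
    using assms by (auto simp: is_U_coalgebra_def)
  note hom = ring_map_simps[OF ring_map_map_hom[OF \<Delta>]]
  have \<Delta>V: "map_series \<Delta> (L_shift i j) = (\<Sum>k\<in>UNIV. L_shift i k \<otimes>\<^sub>s L_shift k j)" for i j
    by (simp add: shift_series_eq_subst map_series_subst_series[OF superalgebra_hom_linear[OF \<Delta>]] \<Delta>L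
        subst_series_sum subst_series_tensor_series shifted_inverse_nth_0)
  define K where "K = K_shift \<otimes>\<^sub>s K_shift"
  have K: "(F \<otimes>\<^sub>s G) * K = (F * K_shift) \<otimes>\<^sub>s (G * K_shift)" for F G :: "U_R fps"
    unfolding K_def by (rule tensor_series_mult_even_right[OF homog_coeffs_K_shift])
  have g: "g = L_shift 3 2 * K_shift" by (simp add: g_def f_U_def shift_hom)
  have g2: "g\<^sup>2 + anticommutator g (- L_mode 3 2) = L_shift 3 1 * K_shift"
    using arg_cong[OF L_31, of "shift_series 1"]
    by (simp add: g_def shift_hom anticommutator_def L_mode_const)
  have e2: "e2 = L_shift 1 3 * K_shift" unfolding e2_def by (rule L_shift_13[symmetric])
  have "map_series \<Delta> e_U * map_series \<Delta> (L_shift 3 3) = map_series \<Delta> (L_shift 2 3)"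
    unfolding hom(2)[symmetric] by (simp add: e_U_shift mult.assoc K_shift_cancel)
  hence "map_series \<Delta> e_U * (map_series \<Delta> (L_shift 3 3) * K) = map_series \<Delta> (L_shift 2 3) * K"
    by (simp flip: mult.assoc)
  moreover have "map_series \<Delta> (L_shift 3 3) * K = 1 + Z"
    by (simp add: \<Delta>V sum_3 distrib_right K K_shift_cancel tensor_series_simps Z_def g2 e2)
       (simp add: g e_U_shift)
  moreover have "map_series \<Delta> (L_shift 2 3) * K
      = (L_shift 2 1 * K_shift) \<otimes>\<^sub>s e2 + (L_shift 2 2 * K_shift) \<otimes>\<^sub>s e_U + e_U \<otimes>\<^sub>s 1"
    by (simp add: \<Delta>V sum_3 distrib_right K K_shift_cancel e2 e_U_shift)
  moreover have "(e_U \<otimes>\<^sub>s 1) * (1 + Z)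
      = e_U \<otimes>\<^sub>s 1 + (e_U * g) \<otimes>\<^sub>s e_U + (e_U * (L_shift 3 1 * K_shift)) \<otimes>\<^sub>s e2"
    by (simp add: Z_def distrib_left tensor_series_mult_left g2 add.assoc)
  moreover have "h_U \<otimes>\<^sub>s e_U = (L_shift 2 2 * K_shift) \<otimes>\<^sub>s e_U - (e_U * g) \<otimes>\<^sub>s e_U"
    by (simp add: h_U_shift g e_U_shift mult.assoc flip: tensor_series_simps)
  ultimately show ?thesis
    by (simp add: left_diff_distrib tensor_series_simps flip: L_shift_21)
qed

lemma U_coproduct_f:
  assumes "is_U_coalgebra \<Delta> \<epsilon>"
  defines "g \<equiv> shift_series (- 1) e_U" and "f2 \<equiv> f_U\<^sup>2 + anticommutator f_U (- L_mode 3 2)"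
  defines "Z \<equiv> f_U \<otimes>\<^sub>s g + f2 \<otimes>\<^sub>s (g\<^sup>2 - anticommutator g (- L_mode 2 3))"
  shows "(map_series \<Delta> f_U - 1 \<otimes>\<^sub>s f_U) * (1 + Z)
    = f_U \<otimes>\<^sub>s h_U + f2 \<otimes>\<^sub>s commutator h_U (- L_mode 2 3)"
proof -
  have \<Delta>: "superalgebra_hom \<Delta>"
    and \<Delta>L: "\<And>i j. map_series \<Delta> (L_series i j) = (\<Sum>k\<in>UNIV. L_series i k \<otimes>\<^sub>s L_series k j)"
    using assms by (auto simp: is_U_coalgebra_def)
  note hom = ring_map_simps[OF ring_map_map_hom[OF \<Delta>]]
  define K where "K = K_series \<otimes>\<^sub>s K_series"
  have K: "(F \<otimes>\<^sub>s G) * K = (F * K_series) \<otimes>\<^sub>s (G * K_series)" for F G :: "U_R fps"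
    unfolding K_def by (rule tensor_series_mult_even_right[OF homog_coeffs_K_series])
  have unshift: "shift_series (- 1) (shift_series 1 F) = F" for F :: "U_R fps"
    by (simp add: shift_series_shift_series shift_series_0)
  have g: "g = L_series 2 3 * K_series" by (simp add: g_def e_U_shift shift_hom unshift)
  have g2: "g\<^sup>2 - anticommutator g (- L_mode 2 3) = L_series 1 3 * K_series"
    using arg_cong[OF L_shift_13, of "shift_series (- 1)"]
    by (simp add: g_def shift_hom anticommutator_def L_mode_const unshift)
  have f2: "f2 = L_series 3 1 * K_series" unfolding f2_def by (rule L_31[symmetric])
  have "map_series \<Delta> f_U * map_series \<Delta> (L_series 3 3) = map_series \<Delta> (L_series 3 2)"
    unfolding hom(2)[symmetric] by (simp add: f_U_def mult.assoc K_cancel)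
  hence "map_series \<Delta> f_U * (map_series \<Delta> (L_series 3 3) * K) = map_series \<Delta> (L_series 3 2) * K"
    by (simp flip: mult.assoc)
  moreover have "map_series \<Delta> (L_series 3 3) * K = 1 + Z"
    by (simp add: \<Delta>L sum_3 distrib_right K K_cancel tensor_series_simps Z_def g2 f2)
       (simp add: g f_U_def)
  moreover have "map_series \<Delta> (L_series 3 2) * K
      = f2 \<otimes>\<^sub>s (L_series 1 2 * K_series) + f_U \<otimes>\<^sub>s (L_series 2 2 * K_series) + 1 \<otimes>\<^sub>s f_U"
    by (simp add: \<Delta>L sum_3 distrib_right K K_cancel f2 f_U_def)
  \<comment> \<open>As f is odd, (1 \<otimes> f)(f \<otimes> g) = -(f \<otimes> f g), whereas
    \<open>f2\<close> is even and gives no sign. Subtraction turns this minus into the plus of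
    \<open>h_U_def\<close>.\<close>
  moreover have "(1 \<otimes>\<^sub>s f_U) * (1 + Z)
      = 1 \<otimes>\<^sub>s f_U - f_U \<otimes>\<^sub>s (f_U * g) + f2 \<otimes>\<^sub>s (f_U * (L_series 1 3 * K_series))"
    using homog_coeffs_L31_K
    by (simp add: Z_def distrib_left tensor_series_mult[OF homog_coeffs_f_U homog_coeffs_f_U]
        tensor_series_mult_even_right f2 g2)
  moreover have "f_U \<otimes>\<^sub>s h_U = f_U \<otimes>\<^sub>s (L_series 2 2 * K_series) + f_U \<otimes>\<^sub>s (f_U * g)"
    by (simp add: h_U_def g f_U_def mult.assoc flip: tensor_series_simps)
  ultimately show ?thesis
    by (simp add: left_diff_distrib tensor_series_simps flip: L_12)
qed

section \<open>Transport along the isomorphism\<close>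

text \<open>\<phi> \<otimes> \<phi> intertwines the two coproducts, so each axiom is pushed to the
  target, where it holds, and pulled back by injectivity.\<close>

lemma superbialgebra_transport:
  fixes \<phi> :: "'a::superalgebra \<Rightarrow> 'b::superalgebra"
  assumes \<phi>: "superalgebra_iso \<phi>" and B: "is_superbialgebra \<Delta>B \<epsilon>B"
  defines "\<psi> \<equiv> inv \<phi>"
  shows "is_superbialgebra (tensor_map \<psi> \<psi> \<circ> \<Delta>B \<circ> \<phi>) (\<epsilon>B \<circ> \<phi>)"
proof -
  have hom: "superalgebra_hom \<phi>" "superalgebra_hom \<psi>" and bij: "bij \<phi>"
    using \<phi> superalgebra_iso_inv[OF \<phi>] by (simp_all add: superalgebra_iso_def \<psi>_def)
  have \<Delta>B: "superalgebra_hom \<Delta>B" and \<epsilon>B: "superalgebra_hom \<epsilon>B"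
    and coassoc: "\<And>x. tensor_assoc (tensor_map \<Delta>B id (\<Delta>B x)) = tensor_map id \<Delta>B (\<Delta>B x)"
    and counit: "\<And>x. tensor_lift (\<lambda>a b. \<epsilon>B a *\<^sub>C b) (\<Delta>B x) = x"
        "\<And>x. tensor_lift (\<lambda>a b. \<epsilon>B b *\<^sub>C a) (\<Delta>B x) = x"
    using B by (auto simp: is_superbialgebra_def)
  define \<Delta> where "\<Delta> = tensor_map \<psi> \<psi> \<circ> \<Delta>B \<circ> \<phi>"
  define \<epsilon> where "\<epsilon> = \<epsilon>B \<circ> \<phi>"
  have \<psi>\<phi>: "\<psi> (\<phi> x) = x" and \<phi>\<psi>: "\<phi> (\<psi> y) = y" for x y
    using bij by (simp_all add: \<psi>_def bij_is_inj bij_is_surj surj_f_inv_f)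
  have inverse: "\<psi> \<circ> \<phi> = id" "\<phi> \<circ> \<psi> = id" by (auto simp: \<psi>\<phi> \<phi>\<psi>)
  have \<Delta>: "superalgebra_hom \<Delta>" and \<epsilon>: "superalgebra_hom \<epsilon>"
    unfolding \<Delta>_def \<epsilon>_def
    by (intro superalgebra_hom_comp superalgebra_hom_tensor_map hom \<Delta>B \<epsilon>B)+
  note lin = superalgebra_hom_linear[OF hom(1)] superalgebra_hom_linear[OF hom(2)]
    superalgebra_hom_linear[OF \<Delta>B] superalgebra_hom_linear[OF \<Delta>] superalgebra_hom_linear[OF
        superalgebra_hom_id]
    superalgebra_hom_linear[OF \<epsilon>B] superalgebra_hom_linear[OF \<epsilon>] tensor_map_linear
  have \<phi>\<phi>: "tensor_map \<phi> \<phi> (\<Delta> x) = \<Delta>B (\<phi> x)" for x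
    by (simp add: \<Delta>_def tensor_map_tensor_map lin inverse tensor_map_id)
  have \<phi>\<phi>': "tensor_map \<phi> \<phi> \<circ> \<Delta> = \<Delta>B \<circ> \<phi>" by (auto simp: \<phi>\<phi>)
  have "tensor_assoc (tensor_map \<Delta> id (\<Delta> x)) = tensor_map id \<Delta> (\<Delta> x)" for x
  proof -
    have "tensor_map \<phi> (tensor_map \<phi> \<phi>) (tensor_assoc (tensor_map \<Delta> id (\<Delta> x)))
        = tensor_assoc (tensor_map (tensor_map \<phi> \<phi>) \<phi> (tensor_map \<Delta> id (\<Delta> x)))"
      by (simp add: tensor_assoc_tensor_map lin)
    also have "\<dots> = tensor_assoc (tensor_map \<Delta>B id (tensor_map \<phi> \<phi> (\<Delta> x)))"
      by (simp add: tensor_map_tensor_map lin \<phi>\<phi>')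
    also have "\<dots> = tensor_map id \<Delta>B (tensor_map \<phi> \<phi> (\<Delta> x))"
      by (simp add: \<phi>\<phi> coassoc)
    also have "\<dots> = tensor_map \<phi> (tensor_map \<phi> \<phi>) (tensor_map id \<Delta> (\<Delta> x))"
      by (simp add: tensor_map_tensor_map lin \<phi>\<phi>')
    finally have *: "tensor_map \<phi> (tensor_map \<phi> \<phi>) (tensor_assoc (tensor_map \<Delta> id (\<Delta> x)))
      = tensor_map \<phi> (tensor_map \<phi> \<phi>) (tensor_map id \<Delta> (\<Delta> x))" .
    have "tensor_map \<psi> \<psi> \<circ> tensor_map \<phi> \<phi> = id"
      by (auto simp: tensor_map_tensor_map lin inverse tensor_map_id)
    hence "tensor_map \<psi> (tensor_map \<psi> \<psi>) (tensor_map \<phi> (tensor_map \<phi> \<phi>) t) = t" for t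
      by (simp add: tensor_map_tensor_map lin inverse tensor_map_id)
    thus ?thesis by (metis *)
  qed
  moreover have "tensor_lift (\<lambda>a b. \<epsilon> a *\<^sub>C b) (\<Delta> x) = x" "tensor_lift (\<lambda>a b. \<epsilon> b *\<^sub>C a) (\<Delta> x) = x"
      for x
  proof -
    note bl = counit_bilinear[OF superalgebra_hom_linear[OF \<epsilon>]] counit_bilinear[OF
        superalgebra_hom_linear[OF \<epsilon>B]]
    have "\<phi> (tensor_lift (\<lambda>a b. \<epsilon> a *\<^sub>C b) t) = tensor_lift (\<lambda>a b. \<epsilon>B a *\<^sub>C b) (tensor_map \<phi> \<phi> t)"
      "\<phi> (tensor_lift (\<lambda>a b. \<epsilon> b *\<^sub>C a) t) = tensor_lift (\<lambda>a b. \<epsilon>B b *\<^sub>C a) (tensor_map \<phi> \<phi> t)"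
          for t
    proof (induction t rule: tensor_induct)
      case (pure a b)
      have "\<epsilon> a = \<epsilon>B (\<phi> a)" for a by (simp add: \<epsilon>_def)
      thus "\<phi> (tensor_lift (\<lambda>a b. \<epsilon> a *\<^sub>C b) (a \<otimes> b))
          = tensor_lift (\<lambda>a b. \<epsilon>B a *\<^sub>C b) (tensor_map \<phi> \<phi> (a \<otimes> b))"
        "\<phi> (tensor_lift (\<lambda>a b. \<epsilon> b *\<^sub>C a) (a \<otimes> b))
            = tensor_lift (\<lambda>a b. \<epsilon>B b *\<^sub>C a) (tensor_map \<phi> \<phi> (a \<otimes> b))"
        unfolding tensor_map_pure[OF lin(1,1)] tensor_lift_pure[OF bl(1)] tensor_lift_pure[OF bl(2)]
          tensor_lift_pure[OF bl(3)] tensor_lift_pure[OF bl(4)]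
        by (simp_all add: complex_linear_simps(2)[OF lin(1)])
    next
      case (add s t)
      {
        case 1
        show ?case using add(1,3)
          by (simp add: tensor_lift_add bl complex_linear_simps(1) lin)
      next
        case 2
        show ?case using add(2,4)
          by (simp add: tensor_lift_add bl complex_linear_simps(1) lin)
      }
    qed
    hence "\<phi> (tensor_lift (\<lambda>a b. \<epsilon> a *\<^sub>C b) (\<Delta> x)) = \<phi> x" "\<phi> (tensor_lift (\<lambda>a b. \<epsilon> b *\<^sub>C a) (\<Delta> x))
        = \<phi> x"
      by (simp_all add: \<phi>\<phi> counit)
    thus "tensor_lift (\<lambda>a b. \<epsilon> a *\<^sub>C b) (\<Delta> x) = x" "tensor_lift (\<lambda>a b. \<epsilon> b *\<^sub>C a) (\<Delta> x) = x"
      by (metis \<psi>\<phi>)+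
  qed
  ultimately show ?thesis
    unfolding \<Delta>_def[symmetric] \<epsilon>_def[symmetric] is_superbialgebra_def using \<Delta> \<epsilon> by blast
qed

lemma reflect_series_map_series:
  fixes F :: "'a::complex_algebra fps" and f :: "'a \<Rightarrow> 'b::complex_algebra"
  shows "complex_linear f \<Longrightarrow> map_series f (reflect_series F) = reflect_series (map_series f F)"
  by (simp add: reflect_series_eq_subst map_series_subst_series)

lemma ring_map_reflect_series: "ring_map (reflect_series :: 'a::complex_algebra fps \<Rightarrow> _)"
  by (simp add: ring_map_def reflect_series_eq_subst subst_series_add subst_series_mult
      subst_series_one)

text \<open>With 1 + Z on the right of F - G, a right inverse is required, while the geometric
  series is a left one. The left inverse of the geometric series turns out to be 1 + Z, so the
  inverse is two-sided.\<close>

lemma alternating_series_solve: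
  fixes F G W Z :: "'a::ring_1 fps"
  assumes "(F - G) * (1 + Z) = W" "fps_nth Z 0 = 0"
  shows "F = G + W * (1 + alternating_series Z)"
proof -
  define A where "A = 1 + alternating_series Z"
  have A: "A * (1 + Z) = 1" unfolding A_def by (rule alternating_series_inverse[OF assms(2)])
  have C: "inverse_series A * A = 1"
    by (rule inverse_series_left) (simp add: A_def alternating_series_def fps_compose_nth)
  have "inverse_series A = inverse_series A * (A * (1 + Z))" by (simp only: A mult_1_right)
  also have "\<dots> = 1 + Z" by (simp only: C mult.assoc[symmetric] mult_1_left)
  finally have "(1 + Z) * A = 1" using C by simp
  hence "(F - G) * ((1 + Z) * A) = F - G" by simp
  hence "F - G = W * A" by (simp only: assms(1) mult.assoc[symmetric])
  thus ?thesis by (simp add: A_def algebra_simps)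
qed

lemma tensor_series_const: "fps_const a \<otimes>\<^sub>s fps_const b = fps_const (a \<otimes> b)"
  for a :: "'a::superalgebra" and b :: "'b::superalgebra"
proof -
  have "left_series (fps_const a) = fps_const (a \<otimes> 1 :: ('a, 'b) tensor)"
    "right_series (fps_const b) = fps_const (1 \<otimes> b :: ('a, 'b) tensor)"
    by (auto intro!: fps_ext simp: left_series_def right_series_def)
  thus ?thesis by (simp add: tensor_series_factor tensor_mult_even_left[OF homog_one])
qed

lemma tensor_series_nth_0: "fps_nth (F \<otimes>\<^sub>s G) 0 = fps_nth F 0 \<otimes> fps_nth G 0"
  by (simp add: tensor_series_def)

text \<open>\<phi> \<otimes> \<phi> is invertible, with inverse built from
  \<open>inv \<phi>\<close>. The explicit solution yields existence and uniqueness of the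
  transported structure at once.\<close>

lemma is_transported_iff:
  assumes "superalgebra_iso \<phi>" "superalgebra_hom \<Delta>U"
  shows "is_transported \<phi> \<Delta>U \<epsilon>U \<Delta> \<epsilon> \<longleftrightarrow> \<Delta> = tensor_map (inv \<phi>) (inv \<phi>) \<circ> \<Delta>U \<circ> \<phi> \<and> \<epsilon> = \<epsilon>U \<circ> \<phi>"
proof -
  have bij: "bij \<phi>" and lin: "complex_linear \<phi>" "complex_linear (inv \<phi>)"
    using assms(1) superalgebra_iso_inv[OF assms(1)]
    by (simp_all add: superalgebra_iso_def superalgebra_hom_def)
  have comp: "inv \<phi> \<circ> \<phi> = id" "\<phi> \<circ> inv \<phi> = id"
    using bij by (simp_all add: bij_is_inj bij_is_surj flip: surj_iff)
  have cancel: "tensor_map \<phi> \<phi> (tensor_map (inv \<phi>) (inv \<phi>) t) = t"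
      "tensor_map (inv \<phi>) (inv \<phi>) (tensor_map \<phi> \<phi> s) = s" for s t
    by (simp_all add: tensor_map_tensor_map lin comp tensor_map_id)
  have "\<Delta>U \<circ> \<phi> = tensor_map \<phi> \<phi> \<circ> \<Delta> \<longleftrightarrow> \<Delta> = tensor_map (inv \<phi>) (inv \<phi>) \<circ> \<Delta>U \<circ> \<phi>"
    unfolding fun_eq_iff comp_apply by (metis cancel)
  thus ?thesis by (simp add: is_transported_def)
qed

theorem proposition3p4:
  fixes \<phi> :: "A_plus \<Rightarrow> U_R"
    and \<Delta>U :: "U_R \<Rightarrow> (U_R, U_R) tensor"
    and \<epsilon>U :: "U_R \<Rightarrow> complex"
  assumes "is_phi \<phi>"
    and "is_U_coalgebra \<Delta>U \<epsilon>U"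
  shows "(\<exists>!p. is_transported \<phi> \<Delta>U \<epsilon>U (fst p) (snd p)) \<and>
    (\<forall>\<Delta> \<epsilon>. is_transported \<phi> \<Delta>U \<epsilon>U \<Delta> \<epsilon> \<longrightarrow>
      is_superbialgebra \<Delta> \<epsilon> \<and>
      map_series \<epsilon> e_series = 0 \<and>
      map_series \<epsilon> f_series = 0 \<and>
      map_series \<epsilon> h_series = 1 \<and>
      map_series \<Delta> e_series =
        e_series \<otimes>\<^sub>s 1
        + (h_series \<otimes>\<^sub>s e_series
           + commutator h_series f_zero \<otimes>\<^sub>s (e_series\<^sup>2 - anticommutator e_series e_zero))
          * (1 \<otimes>\<^sub>s 1 + X12) \<and>
      map_series \<Delta> f_series =
        1 \<otimes>\<^sub>s f_series
        + (f_series \<otimes>\<^sub>s h_series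
           + (f_series\<^sup>2 + anticommutator f_series f_zero) \<otimes>\<^sub>s commutator h_series e_zero)
          * (1 \<otimes>\<^sub>s 1 + Y12) \<and>
      map_series \<Delta> h_series =
        1 \<otimes>\<^sub>s 1
        + anticommutator (map_series \<Delta> e_series) (f_zero \<otimes>\<^sub>s 1 + 1 \<otimes>\<^sub>s f_zero))"
proof (intro conjI allI impI)
  have \<phi>: "superalgebra_iso \<phi>"
    and \<phi>e: "map_series \<phi> (reflect_series e_series) = e_U"
    and \<phi>f: "map_series \<phi> (reflect_series f_series) = f_U"
    and \<phi>h: "map_series \<phi> (reflect_series h_series) = h_U"
    using assms(1) by (simp_all add: is_phi_def Let_def e_U_def f_U_def h_U_def K_series_def)
  have \<Delta>U: "superalgebra_hom \<Delta>U" and \<epsilon>U: "superalgebra_hom \<epsilon>U"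
    and \<Delta>L: "\<And>i j. map_series \<Delta>U (L_series i j) = (\<Sum>k\<in>UNIV. L_series i k \<otimes>\<^sub>s L_series k j)"
    and \<epsilon>L: "\<And>i j. map_series \<epsilon>U (L_series i j) = (if i = j then 1 else 0)"
    using assms(2) by (auto simp: is_U_coalgebra_def)
  note transported = is_transported_iff[OF \<phi> \<Delta>U]
  show "\<exists>!p. is_transported \<phi> \<Delta>U \<epsilon>U (fst p) (snd p)"
    unfolding transported by (auto simp: prod_eq_iff intro!: ex1I)
  have hom: "superalgebra_hom \<phi>" and bij: "bij \<phi>" using \<phi> by (auto simp: superalgebra_iso_def)
  note lin = superalgebra_hom_linear[OF hom]
  fix \<Delta> \<epsilon>
  assume tr: "is_transported \<phi> \<Delta>U \<epsilon>U \<Delta> \<epsilon>"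
  hence \<Delta>: "\<Delta> = tensor_map (inv \<phi>) (inv \<phi>) \<circ> \<Delta>U \<circ> \<phi>" and \<epsilon>: "\<epsilon> = \<epsilon>U \<circ> \<phi>"
    by (simp_all add: transported)
  show bialg: "is_superbialgebra \<Delta> \<epsilon>"
    unfolding \<Delta> \<epsilon> by (rule superbialgebra_transport[OF \<phi> U_bialgebra[OF assms(2)]])
  hence \<Delta>_hom: "superalgebra_hom \<Delta>" and \<epsilon>_hom: "superalgebra_hom \<epsilon>"
    by (simp_all add: is_superbialgebra_def)
  note epsilon_simps = ring_map_simps[OF ring_map_map_hom[OF \<epsilon>U]]
  \<comment> \<open>\<phi> is given on e(-u), f(-u) and h(-u), hence the detour through a double
    reflection.\<close>
  have \<epsilon>_eq: "map_series \<epsilon> F = reflect_series (map_series \<epsilon>U (map_series \<phi> (reflect_series F)))"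
      for F
    by (simp add: reflect_series_map_series lin superalgebra_hom_linear[OF \<epsilon>U]
        reflect_series_reflect_series
        \<epsilon> map_series_comp)
  have \<epsilon>K: "map_series \<epsilon>U K_series = 1"
    using arg_cong[OF K_series_inverse(1), of "map_series \<epsilon>U"] by (simp add: epsilon_simps \<epsilon>L)
  note reflect_simps = ring_map_simps[OF ring_map_reflect_series]
  show "map_series \<epsilon> e_series = 0" "map_series \<epsilon> f_series = 0" "map_series \<epsilon> h_series = 1"
    by (simp_all add: \<epsilon>_eq \<phi>e \<phi>f \<phi>h e_U_def f_U_def h_U_def epsilon_simps \<epsilon>L \<epsilon>K reflect_simps)
  \<comment> \<open>The reflection undoes the sign of u in the definition of \<phi>, so e, f, h
    correspond to \<open>e_U\<close>, \<open>f_U\<close>, \<open>h_U\<close>. Both maps are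
    injective ring maps, so identities over A^+ can be checked over U(R).\<close>
  define \<Phi> where "\<Phi> = (\<lambda>F :: A_plus fps. reflect_series (map_series \<phi> F))"
  define \<Phi>2 where "\<Phi>2 = (\<lambda>F :: (A_plus, A_plus) tensor fps. reflect_series (map_series (tensor_map \<phi>
      \<phi>) F))"
  note hom2 = superalgebra_hom_tensor_map[OF hom hom]
  have \<Phi>: "ring_map \<Phi>" unfolding \<Phi>_def
    by (rule ring_map_compose[OF ring_map_map_hom[OF hom] ring_map_reflect_series])
  have \<Phi>2: "ring_map \<Phi>2" unfolding \<Phi>2_def
    by (rule ring_map_compose[OF ring_map_map_hom[OF hom2] ring_map_reflect_series])
  note simps = ring_map_simps[OF \<Phi>] ring_map_simps[OF \<Phi>2]
  have gens: "\<Phi> e_series = e_U" "\<Phi> f_series = f_U" "\<Phi> h_series = h_U"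
    using \<phi>e \<phi>f \<phi>h by (simp_all add: \<Phi>_def reflect_series_map_series lin)
  \<comment> \<open>f(u - 1) corresponds to \<open>f_U\<close> at u + 1, and e(u + 1) to
    \<open>e_U\<close> at u - 1.\<close>
  have shift: "\<Phi> (shift_series c F) = shift_series (- c) (\<Phi> F)" for c F
  proof -
    have "map_series \<phi> (shift_series c F) = shift_series c (map_series \<phi> F)"
      by (simp add: shift_series_eq_subst map_series_subst_series lin)
    thus ?thesis by (simp add: \<Phi>_def reflect_series_shift_series)
  qed
  have tensor: "\<Phi>2 (F \<otimes>\<^sub>s G) = \<Phi> F \<otimes>\<^sub>s \<Phi> G" for F G
    by (simp add: \<Phi>2_def \<Phi>_def map_series_tensor_map[OF hom hom] reflect_series_eq_subst
        subst_series_tensor_series)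
  have const: "\<Phi> (fps_const a) = fps_const (\<phi> a)" for a
  proof -
    have "map_series \<phi> (fps_const a) = fps_const (\<phi> a)"
      by (rule fps_ext) (simp add: complex_linear_simps(3)[OF lin])
    thus ?thesis by (simp add: \<Phi>_def reflect_series_eq_subst subst_series_const)
  qed
  \<comment> \<open>Reflection negates the coefficient of u^-1; this is why e_0 and f_0 correspond
    to minus the modes of L.\<close>
  have nth_1: "fps_nth (\<Phi> F) 1 = - \<phi> (fps_nth F 1)" for F
    by (simp add: \<Phi>_def reflect_series_eq_subst subst_series_def scaleC_minus_left scaleC_one)
  have L1: "fps_nth (L_series i j) 0 = (if i = j then 1 else 0)" "fps_nth (L_series i j) 1
      = gen (gen_L i j 0)" for i j
    by (simp_all add: L_series_def series_of_def)
  have K0: "fps_nth K_series 0 = 1"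
    using arg_cong[OF K_series_inverse(1), of "\<lambda>F. fps_nth F 0"] by (simp add: L1)
  have "\<phi> (gen (gen_e 0)) = - gen (gen_L 2 3 0)" "\<phi> (gen (gen_f 0)) = - gen (gen_L 3 2 0)"
    using nth_1[of e_series] nth_1[of f_series] unfolding gens
    by (simp_all add: e_U_def f_U_def fps_mult_nth_1 L1[simplified] K0 e_series_def f_series_def
        series_of_def)
  hence zeros: "\<Phi> e_zero = - L_mode 2 3" "\<Phi> f_zero = - L_mode 3 2"
    by (simp_all add: e_zero_def f_zero_def const L_mode_def)
  have inj: "F = G" if "\<Phi>2 F = \<Phi>2 G" for F G
  proof -
    have "tensor_map (inv \<phi>) (inv \<phi>) (tensor_map \<phi> \<phi> t) = t" for t
      using bij by (simp add: tensor_map_tensor_map lin superalgebra_hom_linear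
          superalgebra_iso_inv[OF \<phi>]
          bij_is_inj tensor_map_id)
    hence "map_series (tensor_map (inv \<phi>) (inv \<phi>)) (reflect_series (\<Phi>2 H)) = H" for H
      by (intro fps_ext) (simp add: \<Phi>2_def reflect_series_reflect_series)
    thus ?thesis using that by metis
  qed
  have inj1: "F = G" if "\<Phi> F = \<Phi> G" for F G
  proof -
    have "map_series (inv \<phi>) (reflect_series (\<Phi> H)) = H" for H
      using bij by (intro fps_ext) (simp add: \<Phi>_def reflect_series_reflect_series bij_is_inj)
    thus ?thesis using that by metis
  qed
  have \<phi>\<phi>: "tensor_map \<phi> \<phi> (\<Delta> x) = \<Delta>U (\<phi> x)" for x
    using tr by (simp add: is_transported_def fun_eq_iff)
  have coproduct: "\<Phi>2 (map_series \<Delta> F) = map_series \<Delta>U (\<Phi> F)" for F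
  proof -
    have "map_series (tensor_map \<phi> \<phi>) (map_series \<Delta> F) = map_series \<Delta>U (map_series \<phi> F)"
      by (rule fps_ext) (simp add: \<phi>\<phi>)
    thus ?thesis by (simp add: \<Phi>2_def \<Phi>_def reflect_series_map_series superalgebra_hom_linear[OF
        \<Delta>U])
  qed
  note transfer = simps coproduct tensor gens shift zeros commutator_def anticommutator_def
      power2_eq_square
  show "map_series \<Delta> e_series =
        e_series \<otimes>\<^sub>s 1
        + (h_series \<otimes>\<^sub>s e_series
           + commutator h_series f_zero \<otimes>\<^sub>s (e_series\<^sup>2 - anticommutator e_series e_zero))
          * (1 \<otimes>\<^sub>s 1 + X12)"
    unfolding X12_def Let_def tensor_series_simps(7)
  proof (rule alternating_series_solve[OF inj])
    show "\<Phi>2 ((map_series \<Delta> e_series - e_series \<otimes>\<^sub>s 1) *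
      (1 + (shift_series (- 1) f_series \<otimes>\<^sub>s e_series +
         ((shift_series (- 1) f_series)\<^sup>2 + anticommutator (shift_series (- 1) f_series) f_zero) \<otimes>\<^sub>s
           (e_series\<^sup>2 - anticommutator e_series e_zero))))
      = \<Phi>2 (h_series \<otimes>\<^sub>s e_series + commutator h_series f_zero \<otimes>\<^sub>s (e_series\<^sup>2
          - anticommutator e_series e_zero))"
      using U_coproduct_e[OF assms(2)] by (simp add: transfer)
  \<comment> \<open>The remaining condition: e(u) starts at u^-1, so the argument of the geometric
    series has no constant term.\<close>
  qed (simp add: tensor_series_nth_0 e_series_def series_of_def anticommutator_def power2_eq_square)
  show "map_series \<Delta> f_series =
        1 \<otimes>\<^sub>s f_series
        + (f_series \<otimes>\<^sub>s h_series
           + (f_series\<^sup>2 + anticommutator f_series f_zero) \<otimes>\<^sub>s commutator h_series e_zero)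
          * (1 \<otimes>\<^sub>s 1 + Y12)"
    unfolding Y12_def Let_def tensor_series_simps(7)
  proof (rule alternating_series_solve[OF inj])
    show "\<Phi>2 ((map_series \<Delta> f_series - 1 \<otimes>\<^sub>s f_series) *
      (1 + (f_series \<otimes>\<^sub>s shift_series 1 e_series +
         (f_series\<^sup>2 + anticommutator f_series f_zero) \<otimes>\<^sub>s
           ((shift_series 1 e_series)\<^sup>2 - anticommutator (shift_series 1 e_series) e_zero))))
      = \<Phi>2 (f_series \<otimes>\<^sub>s h_series + (f_series\<^sup>2
          + anticommutator f_series f_zero) \<otimes>\<^sub>s commutator h_series e_zero)"
      using U_coproduct_f[OF assms(2)] by (simp add: transfer)
  qed (simp add: tensor_series_nth_0 f_series_def series_of_def anticommutator_def power2_eq_square)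
  show "map_series \<Delta> h_series =
        1 \<otimes>\<^sub>s 1
        + anticommutator (map_series \<Delta> e_series) (f_zero \<otimes>\<^sub>s 1 + 1 \<otimes>\<^sub>s f_zero)"
  proof -
    \<comment> \<open>Injectivity turns the relation between \<open>e_U\<close> and
      \<open>h_U\<close> into one over A^+. As \<Delta> is multiplicative, only \<Delta>(f_0) is
      still missing.\<close>
    have "h_series = 1 + anticommutator e_series f_zero"
      by (rule inj1) (use anticommutator_e_U in \<open>simp add: transfer\<close>)
    hence "map_series \<Delta> h_series = map_series \<Delta> (1 + anticommutator e_series f_zero)"
      by (rule arg_cong)
    hence "map_series \<Delta> h_series = 1 + anticommutator (map_series \<Delta> e_series) (map_series \<Delta> f_zero)"
      by (simp only: anticommutator_def ring_map_simps[OF ring_map_map_hom[OF \<Delta>_hom]])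
    moreover have "map_series \<Delta> f_zero = f_zero \<otimes>\<^sub>s 1 + 1 \<otimes>\<^sub>s f_zero"
    proof (rule inj)
      \<comment> \<open>At order u^-1 only L^32 \<otimes> L^22 and L^33 \<otimes> L^32 contribute,
        since L^31 and L^12 have no constant term. Hence f_0 is primitive.\<close>
      have "fps_nth (map_series \<Delta>U (L_series 3 2)) 1
          = gen (gen_L 3 2 0) \<otimes> 1 + 1 \<otimes> gen (gen_L 3 2 0)"
        unfolding \<Delta>L
        by (simp add: sum_3 tensor_series_def L1[simplified])
      hence "map_series \<Delta>U (L_mode 3 2)
          = fps_const (gen (gen_L 3 2 0) \<otimes> 1 + 1 \<otimes> gen (gen_L 3 2 0))"
        by (intro fps_ext) (simp add: L_mode_def L1[simplified] complex_linear_simps(3)[OF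
            superalgebra_hom_linear[OF \<Delta>U]])
      also have "\<dots> = L_mode 3 2 \<otimes>\<^sub>s 1 + 1 \<otimes>\<^sub>s L_mode 3 2"
        using tensor_series_const[of "gen (gen_L 3 2 0)" "1 :: U_R"]
          tensor_series_const[of "1 :: U_R" "gen (gen_L 3 2 0)"] by (simp add: L_mode_def)
      finally have "map_series \<Delta>U (L_mode 3 2) = L_mode 3 2 \<otimes>\<^sub>s 1 + 1 \<otimes>\<^sub>s L_mode 3 2" .
      thus "\<Phi>2 (map_series \<Delta> f_zero) = \<Phi>2 (f_zero \<otimes>\<^sub>s 1 + 1 \<otimes>\<^sub>s f_zero)"
        by (simp add: transfer ring_map_simps[OF ring_map_map_hom[OF \<Delta>U]] tensor_series_simps)
    qed
    ultimately show ?thesis by (simp add: tensor_series_simps)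
  qed
qed

end
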